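(* Let $\beta>-d/2$, $f\equiv\mathbf{1}_W$ and assume that $$\limsup_{r\to 0} \frac{\operatorname{Vol}(\{x\in W: d(x,\partial W)\leq r\})}{r}<\infty.$$ (a) If $n^2 r_n^d\to\infty$ and $nr_n^{d+1}\to 0$ as $n\to\infty$, then $$\frac{L_n(\beta)-\frac{n(n-1)}{2} \int_{W^2} \mathbf{1}\{\|x-y\|\leq r_n\} \, \|x-y\|^\beta\, \mathrm{d}(x,y)}{\sqrt{\frac{d\kappa_d}{2(2\beta+d)} }\,n r_n^{\beta+d/2}} \overset{\mathcal{D}}{\longrightarrow} N(0,1) \quad \text{as} \quad n\to\infty.$$ (b) If $n^2 r_n^d\to\infty$ and $n^2 r_n^{d+2}\to0$ as $n\to\infty$, then $$\frac{L_n(\beta)-\frac{d\kappa_d}{2(\beta+d)} \, n(n-1) r_n^{\beta+d}}{\sqrt{\frac{d\kappa_d}{2(2\beta+d)} }\,n r_n^{\beta+d/2}} \overset{\mathcal{D}}{\longrightarrow} N(0,1) \quad \text{as} \quad n\to\infty.$$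
   Context: Let $d\ge 1$ and let $W\subset\mathbb{R}^d$ be a measurable set with volume (Lebesgue measure) $\operatorname{Vol}(W)=1$. Let $f$ be a probability density on $\mathbb{R}^d$ whose support is contained in $W$. For $n\ge 2$ let $\mathscr{X}_n=\{X_1,\ldots,X_n\}$, where $X_1,\ldots,X_n$ are i.i.d. random vectors with density $f$. Let $(r_n)$ be a sequence of positive real numbers with $r_n\to0$ as $n\to\infty$. For $\beta\in\mathbb{R}$ define $$L_n(\beta):=\frac12\sum_{(x,y)\in\mathscr{X}^2_{n,\neq}}\mathbf{1}\{\|x-y\|\le r_n\}\,\|x-y\|^\beta,$$ where the sum is over all ordered pairs of distinct points of $\mathscr{X}_n$, $\|\cdot\|$ is the Euclidean norm and $\mathbf{1}\{\cdot\}$ is the indicator. $\kappa_d=\pi^{d/2}/\Gamma(d/2+1)$ is the volume of the $d$-dimensional unit ball. $\partial W$ is the boundary of $W$ and $d(x,A):=\inf_{y\in A}\|x-y\|$. $g\equiv h$ means $g=h$ almost everywhere on $W$; $\mathbf{1}_W$ is the indicator function of $W$ (so $f\equiv\mathbf{1}_W$ is the case of i.i.d. uniform points in $W$). $\overset{\mathcal{D}}{\longrightarrow}$ denotes convergence in distribution and $N(0,1)$ a standard Gaussian random variable. *)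

theory Defs
  imports "HOL-Probability.Probability"
begin

text \<open>
  The sum ranges over ordered pairs of distinct points (hence the factor one half), so that the
  base of \<open>powr\<close> is positive in every summand and the convention \<open>0 powr \<beta> = 0\<close> plays no role.
\<close>

definition edge_length_functional :: "real \<Rightarrow> real \<Rightarrow> 'a::euclidean_space set \<Rightarrow> real" where
  "edge_length_functional \<beta> \<rho> P =
     1 / 2 * (\<Sum>(x, y)\<in>{(x, y). x \<in> P \<and> y \<in> P \<and> x \<noteq> y}.
                of_bool (norm (x - y) \<le> \<rho>) * norm (x - y) powr \<beta>)"

end

theory Submission
  imports Defs
begin

text \<open>
  With probability one the \<open>n\<close> points are distinct, and then the functional is the U-statistic
  \<open>\<Sum>i<j. h (X i) (X j)\<close> of the edge kernel \<open>h\<close>. Put \<open>g x = \<integral>h x y dy\<close>, where \<open>y\<close> has the law of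
  the points, and \<open>\<theta> = \<integral>g\<close>. Hoeffding's decomposition (\<open>U_sum_hoeffding\<close>) writes the centred
  functional as the sum over all pairs of the degenerate kernel \<open>h x y - g x - g y + \<theta>\<close>, plus
  \<open>(n - 1) * (\<Sum>i. g (X i) - \<theta>)\<close>.

  The linear part vanishes in the limit because \<open>g\<close> is nearly constant. A point whose distance to
  the boundary of \<open>W\<close> exceeds the radius \<open>\<rho>\<close> sees a full ball, so that \<open>g\<close> equals the ball integral
  \<open>ball_moment\<close>, of order \<open>\<rho> powr (\<beta> + d)\<close>; by the assumption on \<open>\<partial>W\<close> the other points have
  probability \<open>O(\<rho>)\<close> (\<open>near_uniform_N\<close>). The linear part therefore has variance
  \<open>O(n^3 \<rho> powr (2 \<beta> + 2 d + 1))\<close>. The normalizing variance has order \<open>n^2 \<rho> powr (2 \<beta> + d)\<close>, and the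
  quotient is of order \<open>n \<rho>^(d + 1)\<close>, which is the hypothesis of the first claim. For the same
  reason \<open>\<theta>\<close> differs from the ball integral by a factor \<open>1 + O(\<rho>)\<close>; replacing one by the other
  shifts the normalized functional by \<open>O(sqrt (n^2 \<rho>^(d + 2)))\<close>, which is the hypothesis of the
  second claim.

  The core is a quantitative central limit theorem for a bounded degenerate kernel \<open>K\<close>
  (\<open>char_U_sum_approx\<close>). Reveal the points one at a time. The pairs formed by the new point and the
  earlier ones contribute a row sum \<open>Y k = \<Sum>i<k. K (X i) (X k)\<close> whose mean given the past is zero.
  In the characteristic function the factors \<open>exp (\<i> t Y k)\<close> are replaced, last one first, by
  \<open>exp (- t\<^sup>2 E(Y k)\<^sup>2 / 2)\<close>. Each replacement costs a third moment of \<open>Y k\<close> and the mean absolute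
  deviation of its conditional variance. For these statistics each single conditional variance is
  so concentrated that the sum of the deviations over \<open>k\<close> is still small:
  up to a centred i.i.d. sum, the deviation is again the U-statistic of a degenerate kernel, namely
  of \<open>K\<close> composed with itself, and second moments of such sums are explicit. All errors are expressed
  by a bound \<open>b\<close> for \<open>K\<close> and a bound \<open>m\<close> for the \<open>L\<^sup>1\<close> norms of its sections. For the normalized edge
  kernel \<open>b\<close> has order \<open>1 / (n \<rho> powr (d / 2))\<close> and \<open>m\<close> has order \<open>\<rho> powr (d / 2) / n\<close>, and the errors
  become powers of \<open>1 / (n\<^sup>2 \<rho>^d)\<close>, of \<open>1 / n\<close> and of \<open>\<rho>^d\<close>.

  For negative \<open>\<beta>\<close> the edge kernel is unbounded and only its square is integrable. The limit theorem
  is therefore applied to edges longer than \<open>\<delta> * \<rho>\<close>. The shorter edges carry the fraction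
  \<open>\<delta> powr (2 \<beta> + d)\<close> of the variance, because the edge kernel is homogeneous, and \<open>\<delta>\<close> tends to \<open>0\<close>
  after \<open>n\<close> tends to infinity (\<open>char_edge_sum_estimate\<close>, \<open>char_edge_sum_tendsto\<close>). Convergence in
  distribution then follows from Levy's continuity theorem.
\<close>

section \<open>Square-integrable functions\<close>

lemma abs_mult_le_sum_squares: "\<bar>a * b\<bar> \<le> a\<^sup>2 + (b::real)\<^sup>2"
proof -
  have "0 \<le> (\<bar>a\<bar> - \<bar>b\<bar>)\<^sup>2" by simp
  then have "2 * \<bar>a * b\<bar> \<le> a\<^sup>2 + b\<^sup>2" by (simp add: power2_diff abs_mult)
  then show ?thesis using abs_ge_zero[of "a * b"] by linarith
qed

lemma integrable_mult_of_squares: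
  fixes f g :: "'a \<Rightarrow> real"
  assumes [measurable]: "f \<in> borel_measurable M" "g \<in> borel_measurable M"
    and "integrable M (\<lambda>x. (f x)\<^sup>2)" "integrable M (\<lambda>x. (g x)\<^sup>2)"
  shows "integrable M (\<lambda>x. f x * g x)"
  by (rule Bochner_Integration.integrable_bound[where f="\<lambda>x. (f x)\<^sup>2 + (g x)\<^sup>2"])
     (use assms abs_mult_le_sum_squares in \<open>auto intro!: AE_I2\<close>)

lemma square_sum_integrable:
  fixes f g :: "'a \<Rightarrow> real"
  assumes [measurable]: "f \<in> borel_measurable M" "g \<in> borel_measurable M"
    and "integrable M (\<lambda>x. (f x)\<^sup>2)" "integrable M (\<lambda>x. (g x)\<^sup>2)"
  shows "integrable M (\<lambda>x. (f x + g x)\<^sup>2)"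
  unfolding power2_sum using assms integrable_mult_of_squares[OF assms]
  by (simp add: mult.assoc)

lemma square_sum_integrable_finite:
  fixes f :: "'i \<Rightarrow> 'a \<Rightarrow> real"
  assumes "finite I" and "\<And>i. i \<in> I \<Longrightarrow> f i \<in> borel_measurable M"
    and "\<And>i. i \<in> I \<Longrightarrow> integrable M (\<lambda>x. (f i x)\<^sup>2)"
  shows "integrable M (\<lambda>x. (\<Sum>i\<in>I. f i x)\<^sup>2)"
  using assms by (induction I rule: finite_induct) (simp_all add: square_sum_integrable)

lemma (in finite_measure) integrable_of_square:
  fixes f :: "'a \<Rightarrow> real"
  assumes "f \<in> borel_measurable M" and "integrable M (\<lambda>x. (f x)\<^sup>2)"
  shows "integrable M f"
  using integrable_mult_of_squares[of f M "\<lambda>_. 1"] assms by simp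

text \<open>
  The Cauchy-Schwarz inequality: the quadratic polynomial \<open>s \<mapsto> \<integral>(s * \<bar>f\<bar> - \<bar>g\<bar>)\<^sup>2\<close> has no negative
  value.
\<close>

lemma integral_mult_le_sqrt:
  fixes f g :: "'a \<Rightarrow> real"
  assumes [measurable]: "f \<in> borel_measurable M" "g \<in> borel_measurable M"
    and "integrable M (\<lambda>x. (f x)\<^sup>2)" "integrable M (\<lambda>x. (g x)\<^sup>2)"
  shows "(\<integral>x. \<bar>f x * g x\<bar> \<partial>M) \<le> sqrt (\<integral>x. (f x)\<^sup>2 \<partial>M) * sqrt (\<integral>x. (g x)\<^sup>2 \<partial>M)"
proof -
  let ?F = "\<integral>x. (f x)\<^sup>2 \<partial>M" and ?G = "\<integral>x. (g x)\<^sup>2 \<partial>M" and ?P = "\<integral>x. \<bar>f x * g x\<bar> \<partial>M"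
  note int = integrable_mult_of_squares[OF assms, THEN integrable_abs]
  have F: "0 \<le> ?F" and G: "0 \<le> ?G" and P: "0 \<le> ?P" by auto
  have "0 \<le> ?F * s\<^sup>2 - 2 * ?P * s + ?G" for s
  proof -
    have "0 \<le> (\<integral>x. (\<bar>f x\<bar> * s - \<bar>g x\<bar>)\<^sup>2 \<partial>M)" by simp
    also have "\<dots> = (\<integral>x. (f x)\<^sup>2 * s\<^sup>2 - 2 * s * \<bar>f x * g x\<bar> + (g x)\<^sup>2 \<partial>M)"
      by (intro Bochner_Integration.integral_cong) (auto simp: power2_diff power_mult_distrib abs_mult)
    also have "\<dots> = ?F * s\<^sup>2 - 2 * ?P * s + ?G" using assms int by simp
    finally show ?thesis .
  qed
  note quad = this
  have "?P\<^sup>2 \<le> ?F * ?G"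
  proof (cases "?F = 0")
    case True
    then have "2 * ?P * s \<le> ?G" for s using quad[of s] by simp
    note lin = this
    have "?P = 0"
    proof (rule ccontr)
      assume "?P \<noteq> 0"
      then have "2 * ?P * (?G / ?P + 1) = 2 * ?G + 2 * ?P" by (simp add: field_simps)
      with lin[of "?G / ?P + 1"] \<open>?P \<noteq> 0\<close> P G show False by linarith
    qed
    with True show ?thesis by simp
  next
    case False
    with F have "0 < ?F" by (metis less_le)
    with quad[of "?P / ?F"] show ?thesis by (simp add: field_simps power2_eq_square)
  qed
  then show ?thesis using P by (metis real_le_rsqrt real_sqrt_mult)
qed

lemma (in prob_space) expectation_abs_le_sqrt:
  fixes f :: "'a \<Rightarrow> real"
  assumes "f \<in> borel_measurable M" "integrable M (\<lambda>x. (f x)\<^sup>2)"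
  shows "expectation (\<lambda>x. \<bar>f x\<bar>) \<le> sqrt (expectation (\<lambda>x. (f x)\<^sup>2))"
  using integral_mult_le_sqrt[of f M "\<lambda>_. 1"] assms by (simp add: prob_space)

section \<open>Independent samples and their past\<close>

locale iid_sample = prob_space M + N: prob_space N
  for M :: "'w measure" and N :: "'b measure" +
  fixes X :: "nat \<Rightarrow> 'w \<Rightarrow> 'b"
  assumes indep: "indep_vars (\<lambda>_. N) X UNIV"
    and distr_X: "\<And>i. distr M N (X i) = N"
begin

lemma X_measurable [measurable]: "X i \<in> measurable M N"
  using indep by (auto simp: indep_vars_def)

definition past :: "nat \<Rightarrow> 'w \<Rightarrow> nat \<Rightarrow> 'b" where
  "past k \<omega> = restrict (\<lambda>i. X i \<omega>) {..<k}"

abbreviation past_space :: "nat \<Rightarrow> (nat \<Rightarrow> 'b) measure" where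
  "past_space k \<equiv> PiM {..<k} (\<lambda>_. N)"

lemma past_measurable [measurable]: "past k \<in> measurable M (past_space k)"
  unfolding past_def by (rule measurable_restrict) simp

lemma past_apply: "i < k \<Longrightarrow> past k \<omega> i = X i \<omega>" by (simp add: past_def)

lemma distr_pair:
  assumes "i \<noteq> j"
  shows "distr M (N \<Otimes>\<^sub>M N) (\<lambda>\<omega>. (X i \<omega>, X j \<omega>)) = N \<Otimes>\<^sub>M N"
proof -
  let ?Xi = "\<lambda>\<omega>. restrict (\<lambda>l. X l \<omega>) {i}" and ?Xj = "\<lambda>\<omega>. restrict (\<lambda>l. X l \<omega>) {j}"
  have "indep_var (PiM {i} (\<lambda>_. N)) ?Xi (PiM {j} (\<lambda>_. N)) ?Xj"
    by (rule indep_var_restrict[OF indep]) (use assms in auto)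
  from indep_var_compose[OF this, of "\<lambda>f. f i" N "\<lambda>f. f j" N]
  have "indep_var N (X i) N (X j)" by (simp add: comp_def)
  then show ?thesis using distr_X unfolding indep_var_distribution_eq by simp
qed

text \<open>
  The predicate \<open>indep_var\<close> relates variables with values in one common type, so the fresh point
  first enters as a function on the singleton \<open>{k}\<close> and is evaluated afterwards.
\<close>

lemma distr_past_fresh:
  "distr M (past_space k \<Otimes>\<^sub>M N) (\<lambda>\<omega>. (past k \<omega>, X k \<omega>)) = distr M (past_space k) (past k) \<Otimes>\<^sub>M N"
proof -
  let ?single = "\<lambda>\<omega>. restrict (\<lambda>i. X i \<omega>) {k}" and ?S = "PiM {k} (\<lambda>_. N)"
  let ?D = "distr M (past_space k) (past k)" and ?E = "distr M ?S ?single"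
  have "indep_var (past_space k) (past k) ?S ?single"
    unfolding past_def by (rule indep_var_restrict[OF indep]) auto
  then have joint: "?D \<Otimes>\<^sub>M ?E = distr M (past_space k \<Otimes>\<^sub>M ?S) (\<lambda>\<omega>. (past k \<omega>, ?single \<omega>))"
    and single [measurable]: "?single \<in> measurable M ?S"
    unfolding indep_var_distribution_eq by auto
  have E: "distr ?E N (\<lambda>f. f k) = N"
    by (subst distr_distr) (simp_all add: comp_def distr_X)
  have "?D \<Otimes>\<^sub>M N = distr ?D ?D (\<lambda>u. u) \<Otimes>\<^sub>M distr ?E N (\<lambda>f. f k)" by (simp add: E)
  also have "\<dots> = distr (?D \<Otimes>\<^sub>M ?E) (?D \<Otimes>\<^sub>M N) (\<lambda>(u, f). (u, f k))"
    by (rule pair_measure_distr) (simp_all add: E N.sigma_finite_measure_axioms)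
  also have "\<dots> = distr M (?D \<Otimes>\<^sub>M N) (\<lambda>\<omega>. (past k \<omega>, X k \<omega>))"
    unfolding joint by (subst distr_distr) (auto simp: comp_def)
  also have "\<dots> = distr M (past_space k \<Otimes>\<^sub>M N) (\<lambda>\<omega>. (past k \<omega>, X k \<omega>))"
    by (rule distr_cong) (auto intro!: sets_pair_measure_cong)
  finally show ?thesis by simp
qed

text \<open>
  These rules do the work of conditional expectations. The fresh point \<open>X k\<close> is independent of the
  past, so by Fubini either of the two may be integrated first. Martingale arguments integrate the
  fresh point first; moments of a row sum integrate the past first, because for a fixed value of the
  fresh point the row is an i.i.d. sum.
\<close>

lemma
  fixes \<Phi> :: "(nat \<Rightarrow> 'b) \<times> 'b \<Rightarrow> 'c::{banach, second_countable_topology}"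
  assumes meas: "\<Phi> \<in> borel_measurable (past_space k \<Otimes>\<^sub>M N)"
    and int: "integrable M (\<lambda>\<omega>. \<Phi> (past k \<omega>, X k \<omega>))"
  shows integrable_fresh_inner: "integrable M (\<lambda>\<omega>. \<integral>z. \<Phi> (past k \<omega>, z) \<partial>N)"
    and expectation_fresh_inner: "expectation (\<lambda>\<omega>. \<Phi> (past k \<omega>, X k \<omega>)) =
          expectation (\<lambda>\<omega>. \<integral>z. \<Phi> (past k \<omega>, z) \<partial>N)"
    and expectation_fresh_outer: "expectation (\<lambda>\<omega>. \<Phi> (past k \<omega>, X k \<omega>)) =
          (\<integral>z. expectation (\<lambda>\<omega>. \<Phi> (past k \<omega>, z)) \<partial>N)"
    and integrable_fresh_outer: "integrable N (\<lambda>z. expectation (\<lambda>\<omega>. \<Phi> (past k \<omega>, z)))"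
proof -
  note [measurable] = meas
  let ?D = "distr M (past_space k) (past k)"
  interpret D: prob_space ?D by (rule prob_space_distr) simp
  interpret square: pair_prob_space ?D N ..
  have m: "(\<lambda>\<omega>. (past k \<omega>, X k \<omega>)) \<in> measurable M (past_space k \<Otimes>\<^sub>M N)" by measurable
  have sD: "sets (?D \<Otimes>\<^sub>M N) = sets (past_space k \<Otimes>\<^sub>M N)" by (rule sets_pair_measure_cong) auto
  have i: "integrable (?D \<Otimes>\<^sub>M N) \<Phi>"
    using int by (simp add: distr_past_fresh[symmetric] integrable_distr_eq[OF m meas])
  have e: "expectation (\<lambda>\<omega>. \<Phi> (past k \<omega>, X k \<omega>)) = integral\<^sup>L (?D \<Otimes>\<^sub>M N) \<Phi>"
    by (simp add: distr_past_fresh[symmetric] integral_distr[OF m meas])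
  have mi: "(\<lambda>u. \<integral>z. \<Phi> (u, z) \<partial>N) \<in> borel_measurable (past_space k)"
    by (rule N.borel_measurable_lebesgue_integral) simp
  show "integrable M (\<lambda>\<omega>. \<integral>z. \<Phi> (past k \<omega>, z) \<partial>N)"
    using square.integrable_fst'[OF i] by (simp add: integrable_distr_eq[OF past_measurable mi])
  show "expectation (\<lambda>\<omega>. \<Phi> (past k \<omega>, X k \<omega>)) = expectation (\<lambda>\<omega>. \<integral>z. \<Phi> (past k \<omega>, z) \<partial>N)"
    unfolding e square.integral_fst'[OF i, symmetric] by (rule integral_distr[OF past_measurable mi])
  have i2: "integrable (?D \<Otimes>\<^sub>M N) (case_prod (\<lambda>u z. \<Phi> (u, z)))" using i by simp
  have eq: "(\<integral>u. \<Phi> (u, z) \<partial>?D) = expectation (\<lambda>\<omega>. \<Phi> (past k \<omega>, z))" if "z \<in> space N" for z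
    by (rule integral_distr[OF past_measurable]) (use that in measurable)
  have "(\<integral>z. (\<integral>u. \<Phi> (u, z) \<partial>?D) \<partial>N) = (\<integral>z. expectation (\<lambda>\<omega>. \<Phi> (past k \<omega>, z)) \<partial>N)"
    by (rule Bochner_Integration.integral_cong) (use eq in auto)
  then show "expectation (\<lambda>\<omega>. \<Phi> (past k \<omega>, X k \<omega>)) = (\<integral>z. expectation (\<lambda>\<omega>. \<Phi> (past k \<omega>, z)) \<partial>N)"
    unfolding e using square.integral_snd[OF i2] by simp
  show "integrable N (\<lambda>z. expectation (\<lambda>\<omega>. \<Phi> (past k \<omega>, z)))"
    using square.integrable_snd[OF i2] by (rule Bochner_Integration.integrable_cong[THEN iffD1, rotated -1]) (use eq in auto)
qed

lemma integrable_X_iff: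
  fixes \<psi> :: "'b \<Rightarrow> 'c::{banach, second_countable_topology}"
  assumes "\<psi> \<in> borel_measurable N"
  shows "integrable M (\<lambda>\<omega>. \<psi> (X i \<omega>)) \<longleftrightarrow> integrable N \<psi>"
  using integrable_distr_eq[OF X_measurable assms, of i] by (simp add: distr_X)

lemma expectation_X:
  fixes \<psi> :: "'b \<Rightarrow> 'c::{banach, second_countable_topology}"
  assumes "\<psi> \<in> borel_measurable N"
  shows "expectation (\<lambda>\<omega>. \<psi> (X i \<omega>)) = integral\<^sup>L N \<psi>"
  using integral_distr[OF X_measurable assms, of i] by (simp add: distr_X)

lemma integrable_pair_iff:
  fixes K :: "'b \<Rightarrow> 'b \<Rightarrow> real"
  assumes "case_prod K \<in> borel_measurable (N \<Otimes>\<^sub>M N)" "i \<noteq> j"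
  shows "integrable M (\<lambda>\<omega>. K (X i \<omega>) (X j \<omega>)) \<longleftrightarrow> integrable (N \<Otimes>\<^sub>M N) (case_prod K)"
  using integrable_distr_eq[of "\<lambda>\<omega>. (X i \<omega>, X j \<omega>)" M "N \<Otimes>\<^sub>M N" "case_prod K"] assms
  by (simp add: distr_pair)

lemma X_in_space: "\<omega> \<in> space M \<Longrightarrow> X i \<omega> \<in> space N"
  using measurable_space[OF X_measurable] .

lemma
  fixes \<psi> :: "'b \<Rightarrow> real"
  assumes meas [measurable]: "\<psi> \<in> borel_measurable N"
    and sq: "integrable N (\<lambda>x. (\<psi> x)\<^sup>2)" and mean: "integral\<^sup>L N \<psi> = 0"
  shows integrable_iid_sum_square: "integrable M (\<lambda>\<omega>. (\<Sum>i<n. \<psi> (X i \<omega>))\<^sup>2)"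
    and expectation_iid_sum_square:
      "expectation (\<lambda>\<omega>. (\<Sum>i<n. \<psi> (X i \<omega>))\<^sup>2) = real n * (\<integral>x. (\<psi> x)\<^sup>2 \<partial>N)"
proof -
  have sqX: "integrable M (\<lambda>\<omega>. (\<psi> (X i \<omega>))\<^sup>2)" for i
    using integrable_X_iff[of "\<lambda>x. (\<psi> x)\<^sup>2" i] sq by simp
  show int: "integrable M (\<lambda>\<omega>. (\<Sum>i<n. \<psi> (X i \<omega>))\<^sup>2)" for n
    by (rule square_sum_integrable_finite) (use sqX in auto)
  show "expectation (\<lambda>\<omega>. (\<Sum>i<n. \<psi> (X i \<omega>))\<^sup>2) = real n * (\<integral>x. (\<psi> x)\<^sup>2 \<partial>N)"
  proof (induction n)
    case (Suc n)
    let ?S = "\<lambda>\<omega>. \<Sum>i<n. \<psi> (X i \<omega>)"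
    have cross: "integrable M (\<lambda>\<omega>. ?S \<omega> * \<psi> (X n \<omega>))"
      by (rule integrable_mult_of_squares) (use int sqX in auto)
    have "expectation (\<lambda>\<omega>. ?S \<omega> * \<psi> (X n \<omega>)) = expectation (\<lambda>\<omega>. \<integral>z. ?S \<omega> * \<psi> z \<partial>N)"
      using expectation_fresh_inner[of "\<lambda>(u, z). (\<Sum>i<n. \<psi> (u i)) * \<psi> z" n] cross
      by (simp add: past_apply)
    then have "expectation (\<lambda>\<omega>. ?S \<omega> * \<psi> (X n \<omega>)) = 0" by (simp add: mean)
    moreover have "expectation (\<lambda>\<omega>. (\<Sum>i<Suc n. \<psi> (X i \<omega>))\<^sup>2)
        = expectation (\<lambda>\<omega>. (?S \<omega>)\<^sup>2 + (\<psi> (X n \<omega>))\<^sup>2 + 2 * (?S \<omega> * \<psi> (X n \<omega>)))"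
      by (simp add: power2_sum mult.assoc)
    moreover have "expectation (\<lambda>\<omega>. (\<psi> (X n \<omega>))\<^sup>2) = (\<integral>x. (\<psi> x)\<^sup>2 \<partial>N)"
      by (rule expectation_X) simp
    ultimately show ?case using cross int sqX Suc by (simp add: algebra_simps)
  qed simp
qed

text \<open>
  Integrate the last summand of \<open>(S + \<psi>) ^ 4\<close> first. The term \<open>4 * S ^ 3 * \<psi>\<close> vanishes since \<open>\<psi>\<close> is
  centred, the term \<open>4 * S * \<psi> ^ 3\<close> since \<open>S\<close> is, and \<open>6 * S\<^sup>2 * \<psi>\<^sup>2\<close> is known from the second moment.
\<close>

lemma expectation_iid_sum_fourth_le:
  fixes \<psi> :: "'b \<Rightarrow> real"
  assumes meas [measurable]: "\<psi> \<in> borel_measurable N"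
    and bound: "\<And>x. x \<in> space N \<Longrightarrow> \<bar>\<psi> x\<bar> \<le> b" and mean: "integral\<^sup>L N \<psi> = 0"
  shows "expectation (\<lambda>\<omega>. (\<Sum>i<n. \<psi> (X i \<omega>)) ^ 4)
      \<le> real n * (\<integral>x. (\<psi> x) ^ 4 \<partial>N) + 3 * (real n)\<^sup>2 * (\<integral>x. (\<psi> x)\<^sup>2 \<partial>N)\<^sup>2"
proof (induction n)
  case (Suc n)
  let ?S = "\<lambda>\<omega>. \<Sum>i<n. \<psi> (X i \<omega>)"
  let ?q = "\<lambda>p::nat. \<integral>x. (\<psi> x) ^ p \<partial>N"
  have intp: "integrable N (\<lambda>x. (\<psi> x) ^ p)" for p
    by (rule N.integrable_const_bound[where B="b ^ p"])
       (auto intro!: AE_I2 simp: power_abs intro!: power_mono bound)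
  have S_bound: "\<bar>?S \<omega>\<bar> \<le> real n * b" if "\<omega> \<in> space M" for \<omega>
    using sum_norm_bound[of "{..<n}" "\<lambda>i. \<psi> (X i \<omega>)" b] bound[OF X_in_space[OF that]] by simp
  have intS: "integrable M (\<lambda>\<omega>. (?S \<omega>) ^ p)" for p
    by (rule integrable_const_bound[where B="(real n * b) ^ p"])
       (auto intro!: AE_I2 simp: power_abs intro!: power_mono S_bound)
  have intSum: "integrable M (\<lambda>\<omega>. (?S \<omega> + \<psi> (X n \<omega>)) ^ 4)"
  proof (rule integrable_const_bound[where B="(real n * b + b) ^ 4"])
    show "AE \<omega> in M. norm ((?S \<omega> + \<psi> (X n \<omega>)) ^ 4) \<le> (real n * b + b) ^ 4"
    proof (rule AE_I2)
      fix \<omega> assume w: "\<omega> \<in> space M"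
      have "\<bar>?S \<omega> + \<psi> (X n \<omega>)\<bar> \<le> real n * b + b"
        using S_bound[OF w] bound[OF X_in_space[OF w], of n] by linarith
      then show "norm ((?S \<omega> + \<psi> (X n \<omega>)) ^ 4) \<le> (real n * b + b) ^ 4"
        unfolding real_norm_def power_abs by (intro power_mono) auto
    qed
  qed simp
  have binom: "(s + p) ^ 4 = s ^ 4 + 4 * s ^ 3 * p + 6 * s ^ 2 * p ^ 2 + 4 * s * p ^ 3 + p ^ 4" for s p :: real
    by algebra
  have inner: "(\<integral>z. (s + \<psi> z) ^ 4 \<partial>N) = s ^ 4 + 6 * s ^ 2 * ?q 2 + 4 * s * ?q 3 + ?q 4" for s
    unfolding binom using intp intp[of 1] mean by (simp add: N.prob_space)
  have ES: "expectation ?S = 0"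
    using intp[of 1] by (simp add: Bochner_Integration.integral_sum integrable_X_iff expectation_X mean)
  have ES2: "expectation (\<lambda>\<omega>. (?S \<omega>)\<^sup>2) = real n * ?q 2"
    by (rule expectation_iid_sum_square) (use intp mean in auto)
  have "expectation (\<lambda>\<omega>. (?S \<omega> + \<psi> (X n \<omega>)) ^ 4) = expectation (\<lambda>\<omega>. \<integral>z. (?S \<omega> + \<psi> z) ^ 4 \<partial>N)"
    using expectation_fresh_inner[of "\<lambda>(u, z). ((\<Sum>i<n. \<psi> (u i)) + \<psi> z) ^ 4" n] intSum
    by (simp add: past_apply)
  also have "\<dots> = expectation (\<lambda>\<omega>. ?S \<omega> ^ 4) + 6 * (real n * ?q 2) * ?q 2 + ?q 4"
    unfolding inner using intS intS[of 1] ES ES2 by (simp add: prob_space)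
  also have "\<dots> \<le> (real n * ?q 4 + 3 * (real n)\<^sup>2 * (?q 2)\<^sup>2) + 6 * (real n * ?q 2) * ?q 2 + ?q 4"
    using Suc by simp
  also have "\<dots> \<le> real (Suc n) * ?q 4 + 3 * (real (Suc n))\<^sup>2 * (?q 2)\<^sup>2"
    by (simp add: algebra_simps power2_eq_square)
  finally show ?case by simp
qed simp

end

section \<open>Degenerate U-statistics and their second moments\<close>

definition U_sum :: "('b \<Rightarrow> 'b \<Rightarrow> real) \<Rightarrow> nat \<Rightarrow> (nat \<Rightarrow> 'b) \<Rightarrow> real" where
  "U_sum K n u = (\<Sum>j<n. \<Sum>i<j. K (u i) (u j))"

lemma U_sum_Suc: "U_sum K (Suc n) u = U_sum K n u + (\<Sum>i<n. K (u i) (u n))"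
  by (simp add: U_sum_def)

lemma square_sum_eq_diagonal_plus_U_sum:
  "(\<Sum>i<n. f (u i))\<^sup>2 = (\<Sum>i<n. (f (u i))\<^sup>2) + 2 * U_sum (\<lambda>x y. f x * f y) n u" for f :: "'b \<Rightarrow> real"
  by (induction n) (simp_all add: U_sum_def power2_sum sum_distrib_right sum_distrib_left algebra_simps)

text \<open>
  Integrability and the vanishing mean are required of every section, not only of almost every
  one, so that no exceptional sets have to be carried through the sums over the sample.
\<close>

locale degenerate_kernel = prob_space N for N :: "'b measure" +
  fixes K :: "'b \<Rightarrow> 'b \<Rightarrow> real"
  assumes kernel_measurable: "case_prod K \<in> borel_measurable (N \<Otimes>\<^sub>M N)"
    and kernel_commute: "\<And>x y. K x y = K y x"
    and kernel_section_square: "\<And>x. x \<in> space N \<Longrightarrow> integrable N (\<lambda>y. (K x y)\<^sup>2)"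
    and kernel_square: "integrable (N \<Otimes>\<^sub>M N) (\<lambda>(x, y). (K x y)\<^sup>2)"
    and kernel_degenerate: "\<And>x. x \<in> space N \<Longrightarrow> (\<integral>y. K x y \<partial>N) = 0"
begin

lemma kernel_section_measurable: "x \<in> space N \<Longrightarrow> K x \<in> borel_measurable N"
  using measurable_Pair2[OF kernel_measurable] by simp

lemma kernel_section_integrable: "x \<in> space N \<Longrightarrow> integrable N (K x)"
  by (rule integrable_of_square) (simp_all add: kernel_section_measurable kernel_section_square)

end

context iid_sample
begin

lemma U_sum_past: "k \<le> n \<Longrightarrow> U_sum K k (past n \<omega>) = U_sum K k (\<lambda>i. X i \<omega>)"
  unfolding U_sum_def by (intro sum.cong) (auto simp: past_apply)

lemma U_sum_past_measurable:
  assumes [measurable]: "case_prod K \<in> borel_measurable (N \<Otimes>\<^sub>M N)"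
  shows "U_sum K k \<in> borel_measurable (past_space k)"
  unfolding U_sum_def
proof (intro borel_measurable_sum)
  fix i j assume "j \<in> {..<k}" "i \<in> {..<j}"
  then have [measurable]: "(\<lambda>u. u i) \<in> measurable (past_space k) N" "(\<lambda>u. u j) \<in> measurable (past_space k) N"
    by (auto intro!: measurable_component_singleton)
  show "(\<lambda>u. K (u i) (u j)) \<in> borel_measurable (past_space k)" by measurable
qed

lemma U_sum_measurable [measurable]:
  assumes [measurable]: "case_prod K \<in> borel_measurable (N \<Otimes>\<^sub>M N)"
  shows "(\<lambda>\<omega>. U_sum K n (\<lambda>i. X i \<omega>)) \<in> borel_measurable M"
  unfolding U_sum_def by measurable

lemma row_sum_measurable:
  fixes K :: "'b \<Rightarrow> 'b \<Rightarrow> real"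
  assumes [measurable]: "case_prod K \<in> borel_measurable (N \<Otimes>\<^sub>M N)"
  shows "(\<lambda>(u, z). \<Sum>i<k. K (u i) z) \<in> borel_measurable (past_space k \<Otimes>\<^sub>M N)"
  unfolding case_prod_beta
proof (intro borel_measurable_sum)
  fix i assume "i \<in> {..<k}"
  then have [measurable]: "(\<lambda>u. u i) \<in> measurable (past_space k) N"
    by (auto intro!: measurable_component_singleton)
  show "(\<lambda>p. K (fst p i) (snd p)) \<in> borel_measurable (past_space k \<Otimes>\<^sub>M N)" by measurable
qed

lemma row_sum_past: "(\<Sum>i<k. K (past k \<omega> i) z) = (\<Sum>i<k. K (X i \<omega>) z)"
  by (simp add: past_def)

text \<open>
  For a fixed value of the fresh point the row is a centred i.i.d. sum.
\<close>

lemma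
  assumes K: "degenerate_kernel N K"
  shows integrable_row_square: "integrable M (\<lambda>\<omega>. (\<Sum>i<k. K (X i \<omega>) (X k \<omega>))\<^sup>2)"
    and expectation_row_square: "expectation (\<lambda>\<omega>. (\<Sum>i<k. K (X i \<omega>) (X k \<omega>))\<^sup>2)
        = real k * integral\<^sup>L (N \<Otimes>\<^sub>M N) (\<lambda>(x, y). (K x y)\<^sup>2)"
proof -
  interpret K: degenerate_kernel N K by fact
  interpret square: pair_prob_space N N ..
  note [measurable] = K.kernel_measurable row_sum_measurable[OF K.kernel_measurable]
  show int: "integrable M (\<lambda>\<omega>. (\<Sum>i<k. K (X i \<omega>) (X k \<omega>))\<^sup>2)"
    by (rule square_sum_integrable_finite)
       (use integrable_pair_iff[of "\<lambda>x y. (K x y)\<^sup>2"] K.kernel_square in auto)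
  have "expectation (\<lambda>\<omega>. (\<Sum>i<k. K (X i \<omega>) (X k \<omega>))\<^sup>2)
      = (\<integral>z. expectation (\<lambda>\<omega>. (\<Sum>i<k. K (X i \<omega>) z)\<^sup>2) \<partial>N)"
    using expectation_fresh_outer[of "\<lambda>(u, z). (\<Sum>i<k. K (u i) z)\<^sup>2" k] int
    by (simp add: row_sum_past)
  also have "\<dots> = (\<integral>z. real k * (\<integral>x. (K x z)\<^sup>2 \<partial>N) \<partial>N)"
  proof (rule Bochner_Integration.integral_cong)
    fix z assume z: "z \<in> space N"
    show "expectation (\<lambda>\<omega>. (\<Sum>i<k. K (X i \<omega>) z)\<^sup>2) = real k * (\<integral>x. (K x z)\<^sup>2 \<partial>N)"
      using expectation_iid_sum_square[of "K z" k] K.kernel_section_measurable[OF z]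
        K.kernel_section_square[OF z] K.kernel_degenerate[OF z]
      by (simp add: K.kernel_commute[of _ z])
  qed simp
  also have "\<dots> = real k * integral\<^sup>L (N \<Otimes>\<^sub>M N) (\<lambda>(x, y). (K x y)\<^sup>2)"
    using square.integral_snd[of "\<lambda>x y. (K x y)\<^sup>2"] K.kernel_square by simp
  finally show "expectation (\<lambda>\<omega>. (\<Sum>i<k. K (X i \<omega>) (X k \<omega>))\<^sup>2)
        = real k * integral\<^sup>L (N \<Otimes>\<^sub>M N) (\<lambda>(x, y). (K x y)\<^sup>2)" .
qed

text \<open>
  Different pairs are uncorrelated: given the past, each new row has mean zero because the kernel is
  degenerate.
\<close>

lemma
  assumes K: "degenerate_kernel N K"
  shows integrable_U_sum_square: "integrable M (\<lambda>\<omega>. (U_sum K n (\<lambda>i. X i \<omega>))\<^sup>2)"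
    and expectation_U_sum_square: "expectation (\<lambda>\<omega>. (U_sum K n (\<lambda>i. X i \<omega>))\<^sup>2)
        = real n * (real n - 1) / 2 * integral\<^sup>L (N \<Otimes>\<^sub>M N) (\<lambda>(x, y). (K x y)\<^sup>2)"
proof -
  interpret K: degenerate_kernel N K by fact
  note [measurable] = K.kernel_measurable row_sum_measurable[OF K.kernel_measurable]
    U_sum_past_measurable[OF K.kernel_measurable]
  let ?U = "\<lambda>n \<omega>. U_sum K n (\<lambda>i. X i \<omega>)" and ?Y = "\<lambda>n \<omega>. \<Sum>i<n. K (X i \<omega>) (X n \<omega>)"
  show int: "integrable M (\<lambda>\<omega>. (?U n \<omega>)\<^sup>2)" for n
  proof (induction n)
    case (Suc n)
    then show ?case unfolding U_sum_Suc
      by (intro square_sum_integrable) (simp_all add: integrable_row_square[OF K])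
  qed (simp add: U_sum_def)
  show "expectation (\<lambda>\<omega>. (?U n \<omega>)\<^sup>2)
        = real n * (real n - 1) / 2 * integral\<^sup>L (N \<Otimes>\<^sub>M N) (\<lambda>(x, y). (K x y)\<^sup>2)"
  proof (induction n)
    case (Suc n)
    have cross: "integrable M (\<lambda>\<omega>. ?U n \<omega> * ?Y n \<omega>)"
      by (rule integrable_mult_of_squares) (simp_all add: integrable_row_square[OF K] int)
    have "expectation (\<lambda>\<omega>. ?U n \<omega> * ?Y n \<omega>)
        = expectation (\<lambda>\<omega>. \<integral>z. ?U n \<omega> * (\<Sum>i<n. K (X i \<omega>) z) \<partial>N)"
      using expectation_fresh_inner[of "\<lambda>(u, z). U_sum K n u * (\<Sum>i<n. K (u i) z)" n] cross
      by (simp add: row_sum_past U_sum_past)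
    also have "\<dots> = expectation (\<lambda>\<omega>. 0)"
      by (rule Bochner_Integration.integral_cong)
         (simp_all add: Bochner_Integration.integral_sum K.kernel_section_integrable X_in_space K.kernel_degenerate)
    finally have "expectation (\<lambda>\<omega>. ?U n \<omega> * ?Y n \<omega>) = 0" by simp
    moreover have "expectation (\<lambda>\<omega>. (?U (Suc n) \<omega>)\<^sup>2)
        = expectation (\<lambda>\<omega>. (?U n \<omega>)\<^sup>2 + (?Y n \<omega>)\<^sup>2 + 2 * (?U n \<omega> * ?Y n \<omega>))"
      by (simp add: power2_sum U_sum_Suc mult.assoc)
    ultimately show ?case
      using cross int integrable_row_square[OF K] Suc
      by (simp add: expectation_row_square[OF K] field_simps)
  qed (simp add: U_sum_def)
qed

end

section \<open>Bounded degenerate kernels\<close>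

lemma iexp_second_order: "cmod (iexp x - (1 + \<i> * x - x\<^sup>2 / 2)) \<le> \<bar>x\<bar> ^ 3 / 6"
proof -
  have "(\<Sum>k\<le>2. (\<i> * complex_of_real x) ^ k / fact k) = 1 + \<i> * x - x\<^sup>2 / 2"
    by (simp add: numeral_2_eq_2 power2_eq_square fact_2 power_mult_distrib algebra_simps)
  then show ?thesis using iexp_approx1[of x 2] by (simp add: eval_nat_numeral)
qed

lemma exp_minus_second_order:
  fixes x :: real
  assumes "0 \<le> x"
  shows "\<bar>1 - x - exp (- x)\<bar> \<le> x\<^sup>2 / 2"
proof -
  have "exp (- x) \<le> 1 - x + x\<^sup>2 / 2"
  proof -
    have "1 \<le> (1 - x + x\<^sup>2 / 2) * (1 + x + x\<^sup>2 / 2)"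
      using mult_nonneg_nonneg[OF assms mult_nonneg_nonneg[OF assms mult_nonneg_nonneg[OF assms assms]]]
      by (simp add: field_simps power2_eq_square)
    also have "\<dots> \<le> (1 - x + x\<^sup>2 / 2) * exp x"
    proof (rule mult_left_mono[OF exp_lower_Taylor_quadratic[OF assms]])
      have "0 \<le> (1 - x)\<^sup>2 / 2 + 1 / 2" by simp
      also have "\<dots> = 1 - x + x\<^sup>2 / 2" by (simp add: power2_eq_square field_simps)
      finally show "0 \<le> 1 - x + x\<^sup>2 / 2" .
    qed
    finally show ?thesis by (simp add: exp_minus field_simps)
  qed
  then show ?thesis using exp_ge_add_one_self[of "- x"] by linarith
qed

text \<open>
  The two bounds have different orders of magnitude. For a kernel that lives near the diagonal the
  \<open>L\<^sup>1\<close> norm \<open>m\<close> of a section is much smaller than the supremum \<open>b\<close>, and every power of \<open>m\<close> in an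
  estimate is a gain.
\<close>

locale bounded_degenerate_kernel = degenerate_kernel N K
  for N :: "'b measure" and K :: "'b \<Rightarrow> 'b \<Rightarrow> real" +
  fixes b m :: real
  assumes kernel_le: "\<And>x y. x \<in> space N \<Longrightarrow> y \<in> space N \<Longrightarrow> \<bar>K x y\<bar> \<le> b"
    and kernel_section_le: "\<And>x. x \<in> space N \<Longrightarrow> (\<integral>y. \<bar>K x y\<bar> \<partial>N) \<le> m"
begin

sublocale square: pair_prob_space N N ..

definition second_moment :: real where
  "second_moment = integral\<^sup>L (N \<Otimes>\<^sub>M N) (\<lambda>(x, y). (K x y)\<^sup>2)"

text \<open>
  The kernel of the squared integral operator of \<open>K\<close>. For a point \<open>z\<close> with law \<open>N\<close> it is the
  covariance of \<open>K x z\<close> and \<open>K y z\<close>.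
\<close>

definition composed :: "'b \<Rightarrow> 'b \<Rightarrow> real" where
  "composed x y = (\<integral>z. K x z * K y z \<partial>N)"

lemma bound_nonneg: "0 \<le> b" and section_bound_nonneg: "0 \<le> m"
proof -
  obtain x where x: "x \<in> space N" using not_empty by blast
  show "0 \<le> b" using kernel_le[OF x x] by linarith
  have "0 \<le> (\<integral>y. \<bar>K x y\<bar> \<partial>N)" by simp
  then show "0 \<le> m" using kernel_section_le[OF x] by linarith
qed

lemma bound_mult_nonneg: "0 \<le> b * m" using bound_nonneg section_bound_nonneg by simp

lemma abs_section_integrable: "x \<in> space N \<Longrightarrow> integrable N (\<lambda>z. \<bar>K x z\<bar>)"
  using kernel_section_integrable by simp

lemma product_integrable: "x \<in> space N \<Longrightarrow> y \<in> space N \<Longrightarrow> integrable N (\<lambda>z. K x z * K y z)"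
  by (intro integrable_mult_of_squares kernel_section_measurable kernel_section_square)

lemma integral_abs_product_le:
  assumes "x \<in> space N" "y \<in> space N"
  shows "(\<integral>z. \<bar>K x z * K y z\<bar> \<partial>N) \<le> b * m"
proof -
  have "(\<integral>z. \<bar>K x z * K y z\<bar> \<partial>N) \<le> (\<integral>z. b * \<bar>K y z\<bar> \<partial>N)"
  proof (rule integral_mono)
    show "integrable N (\<lambda>z. \<bar>K x z * K y z\<bar>)" using product_integrable[OF assms] by simp
    show "integrable N (\<lambda>z. b * \<bar>K y z\<bar>)" using abs_section_integrable[OF assms(2)] by simp
  qed (auto simp: abs_mult assms intro!: mult_right_mono kernel_le)
  also have "\<dots> \<le> b * m" using kernel_section_le[OF assms(2)] bound_nonneg by (auto intro!: mult_left_mono)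
  finally show ?thesis .
qed

lemma section_square_le: "x \<in> space N \<Longrightarrow> (\<integral>z. (K x z)\<^sup>2 \<partial>N) \<le> b * m"
  using integral_abs_product_le[of x x] by (simp add: power2_eq_square)

lemma section_fourth_le:
  assumes x: "x \<in> space N"
  shows "(\<integral>z. (K x z) ^ 4 \<partial>N) \<le> b ^ 3 * m"
proof -
  have "(K x z) ^ 4 \<le> b\<^sup>2 * (K x z)\<^sup>2" if "z \<in> space N" for z
  proof -
    have "(K x z)\<^sup>2 \<le> b\<^sup>2" using kernel_le[OF x that] by (metis abs_le_square_iff abs_of_nonneg bound_nonneg)
    then have "(K x z)\<^sup>2 * (K x z)\<^sup>2 \<le> b\<^sup>2 * (K x z)\<^sup>2" by (rule mult_right_mono) simp
    then show ?thesis by (simp add: eval_nat_numeral mult.assoc)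
  qed
  then have "(\<integral>z. (K x z) ^ 4 \<partial>N) \<le> (\<integral>z. b\<^sup>2 * (K x z)\<^sup>2 \<partial>N)"
    using kernel_section_square[OF x]
    by (intro Bochner_Integration.integral_mono') auto
  also have "\<dots> \<le> b\<^sup>2 * (b * m)" using section_square_le[OF x] by (auto intro!: mult_left_mono)
  finally show ?thesis by (simp add: eval_nat_numeral mult_ac)
qed

lemma second_moment_eq: "second_moment = (\<integral>x. (\<integral>y. (K x y)\<^sup>2 \<partial>N) \<partial>N)"
  unfolding second_moment_def using square.integral_fst[of "\<lambda>x y. (K x y)\<^sup>2"] kernel_square by simp

lemma second_moment_nonneg: "0 \<le> second_moment" unfolding second_moment_eq by simp

lemma second_moment_le: "second_moment \<le> b * m"
proof -
  have "second_moment \<le> (\<integral>x. b * m \<partial>N)" unfolding second_moment_eq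
    using square.integrable_fst[of "\<lambda>x y. (K x y)\<^sup>2"] kernel_square section_square_le
    by (intro integral_mono) auto
  then show ?thesis by (simp add: prob_space)
qed

lemma composed_self: "composed x x = (\<integral>z. (K x z)\<^sup>2 \<partial>N)"
  by (simp add: composed_def power2_eq_square)

lemma composed_measurable: "case_prod composed \<in> borel_measurable (N \<Otimes>\<^sub>M N)"
proof -
  note [measurable] = kernel_measurable
  have "(\<lambda>(p, z). K (fst p) z * K (snd p) z) \<in> borel_measurable ((N \<Otimes>\<^sub>M N) \<Otimes>\<^sub>M N)" by measurable
  from borel_measurable_lebesgue_integral[OF this] show ?thesis
    by (simp add: composed_def case_prod_beta')
qed

lemma composed_le: "x \<in> space N \<Longrightarrow> y \<in> space N \<Longrightarrow> \<bar>composed x y\<bar> \<le> b * m"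
  unfolding composed_def
  using integral_abs_product_le[of x y] integral_abs_bound[of N "\<lambda>z. K x z * K y z"] by linarith

lemma triple_integrable:
  assumes x: "x \<in> space N"
  shows "integrable (N \<Otimes>\<^sub>M N) (\<lambda>(y, z). K x z * K y z)"
proof (rule square.integrable_const_bound[where B="b * b"])
  note [measurable] = kernel_measurable kernel_section_measurable[OF x]
  show "(\<lambda>(y, z). K x z * K y z) \<in> borel_measurable (N \<Otimes>\<^sub>M N)" by measurable
  show "AE p in N \<Otimes>\<^sub>M N. norm (case p of (y, z) \<Rightarrow> K x z * K y z) \<le> b * b"
    using kernel_le x bound_nonneg by (auto intro!: AE_I2 mult_mono simp: abs_mult space_pair_measure)
qed

text \<open>
  Degeneracy passes to the square of the operator: exchange the integrals and integrate the factor
  that contains \<open>y\<close> first.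
\<close>

lemma composed_degenerate: "degenerate_kernel N composed"
proof
  note [measurable] = composed_measurable
  have sq: "(composed x y)\<^sup>2 \<le> (b * m)\<^sup>2" if "x \<in> space N" "y \<in> space N" for x y
    using composed_le[OF that] by (metis abs_le_square_iff abs_of_nonneg bound_mult_nonneg)
  show "case_prod composed \<in> borel_measurable (N \<Otimes>\<^sub>M N)" by (rule composed_measurable)
  show "composed x y = composed y x" for x y by (simp add: composed_def mult.commute)
  show "integrable (N \<Otimes>\<^sub>M N) (\<lambda>(x, y). (composed x y)\<^sup>2)"
    by (rule square.integrable_const_bound[where B="(b * m)\<^sup>2"])
       (use sq in \<open>auto intro!: AE_I2 simp: space_pair_measure\<close>)
  fix x assume x: "x \<in> space N"
  have [measurable]: "composed x \<in> borel_measurable N"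
    using measurable_Pair2[OF composed_measurable x] by simp
  show "integrable N (\<lambda>y. (composed x y)\<^sup>2)"
    by (rule integrable_const_bound[where B="(b * m)\<^sup>2"]) (use sq x in \<open>auto intro!: AE_I2\<close>)
  have "(\<integral>y. composed x y \<partial>N) = (\<integral>z. (\<integral>y. K x z * K y z \<partial>N) \<partial>N)"
    unfolding composed_def using square.Fubini_integral[OF triple_integrable[OF x]] by simp
  also have "\<dots> = (\<integral>z. 0 \<partial>N)"
    by (rule Bochner_Integration.integral_cong)
       (simp_all add: kernel_commute[of _ "_::'b"] kernel_degenerate)
  finally show "(\<integral>y. composed x y \<partial>N) = 0" by simp
qed

lemma composed_section_le:
  assumes x: "x \<in> space N"
  shows "(\<integral>y. \<bar>composed x y\<bar> \<partial>N) \<le> m\<^sup>2"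
proof -
  interpret G: degenerate_kernel N composed by (rule composed_degenerate)
  have tri: "integrable (N \<Otimes>\<^sub>M N) (\<lambda>(y, z). \<bar>K x z * K y z\<bar>)"
    using integrable_abs[OF triple_integrable[OF x]] by (simp add: case_prod_beta')
  have "(\<integral>y. \<bar>composed x y\<bar> \<partial>N) \<le> (\<integral>y. (\<integral>z. \<bar>K x z * K y z\<bar> \<partial>N) \<partial>N)"
  proof (rule integral_mono)
    show "integrable N (\<lambda>y. \<bar>composed x y\<bar>)" using G.kernel_section_integrable[OF x] by simp
    show "integrable N (\<lambda>y. \<integral>z. \<bar>K x z * K y z\<bar> \<partial>N)" by (rule square.integrable_fst[OF tri])
    show "\<bar>composed x y\<bar> \<le> (\<integral>z. \<bar>K x z * K y z\<bar> \<partial>N)" for y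
      unfolding composed_def by (rule integral_abs_bound)
  qed
  also have "\<dots> = (\<integral>z. (\<integral>y. \<bar>K x z * K y z\<bar> \<partial>N) \<partial>N)"
    using square.Fubini_integral[OF tri] by simp
  also have "\<dots> \<le> (\<integral>z. \<bar>K x z\<bar> * m \<partial>N)"
  proof (rule integral_mono)
    show "integrable N (\<lambda>z. \<integral>y. \<bar>K x z * K y z\<bar> \<partial>N)" by (rule square.integrable_snd[OF tri])
    show "integrable N (\<lambda>z. \<bar>K x z\<bar> * m)" using abs_section_integrable[OF x] by simp
    show "(\<integral>y. \<bar>K x z * K y z\<bar> \<partial>N) \<le> \<bar>K x z\<bar> * m" if "z \<in> space N" for z
      using kernel_section_le[OF that] by (auto simp: abs_mult kernel_commute[of _ z] intro!: mult_left_mono)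
  qed
  also have "\<dots> \<le> m * m" using kernel_section_le[OF x] section_bound_nonneg
    by (auto intro!: mult_right_mono)
  finally show ?thesis by (simp add: power2_eq_square)
qed

text \<open>
  The left-hand side is an integral over 4-cycles of \<open>K\<close>. Bounding one edge by \<open>b\<close> leaves a path of
  three edges, each of which contributes a factor \<open>m\<close> when the vertices are integrated in turn.
\<close>

lemma composed_second_moment_le:
  "integral\<^sup>L (N \<Otimes>\<^sub>M N) (\<lambda>(x, y). (composed x y)\<^sup>2) \<le> b * m ^ 3"
proof -
  interpret G: degenerate_kernel N composed by (rule composed_degenerate)
  have "integral\<^sup>L (N \<Otimes>\<^sub>M N) (\<lambda>(x, y). (composed x y)\<^sup>2) = (\<integral>x. (\<integral>y. (composed x y)\<^sup>2 \<partial>N) \<partial>N)"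
    using square.integral_fst[of "\<lambda>x y. (composed x y)\<^sup>2"] G.kernel_square by simp
  also have "\<dots> \<le> (\<integral>x. b * m ^ 3 \<partial>N)"
  proof (rule integral_mono)
    show "integrable N (\<lambda>x. \<integral>y. (composed x y)\<^sup>2 \<partial>N)"
      using square.integrable_fst[of "\<lambda>x y. (composed x y)\<^sup>2"] G.kernel_square by simp
    fix x assume x: "x \<in> space N"
    have "(\<integral>y. (composed x y)\<^sup>2 \<partial>N) \<le> (\<integral>y. (b * m) * \<bar>composed x y\<bar> \<partial>N)"
    proof (rule integral_mono)
      show "(composed x y)\<^sup>2 \<le> (b * m) * \<bar>composed x y\<bar>" if "y \<in> space N" for y
        using mult_right_mono[OF composed_le[OF x that], of "\<bar>composed x y\<bar>"]
        by (simp add: power2_eq_square abs_mult_self_eq)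
    qed (use G.kernel_section_square[OF x] G.kernel_section_integrable[OF x] in auto)
    also have "\<dots> \<le> (b * m) * m\<^sup>2" using composed_section_le[OF x] bound_mult_nonneg
      by (auto intro!: mult_left_mono)
    finally show "(\<integral>y. (composed x y)\<^sup>2 \<partial>N) \<le> b * m ^ 3" by (simp add: eval_nat_numeral mult.assoc)
  qed simp
  finally show ?thesis by (simp add: prob_space)
qed

end

lemma bounded_degenerate_kernel_scale:
  assumes "bounded_degenerate_kernel N K b m" and a: "0 \<le> a"
  shows "bounded_degenerate_kernel N (\<lambda>x y. a * K x y) (a * b) (a * m)"
proof -
  interpret K: bounded_degenerate_kernel N K b m by fact
  note [measurable] = K.kernel_measurable
  show ?thesis
  proof
    show "(\<lambda>(x, y). a * K x y) \<in> borel_measurable (N \<Otimes>\<^sub>M N)" by measurable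
    show "integrable (N \<Otimes>\<^sub>M N) (\<lambda>(x, y). (a * K x y)\<^sup>2)"
      using K.kernel_square by (simp add: power_mult_distrib case_prod_beta')
    show "a * K x y = a * K y x" for x y by (simp add: K.kernel_commute)
  qed (use a K.kernel_section_square K.kernel_degenerate K.kernel_le K.kernel_section_le in
      \<open>auto simp: power_mult_distrib abs_mult intro!: mult_left_mono\<close>)
qed

section \<open>A central limit theorem for degenerate U-statistics\<close>

lemma (in prob_space) char_third_order:
  assumes [measurable]: "y \<in> borel_measurable M"
    and int: "integrable M y" "integrable M (\<lambda>x. (y x)\<^sup>2)" "integrable M (\<lambda>x. \<bar>y x\<bar> ^ 3)"
    and centred: "expectation y = 0"
  shows "cmod (expectation (\<lambda>x. iexp (t * y x)) - complex_of_real (1 - t\<^sup>2 / 2 * expectation (\<lambda>x. (y x)\<^sup>2)))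
    \<le> \<bar>t\<bar> ^ 3 / 6 * expectation (\<lambda>x. \<bar>y x\<bar> ^ 3)"
proof -
  let ?T = "\<lambda>x. 1 + \<i> * complex_of_real (t * y x) - complex_of_real ((t * y x)\<^sup>2 / 2)"
  have inte: "integrable M (\<lambda>x. iexp (t * y x))" by (rule integrable_const_bound[where B=1]) auto
  have sq: "(t * y x)\<^sup>2 / 2 = t\<^sup>2 / 2 * (y x)\<^sup>2" for x by (simp add: power_mult_distrib)
  have i1: "integrable M (\<lambda>x. complex_of_real (t * y x))" using int(1) by (intro integrable_of_real) simp
  have i2: "integrable M (\<lambda>x. complex_of_real ((t * y x)\<^sup>2 / 2))"
    unfolding sq using int(2) by (intro integrable_of_real) simp
  have e1: "expectation (\<lambda>x. complex_of_real (t * y x)) = 0" using centred by (simp only: integral_complex_of_real) simp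
  have e2: "expectation (\<lambda>x. complex_of_real ((t * y x)\<^sup>2 / 2)) = complex_of_real (t\<^sup>2 / 2 * expectation (\<lambda>x. (y x)\<^sup>2))"
    unfolding sq by (simp only: integral_complex_of_real) simp
  have intT: "integrable M ?T" using i1 i2 by (simp del: of_real_mult of_real_divide of_real_power)
  have T: "expectation ?T = complex_of_real (1 - t\<^sup>2 / 2 * expectation (\<lambda>x. (y x)\<^sup>2))"
    using i1 i2 e1 e2 by (simp add: prob_space del: of_real_mult of_real_divide of_real_power)
  have "cmod (expectation (\<lambda>x. iexp (t * y x)) - expectation ?T) = cmod (expectation (\<lambda>x. iexp (t * y x) - ?T x))"
    using inte intT by simp
  also have "\<dots> \<le> expectation (\<lambda>x. cmod (iexp (t * y x) - ?T x))" by (rule integral_norm_bound)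
  also have "\<dots> \<le> expectation (\<lambda>x. \<bar>t\<bar> ^ 3 / 6 * \<bar>y x\<bar> ^ 3)"
  proof (rule integral_mono)
    show "cmod (iexp (t * y x) - ?T x) \<le> \<bar>t\<bar> ^ 3 / 6 * \<bar>y x\<bar> ^ 3" for x
      using iexp_second_order[of "t * y x"] by (simp add: abs_mult power_mult_distrib)
    show "integrable M (\<lambda>x. cmod (iexp (t * y x) - ?T x))"
      by (intro integrable_norm Bochner_Integration.integrable_diff inte intT)
  qed (use int in auto)
  finally show ?thesis unfolding T by simp
qed

lemma cmod_iexp_diff_le: "cmod (iexp a - iexp b) \<le> \<bar>a - b\<bar>"
proof -
  have "iexp a - iexp b = iexp b * (iexp (a - b) - 1)"
    by (simp add: right_diff_distrib exp_add[symmetric] exp_diff field_simps)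
  then have "cmod (iexp a - iexp b) = cmod (iexp (a - b) - 1)" by (simp add: norm_mult)
  also have "\<dots> \<le> \<bar>a - b\<bar>" using iexp_approx1[of "a - b" 0] by simp
  finally show ?thesis .
qed

lemma (in prob_space) char_diff_le:
  assumes [measurable]: "f \<in> borel_measurable M" "g \<in> borel_measurable M"
    and sq: "integrable M (\<lambda>x. (f x - g x)\<^sup>2)"
  shows "cmod (expectation (\<lambda>x. iexp (t * f x)) - expectation (\<lambda>x. iexp (t * g x)))
    \<le> \<bar>t\<bar> * expectation (\<lambda>x. \<bar>f x - g x\<bar>)"
proof -
  have int: "integrable M (\<lambda>x. iexp (t * f x))" "integrable M (\<lambda>x. iexp (t * g x))"
    by (rule integrable_const_bound[where B=1]; auto)+
  have "cmod (expectation (\<lambda>x. iexp (t * f x)) - expectation (\<lambda>x. iexp (t * g x)))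
      = cmod (expectation (\<lambda>x. iexp (t * f x) - iexp (t * g x)))" using int by simp
  also have "\<dots> \<le> expectation (\<lambda>x. cmod (iexp (t * f x) - iexp (t * g x)))" by (rule integral_norm_bound)
  also have "\<dots> \<le> expectation (\<lambda>x. \<bar>t\<bar> * \<bar>f x - g x\<bar>)"
  proof (rule integral_mono)
    show "integrable M (\<lambda>x. cmod (iexp (t * f x) - iexp (t * g x)))"
      by (intro integrable_norm Bochner_Integration.integrable_diff int)
    show "integrable M (\<lambda>x. \<bar>t\<bar> * \<bar>f x - g x\<bar>)" using integrable_of_square[OF _ sq] by simp
    show "cmod (iexp (t * f x) - iexp (t * g x)) \<le> \<bar>t\<bar> * \<bar>f x - g x\<bar>" for x
      using cmod_iexp_diff_le[of "t * f x" "t * g x"] by (simp add: right_diff_distrib[symmetric] abs_mult)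
  qed
  finally show ?thesis by simp
qed

text \<open>
  The price of replacing the contribution of one point by a Gaussian one. The three summands bound
  the third absolute moment of its row, the fluctuation of its conditional variance, and the second
  order error in the Gaussian factor.
\<close>

definition clt_step_error :: "real \<Rightarrow> real \<Rightarrow> real \<Rightarrow> nat \<Rightarrow> real" where
  "clt_step_error b m t n =
     \<bar>t\<bar> ^ 3 / 6 * (sqrt (real n * (b * m)) * sqrt (real n * (b ^ 3 * m) + 3 * (real n)\<^sup>2 * (b * m)\<^sup>2))
     + t\<^sup>2 / 2 * sqrt (2 * real n * (b * m)\<^sup>2 + 4 * (real n)\<^sup>2 * (b * m ^ 3))
     + t ^ 4 / 8 * (real n * (b * m))\<^sup>2"

locale degenerate_U_statistic = iid_sample M N X + K: bounded_degenerate_kernel N K b m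
  for M :: "'w measure" and N :: "'b measure" and X :: "nat \<Rightarrow> 'w \<Rightarrow> 'b"
    and K :: "'b \<Rightarrow> 'b \<Rightarrow> real" and b m :: real
begin

abbreviation U :: "nat \<Rightarrow> 'w \<Rightarrow> real" where
  "U n \<omega> \<equiv> U_sum K n (\<lambda>i. X i \<omega>)"

abbreviation row :: "nat \<Rightarrow> 'w \<Rightarrow> 'b \<Rightarrow> real" where
  "row k \<omega> z \<equiv> \<Sum>i<k. K (X i \<omega>) z"

abbreviation row_variance :: "nat \<Rightarrow> 'w \<Rightarrow> real" where
  "row_variance k \<omega> \<equiv> \<integral>z. (row k \<omega> z)\<^sup>2 \<partial>N"

lemma kernel_measurable_pair [measurable]: "case_prod K \<in> borel_measurable (N \<Otimes>\<^sub>M N)"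
  by (rule K.kernel_measurable)

lemma row_section_measurable [measurable]: "\<omega> \<in> space M \<Longrightarrow> row k \<omega> \<in> borel_measurable N"
  by (intro borel_measurable_sum K.kernel_section_measurable X_in_space)

lemma row_le:
  assumes "\<omega> \<in> space M" "z \<in> space N"
  shows "\<bar>row k \<omega> z\<bar> \<le> real k * b"
  using sum_norm_bound[of "{..<k}" "\<lambda>i. K (X i \<omega>) z" b] K.kernel_le[OF X_in_space[OF assms(1)] assms(2)]
  by simp

lemma row_power_le:
  assumes "\<omega> \<in> space M" "z \<in> space N"
  shows "\<bar>row k \<omega> z\<bar> ^ p \<le> (real k * b) ^ p"
  by (intro power_mono row_le assms) simp

lemma row_power_integrable: "integrable M (\<lambda>\<omega>. \<bar>row k \<omega> (X k \<omega>)\<bar> ^ p)"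
  by (rule integrable_const_bound[where B="(real k * b) ^ p"])
     (auto intro!: AE_I2 row_power_le X_in_space simp: power_abs)

lemma row_section_power_integrable: "\<omega> \<in> space M \<Longrightarrow> integrable N (\<lambda>z. \<bar>row k \<omega> z\<bar> ^ p)"
  by (rule N.integrable_const_bound[where B="(real k * b) ^ p"])
     (auto intro!: AE_I2 row_power_le simp: power_abs)

lemma row_section_centred: "\<omega> \<in> space M \<Longrightarrow> (\<integral>z. row k \<omega> z \<partial>N) = 0"
  by (simp add: Bochner_Integration.integral_sum K.kernel_section_integrable X_in_space K.kernel_degenerate)

lemma expectation_row_square_le: "expectation (\<lambda>\<omega>. (row k \<omega> (X k \<omega>))\<^sup>2) \<le> real k * (b * m)"
  using expectation_row_square[OF K.degenerate_kernel_axioms, of k] K.second_moment_le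
  by (simp add: K.second_moment_def mult_left_mono)

lemma expectation_row_fourth_le:
  "expectation (\<lambda>\<omega>. row k \<omega> (X k \<omega>) ^ 4) \<le> real k * (b ^ 3 * m) + 3 * (real k)\<^sup>2 * (b * m)\<^sup>2"
proof -
  note [measurable] = row_sum_measurable[OF kernel_measurable_pair]
  have "expectation (\<lambda>\<omega>. row k \<omega> (X k \<omega>) ^ 4) = (\<integral>z. expectation (\<lambda>\<omega>. row k \<omega> z ^ 4) \<partial>N)"
    and int: "integrable N (\<lambda>z. expectation (\<lambda>\<omega>. row k \<omega> z ^ 4))"
    using expectation_fresh_outer[of "\<lambda>(u, z). (\<Sum>i<k. K (u i) z) ^ 4" k]
      integrable_fresh_outer[of "\<lambda>(u, z). (\<Sum>i<k. K (u i) z) ^ 4" k] row_power_integrable[of k 4]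
    by (simp_all add: row_sum_past power_even_abs)
  note this(1)
  also have "(\<integral>z. expectation (\<lambda>\<omega>. row k \<omega> z ^ 4) \<partial>N)
      \<le> (\<integral>z. real k * (b ^ 3 * m) + 3 * (real k)\<^sup>2 * (b * m)\<^sup>2 \<partial>N)"
  proof (rule integral_mono[OF int])
    fix z assume z: "z \<in> space N"
    have "expectation (\<lambda>\<omega>. row k \<omega> z ^ 4)
        \<le> real k * (\<integral>x. (K z x) ^ 4 \<partial>N) + 3 * (real k)\<^sup>2 * (\<integral>x. (K z x)\<^sup>2 \<partial>N)\<^sup>2"
      using expectation_iid_sum_fourth_le[of "K z" b k] K.kernel_section_measurable[OF z]
        K.kernel_le[OF z] K.kernel_degenerate[OF z]
      by (simp add: K.kernel_commute[of _ z])
    also have "\<dots> \<le> real k * (b ^ 3 * m) + 3 * (real k)\<^sup>2 * (b * m)\<^sup>2"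
      by (intro add_mono mult_left_mono power_mono K.section_fourth_le K.section_square_le z) auto
    finally show "expectation (\<lambda>\<omega>. row k \<omega> z ^ 4) \<le> \<dots>" .
  qed simp
  finally show ?thesis by (simp add: N.prob_space)
qed

text \<open>
  Cauchy-Schwarz for \<open>\<bar>Y\<bar> * Y\<^sup>2\<close> reduces the third moment to the second and the fourth.
\<close>

lemma expectation_row_cube_le:
  assumes "k \<le> n"
  shows "expectation (\<lambda>\<omega>. \<bar>row k \<omega> (X k \<omega>)\<bar> ^ 3)
    \<le> sqrt (real n * (b * m)) * sqrt (real n * (b ^ 3 * m) + 3 * (real n)\<^sup>2 * (b * m)\<^sup>2)"
proof -
  let ?Y = "\<lambda>\<omega>. row k \<omega> (X k \<omega>)"
  have pow: "\<bar>y\<bar> ^ 3 = \<bar>y * y\<^sup>2\<bar>" "y ^ 4 = (y\<^sup>2)\<^sup>2" for y :: real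
    by (simp_all add: abs_mult power2_eq_square power3_eq_cube power4_eq_xxxx mult.assoc)
  have "expectation (\<lambda>\<omega>. \<bar>?Y \<omega>\<bar> ^ 3)
      \<le> sqrt (expectation (\<lambda>\<omega>. (?Y \<omega>)\<^sup>2)) * sqrt (expectation (\<lambda>\<omega>. ((?Y \<omega>)\<^sup>2)\<^sup>2))"
    unfolding pow(1)
  proof (rule integral_mult_le_sqrt)
    show "integrable M (\<lambda>\<omega>. (?Y \<omega>)\<^sup>2)" using row_power_integrable[of k 2] by simp
    show "integrable M (\<lambda>\<omega>. ((?Y \<omega>)\<^sup>2)\<^sup>2)"
      using row_power_integrable[of k 4] unfolding pow(2)[symmetric] by simp
  qed measurable
  also have "\<dots> \<le> sqrt (real n * (b * m)) * sqrt (real n * (b ^ 3 * m) + 3 * (real n)\<^sup>2 * (b * m)\<^sup>2)"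
  proof (intro mult_mono real_sqrt_le_mono)
    show "expectation (\<lambda>\<omega>. (?Y \<omega>)\<^sup>2) \<le> real n * (b * m)"
      by (rule order_trans[OF expectation_row_square_le mult_right_mono]) (use assms K.bound_mult_nonneg in auto)
    have "expectation (\<lambda>\<omega>. ((?Y \<omega>)\<^sup>2)\<^sup>2) \<le> real k * (b ^ 3 * m) + 3 * (real k)\<^sup>2 * (b * m)\<^sup>2"
      using expectation_row_fourth_le[of k] unfolding pow(2) .
    also have "\<dots> \<le> real n * (b ^ 3 * m) + 3 * (real n)\<^sup>2 * (b * m)\<^sup>2"
      using assms K.bound_nonneg K.section_bound_nonneg
      by (intro add_mono mult_right_mono mult_left_mono power_mono) auto
    finally show "expectation (\<lambda>\<omega>. ((?Y \<omega>)\<^sup>2)\<^sup>2) \<le> \<dots>" .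
  qed (use K.bound_mult_nonneg in auto)
  finally show ?thesis .
qed

text \<open>
  Expanding the square of the row turns the conditional variance into an i.i.d. sum over the diagonal
  of the composed kernel and a U-statistic off the diagonal.
\<close>

lemma row_variance_eq:
  assumes w: "\<omega> \<in> space M"
  shows "row_variance k \<omega> = (\<Sum>i<k. K.composed (X i \<omega>) (X i \<omega>)) + 2 * U_sum K.composed k (\<lambda>i. X i \<omega>)"
proof -
  have prod: "integrable N (\<lambda>z. K (X i \<omega>) z * K (X j \<omega>) z)" for i j
    by (intro K.product_integrable X_in_space w)
  have "row_variance k \<omega> = (\<integral>z. (\<Sum>i<k. (K (X i \<omega>) z)\<^sup>2)
      + 2 * (\<Sum>j<k. \<Sum>i<j. K (X i \<omega>) z * K (X j \<omega>) z) \<partial>N)"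
    unfolding square_sum_eq_diagonal_plus_U_sum[of "\<lambda>x. K x _" "\<lambda>i. X i \<omega>"] U_sum_def ..
  also have "\<dots> = (\<Sum>i<k. K.composed (X i \<omega>) (X i \<omega>))
      + 2 * (\<Sum>j<k. \<Sum>i<j. K.composed (X i \<omega>) (X j \<omega>))"
    using prod by (simp add: Bochner_Integration.integral_sum K.composed_def power2_eq_square)
  finally show ?thesis by (simp add: U_sum_def)
qed

text \<open>
  Both parts of the conditional variance have explicit second moments after centring. The resulting
  bound remains small when it is summed over the \<open>n\<close> rows, so the conditional variances can be
  replaced by their means one row at a time.
\<close>

lemma expectation_row_variance_deviation_le:
  assumes "k \<le> n"
  shows "integrable M (row_variance k)"
    and "expectation (\<lambda>\<omega>. \<bar>row_variance k \<omega> - real k * K.second_moment\<bar>)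
      \<le> sqrt (2 * real n * (b * m)\<^sup>2 + 4 * (real n)\<^sup>2 * (b * m ^ 3))"
proof -
  interpret G: degenerate_kernel N K.composed by (rule K.composed_degenerate)
  note [measurable] = K.composed_measurable
  define \<psi> where "\<psi> x = K.composed x x - K.second_moment" for x
  let ?D = "\<lambda>\<omega>. \<Sum>i<k. \<psi> (X i \<omega>)"
    and ?V = "\<lambda>\<omega>. U_sum K.composed k (\<lambda>i. X i \<omega>)"
  have dec: "row_variance k \<omega> - real k * K.second_moment = ?D \<omega> + 2 * ?V \<omega>" if "\<omega> \<in> space M" for \<omega>
    using row_variance_eq[OF that, of k] by (simp add: \<psi>_def sum_subtractf)
  have [measurable]: "\<psi> \<in> borel_measurable N" unfolding \<psi>_def by measurable
  have self: "0 \<le> K.composed x x" "K.composed x x \<le> b * m" if "x \<in> space N" for x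
    using K.section_square_le[OF that] by (simp_all add: K.composed_self)
  have "(K.composed x x)\<^sup>2 \<le> (b * m)\<^sup>2" if "x \<in> space N" for x
    using self[OF that] by (intro power_mono)
  note selfsq = this
  have int1: "integrable N (\<lambda>x. K.composed x x)"
    by (rule N.integrable_const_bound[where B="b * m"]) (use self in \<open>auto intro!: AE_I2\<close>)
  have int2: "integrable N (\<lambda>x. (K.composed x x)\<^sup>2)"
    by (rule N.integrable_const_bound[where B="(b * m)\<^sup>2"]) (use selfsq in \<open>auto intro!: AE_I2\<close>)
  have E1: "(\<integral>x. K.composed x x \<partial>N) = K.second_moment"
    by (simp add: K.composed_self K.second_moment_eq)
  have \<psi>2: "(\<psi> x)\<^sup>2 = (K.composed x x)\<^sup>2 - 2 * K.second_moment * K.composed x x + K.second_moment\<^sup>2" for x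
    by (simp add: \<psi>_def power2_diff)
  have sq: "integrable N (\<lambda>x. (\<psi> x)\<^sup>2)" unfolding \<psi>2 using int1 int2 by simp
  have mean: "integral\<^sup>L N \<psi> = 0" unfolding \<psi>_def using int1 by (simp add: E1 N.prob_space)
  have "(\<integral>x. (\<psi> x)\<^sup>2 \<partial>N) = (\<integral>x. (K.composed x x)\<^sup>2 \<partial>N) - K.second_moment\<^sup>2"
    unfolding \<psi>2 using int1 int2 by (simp add: E1 N.prob_space power2_eq_square)
  also have "\<dots> \<le> (\<integral>x. (b * m)\<^sup>2 \<partial>N) - 0"
    by (intro diff_mono integral_mono int2) (use selfsq in auto)
  finally have \<psi>2_le: "(\<integral>x. (\<psi> x)\<^sup>2 \<partial>N) \<le> (b * m)\<^sup>2" by (simp add: N.prob_space)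
  have intD: "integrable M (\<lambda>\<omega>. (?D \<omega>)\<^sup>2)" by (rule integrable_iid_sum_square) (use sq mean in auto)
  have intV: "integrable M (\<lambda>\<omega>. (?V \<omega>)\<^sup>2)" by (rule integrable_U_sum_square) unfold_locales
  have intDV: "integrable M (\<lambda>\<omega>. (?D \<omega> + 2 * ?V \<omega>)\<^sup>2)"
    by (rule square_sum_integrable) (use intD intV in \<open>simp_all add: power_mult_distrib\<close>)
  have "integrable M (\<lambda>\<omega>. (?D \<omega> + 2 * ?V \<omega>) + real k * K.second_moment)"
    by (rule Bochner_Integration.integrable_add[OF integrable_of_square[OF _ intDV]]) auto
  then show "integrable M (row_variance k)"
    by (rule Bochner_Integration.integrable_cong[THEN iffD1, rotated -1]) (auto simp: dec[symmetric])
  \<comment> \<open>The factor 8 is halved below, because at most \<open>n\<^sup>2 / 2\<close> pairs contribute.\<close>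
  have ineq: "(s + 2 * v)\<^sup>2 \<le> 2 * s\<^sup>2 + 8 * v\<^sup>2" for s v :: real
    using zero_le_power2[of "s - 2 * v"] by (simp add: power2_eq_square algebra_simps)
  have "expectation (\<lambda>\<omega>. (?D \<omega> + 2 * ?V \<omega>)\<^sup>2) \<le> expectation (\<lambda>\<omega>. 2 * (?D \<omega>)\<^sup>2 + 8 * (?V \<omega>)\<^sup>2)"
    by (intro integral_mono intDV ineq) (use intD intV in auto)
  also have "\<dots> = 2 * (real k * (\<integral>x. (\<psi> x)\<^sup>2 \<partial>N))
      + 8 * (real k * (real k - 1) / 2 * integral\<^sup>L (N \<Otimes>\<^sub>M N) (\<lambda>(x, y). (K.composed x y)\<^sup>2))"
    using intD intV unfolding expectation_iid_sum_square[OF \<open>\<psi> \<in> borel_measurable N\<close> sq mean, of k, symmetric]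
      expectation_U_sum_square[OF G.degenerate_kernel_axioms, of k, symmetric] by simp
  also have "\<dots> \<le> 2 * (real n * (b * m)\<^sup>2) + 8 * ((real n)\<^sup>2 / 2 * (b * m ^ 3))"
  proof (intro add_mono mult_left_mono)
    show "real k * (\<integral>x. (\<psi> x)\<^sup>2 \<partial>N) \<le> real n * (b * m)\<^sup>2"
      by (rule mult_mono[OF _ \<psi>2_le]) (use assms in auto)
    have "real k * (real k - 1) \<le> real k * real k" by (intro mult_left_mono) auto
    also have "\<dots> \<le> (real n)\<^sup>2" unfolding power2_eq_square using assms by (intro mult_mono) auto
    finally have "real k * (real k - 1) / 2 \<le> (real n)\<^sup>2 / 2" by simp
    then show "real k * (real k - 1) / 2 * integral\<^sup>L (N \<Otimes>\<^sub>M N) (\<lambda>(x, y). (K.composed x y)\<^sup>2)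
        \<le> (real n)\<^sup>2 / 2 * (b * m ^ 3)"
      by (rule mult_mono[OF _ K.composed_second_moment_le]) (auto intro!: Bochner_Integration.integral_nonneg)
  qed simp_all
  finally have "expectation (\<lambda>\<omega>. (?D \<omega> + 2 * ?V \<omega>)\<^sup>2)
      \<le> 2 * real n * (b * m)\<^sup>2 + 4 * (real n)\<^sup>2 * (b * m ^ 3)" by (simp add: mult_ac)
  note final = this
  have "expectation (\<lambda>\<omega>. \<bar>row_variance k \<omega> - real k * K.second_moment\<bar>)
      = expectation (\<lambda>\<omega>. \<bar>?D \<omega> + 2 * ?V \<omega>\<bar>)"
    by (rule Bochner_Integration.integral_cong) (use dec in auto)
  also have "\<dots> \<le> sqrt (expectation (\<lambda>\<omega>. (?D \<omega> + 2 * ?V \<omega>)\<^sup>2))"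
    by (rule expectation_abs_le_sqrt[OF _ intDV]) measurable
  also have "\<dots> \<le> sqrt (2 * real n * (b * m)\<^sup>2 + 4 * (real n)\<^sup>2 * (b * m ^ 3))"
    by (rule real_sqrt_le_mono[OF final])
  finally show "expectation (\<lambda>\<omega>. \<bar>row_variance k \<omega> - real k * K.second_moment\<bar>)
      \<le> sqrt (2 * real n * (b * m)\<^sup>2 + 4 * (real n)\<^sup>2 * (b * m ^ 3))"
 .
qed

abbreviation damping :: "real \<Rightarrow> nat \<Rightarrow> real" where
  "damping t k \<equiv> exp (- (t\<^sup>2 * (real k * K.second_moment) / 2))"

lemma char_section_deviation:
  assumes w: "\<omega> \<in> space M"
  shows "cmod (\<integral>z. (iexp (t * row k \<omega> z) - damping t k) \<partial>N)
    \<le> \<bar>t\<bar> ^ 3 / 6 * (\<integral>z. \<bar>row k \<omega> z\<bar> ^ 3 \<partial>N)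
      + t\<^sup>2 / 2 * \<bar>row_variance k \<omega> - real k * K.second_moment\<bar>
      + t ^ 4 / 8 * (real k * K.second_moment)\<^sup>2"
proof -
  let ?a = "real k * K.second_moment"
  have int: "integrable N (row k \<omega>)" "integrable N (\<lambda>z. (row k \<omega> z)\<^sup>2)"
    using row_section_power_integrable[OF w, of k 1] row_section_power_integrable[OF w, of k 2]
      row_section_measurable[OF w, of k] by (simp_all add: integrable_abs_iff)
  have "(\<lambda>z. iexp (t * row k \<omega> z)) \<in> borel_measurable N"
    using row_section_measurable[OF w, of k] by measurable
  then have inte: "integrable N (\<lambda>z. iexp (t * row k \<omega> z))"
    by (intro N.integrable_const_bound[where B=1]) (auto simp del: of_real_mult of_real_sum)
  let ?R = "(\<integral>z. iexp (t * row k \<omega> z) \<partial>N) - complex_of_real (1 - t\<^sup>2 / 2 * row_variance k \<omega>)"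
  have eq: "(\<integral>z. (iexp (t * row k \<omega> z) - damping t k) \<partial>N)
      = ?R + complex_of_real (1 - t\<^sup>2 / 2 * row_variance k \<omega> - damping t k)"
    using inte by (simp add: N.prob_space del: of_real_mult of_real_sum)
  have 1: "cmod ?R \<le> \<bar>t\<bar> ^ 3 / 6 * (\<integral>z. \<bar>row k \<omega> z\<bar> ^ 3 \<partial>N)"
    by (rule N.char_third_order[OF row_section_measurable[OF w] int
        row_section_power_integrable[OF w] row_section_centred[OF w]])
  have "\<bar>1 - t\<^sup>2 / 2 * row_variance k \<omega> - damping t k\<bar>
      \<le> \<bar>t\<^sup>2 / 2 * (?a - row_variance k \<omega>)\<bar> + \<bar>1 - t\<^sup>2 * ?a / 2 - damping t k\<bar>"
    by (simp add: right_diff_distrib)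
  also have "\<dots> \<le> t\<^sup>2 / 2 * \<bar>row_variance k \<omega> - ?a\<bar> + (t\<^sup>2 * ?a / 2)\<^sup>2 / 2"
    by (intro add_mono exp_minus_second_order)
       (simp_all add: abs_mult abs_minus_commute K.second_moment_nonneg)
  also have "(t\<^sup>2 * ?a / 2)\<^sup>2 / 2 = t ^ 4 / 8 * ?a\<^sup>2"
    by (simp add: eval_nat_numeral)
  finally have 2: "\<bar>1 - t\<^sup>2 / 2 * row_variance k \<omega> - damping t k\<bar>
      \<le> t\<^sup>2 / 2 * \<bar>row_variance k \<omega> - ?a\<bar> + t ^ 4 / 8 * ?a\<^sup>2" .
  show ?thesis unfolding eq
    by (rule order_trans[OF norm_triangle_ineq]) (use 1 2 in \<open>simp only: norm_of_real\<close>)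
qed

text \<open>
  The past is frozen and the fresh point integrated first. The factor coming from the past has
  modulus one and drops out of the estimate.
\<close>

lemma char_step:
  assumes kn: "k \<le> n"
  shows "cmod (expectation (\<lambda>\<omega>. iexp (t * U (Suc k) \<omega>)) - damping t k * expectation (\<lambda>\<omega>. iexp (t * U k \<omega>)))
    \<le> clt_step_error b m t n"
proof -
  note [measurable] = row_sum_measurable[OF kernel_measurable_pair] U_sum_past_measurable[OF kernel_measurable_pair]
  let ?F = "\<lambda>\<omega> z. iexp (t * U k \<omega>) * (iexp (t * row k \<omega> z) - damping t k)"
  let ?B = "\<lambda>\<omega>. \<bar>t\<bar> ^ 3 / 6 * (\<integral>z. \<bar>row k \<omega> z\<bar> ^ 3 \<partial>N)
      + t\<^sup>2 / 2 * \<bar>row_variance k \<omega> - real k * K.second_moment\<bar>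
      + t ^ 4 / 8 * (real k * K.second_moment)\<^sup>2"
  have intU: "integrable M (\<lambda>\<omega>. iexp (t * U j \<omega>))" for j
    by (rule integrable_const_bound[where B=1]) auto
  have split: "?F \<omega> (X k \<omega>) = iexp (t * U (Suc k) \<omega>) - damping t k * iexp (t * U k \<omega>)" for \<omega>
    by (simp add: U_sum_Suc right_diff_distrib exp_add[symmetric] distrib_left mult.commute)
  have intF: "integrable M (\<lambda>\<omega>. ?F \<omega> (X k \<omega>))" unfolding split using intU by simp
  define \<Phi> where "\<Phi> = (\<lambda>(u, z). iexp (t * U_sum K k u) * (iexp (t * (\<Sum>i<k. K (u i) z)) - damping t k))"
  have \<Phi>: "\<Phi> (past k \<omega>, z) = ?F \<omega> z" for \<omega> z
    by (simp only: \<Phi>_def case_prod_conv row_sum_past U_sum_past[OF order_refl])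
  have "\<Phi> \<in> borel_measurable (past_space k \<Otimes>\<^sub>M N)" unfolding \<Phi>_def by measurable
  note fresh = expectation_fresh_inner[OF this, unfolded \<Phi>, OF intF]
    integrable_fresh_inner[OF this, unfolded \<Phi>, OF intF]
  have cube: "integrable M (\<lambda>\<omega>. \<integral>z. \<bar>row k \<omega> z\<bar> ^ 3 \<partial>N)"
    "expectation (\<lambda>\<omega>. \<bar>row k \<omega> (X k \<omega>)\<bar> ^ 3) = expectation (\<lambda>\<omega>. \<integral>z. \<bar>row k \<omega> z\<bar> ^ 3 \<partial>N)"
    using expectation_fresh_inner[of "\<lambda>(u, z). \<bar>\<Sum>i<k. K (u i) z\<bar> ^ 3" k]
      integrable_fresh_inner[of "\<lambda>(u, z). \<bar>\<Sum>i<k. K (u i) z\<bar> ^ 3" k] row_power_integrable[of k 3]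
    by (simp_all add: row_sum_past)
  note dev = expectation_row_variance_deviation_le[OF kn]
  have "cmod (expectation (\<lambda>\<omega>. iexp (t * U (Suc k) \<omega>)) - damping t k * expectation (\<lambda>\<omega>. iexp (t * U k \<omega>)))
      = cmod (expectation (\<lambda>\<omega>. ?F \<omega> (X k \<omega>)))"
    unfolding split using intU by simp
  also have "\<dots> \<le> expectation (\<lambda>\<omega>. cmod (\<integral>z. ?F \<omega> z \<partial>N))"
    unfolding fresh(1) by (rule integral_norm_bound)
  also have "\<dots> \<le> expectation ?B"
  proof (rule integral_mono)
    show "integrable M (\<lambda>\<omega>. cmod (\<integral>z. ?F \<omega> z \<partial>N))" using fresh(2) by simp
    show "integrable M ?B" using cube(1) dev(1) by simp
    show "cmod (\<integral>z. ?F \<omega> z \<partial>N) \<le> ?B \<omega>" if "\<omega> \<in> space M" for \<omega>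
      using char_section_deviation[OF that, of t k] by (simp add: norm_mult)
  qed
  also have "\<dots> = \<bar>t\<bar> ^ 3 / 6 * expectation (\<lambda>\<omega>. \<bar>row k \<omega> (X k \<omega>)\<bar> ^ 3)
      + t\<^sup>2 / 2 * expectation (\<lambda>\<omega>. \<bar>row_variance k \<omega> - real k * K.second_moment\<bar>)
      + t ^ 4 / 8 * (real k * K.second_moment)\<^sup>2"
    unfolding cube(2) using cube(1) dev(1) by (simp add: prob_space)
  also have "\<dots> \<le> clt_step_error b m t n"
    unfolding clt_step_error_def
    by (intro add_mono mult_left_mono dev(2) expectation_row_cube_le[OF kn] power_mono mult_mono
          K.second_moment_le K.second_moment_nonneg)
       (use kn K.second_moment_nonneg in auto)
  finally show ?thesis .
qed

text \<open>
  The rows are replaced one after another. Earlier errors are multiplied by Gaussian factors, which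
  are at most one, so the errors only add up.
\<close>

theorem char_U_sum_approx:
  "cmod (expectation (\<lambda>\<omega>. iexp (t * U n \<omega>))
      - exp (- (t\<^sup>2 * (real n * (real n - 1) / 2 * K.second_moment) / 2))) \<le> real n * clt_step_error b m t n"
proof -
  have "cmod (expectation (\<lambda>\<omega>. iexp (t * U k \<omega>))
      - exp (- (t\<^sup>2 * (real k * (real k - 1) / 2 * K.second_moment) / 2))) \<le> real k * clt_step_error b m t n"
    if "k \<le> n" for k
    using that
  proof (induction k)
    case 0
    show ?case by (simp add: U_sum_def prob_space)
  next
    case (Suc k)
    let ?e = "\<lambda>k. exp (- (t\<^sup>2 * (real k * (real k - 1) / 2 * K.second_moment) / 2))"
    let ?\<phi> = "\<lambda>k. expectation (\<lambda>\<omega>. iexp (t * U k \<omega>))"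
    have e: "?e (Suc k) = damping t k * ?e k"
      unfolding exp_add[symmetric] by (simp add: field_simps)
    have "cmod (?\<phi> (Suc k) - ?e (Suc k))
        = cmod ((?\<phi> (Suc k) - damping t k * ?\<phi> k) + complex_of_real (damping t k) * (?\<phi> k - ?e k))"
      unfolding e by (simp add: algebra_simps)
    also have "\<dots> \<le> cmod (?\<phi> (Suc k) - damping t k * ?\<phi> k) + damping t k * cmod (?\<phi> k - ?e k)"
      by (rule order_trans[OF norm_triangle_ineq]) (simp add: norm_mult)
    also have "\<dots> \<le> clt_step_error b m t n + 1 * cmod (?\<phi> k - ?e k)"
      using Suc.prems K.second_moment_nonneg by (intro add_mono char_step mult_right_mono) auto
    also have "\<dots> \<le> real (Suc k) * clt_step_error b m t n" using Suc by (simp add: distrib_right)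
    finally show ?case .
  qed
  then show ?thesis by simp
qed

end

text \<open>
  These are the sizes of \<open>b\<close> and \<open>m\<close> for the normalized edge kernel, with \<open>(q n)\<^sup>2 = r n ^ d\<close>. In these
  terms \<open>b * m\<close> is of order \<open>1 / n\<^sup>2\<close>, and the error is made of the quantities \<open>1 / (n * q n)\<^sup>2\<close>,
  \<open>1 / n\<close> and \<open>(q n)\<^sup>2\<close>.
\<close>

lemma clt_step_error_vanishes:
  fixes q :: "nat \<Rightarrow> real"
  assumes b0: "0 \<le> b0" and m0: "0 \<le> m0" and q: "\<And>n. 0 < q n" "q \<longlonglongrightarrow> 0"
    and nq: "filterlim (\<lambda>n. real n * q n) at_top sequentially"
  shows "(\<lambda>n. real n * clt_step_error (b0 / (real n * q n)) (m0 * q n / real n) t n) \<longlonglongrightarrow> 0"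
proof -
  let ?i = "\<lambda>n. inverse (real n * q n)" and ?j = "\<lambda>n. inverse (real n)"
  let ?F = "\<lambda>n. \<bar>t\<bar> ^ 3 / 6 * (sqrt (b0 * m0) * sqrt (b0 ^ 3 * m0 * (?i n)\<^sup>2 + 3 * (b0 * m0)\<^sup>2 * ?j n))
     + t\<^sup>2 / 2 * sqrt (2 * (b0 * m0)\<^sup>2 * ?j n + 4 * (b0 * m0 ^ 3) * (q n)\<^sup>2)
     + t ^ 4 / 8 * ((b0 * m0)\<^sup>2 * ?j n)"
  have "?F \<longlonglongrightarrow> \<bar>t\<bar> ^ 3 / 6 * (sqrt (b0 * m0) * sqrt (b0 ^ 3 * m0 * 0\<^sup>2 + 3 * (b0 * m0)\<^sup>2 * 0))
     + t\<^sup>2 / 2 * sqrt (2 * (b0 * m0)\<^sup>2 * 0 + 4 * (b0 * m0 ^ 3) * 0\<^sup>2)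
     + t ^ 4 / 8 * ((b0 * m0)\<^sup>2 * 0)"
    by (intro tendsto_intros q tendsto_inverse_0_at_top nq filterlim_real_sequentially)
  then have lim: "?F \<longlonglongrightarrow> 0" by simp
  have "\<forall>\<^sub>F n in sequentially. ?F n = real n * clt_step_error (b0 / (real n * q n)) (m0 * q n / real n) t n"
    using eventually_gt_at_top[of 0]
  proof eventually_elim
    fix n :: nat assume n: "0 < n"
    let ?b = "b0 / (real n * q n)" and ?m = "m0 * q n / real n"
    have bm: "?b * ?m = b0 * m0 / (real n)\<^sup>2" using n q(1)[of n] by (simp add: field_simps power2_eq_square)
    have "real n * (sqrt (real n * (?b * ?m)) * sqrt (real n * (?b ^ 3 * ?m) + 3 * (real n)\<^sup>2 * (?b * ?m)\<^sup>2))
        = sqrt (real n * (real n * (?b * ?m))) * sqrt (real n * (real n * (?b ^ 3 * ?m) + 3 * (real n)\<^sup>2 * (?b * ?m)\<^sup>2))"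
      unfolding real_sqrt_mult[of "real n" "real n * (?b * ?m)"]
        real_sqrt_mult[of "real n" "real n * (?b ^ 3 * ?m) + 3 * (real n)\<^sup>2 * (?b * ?m)\<^sup>2"]
      by simp
    also have "real n * (real n * (?b * ?m)) = b0 * m0" unfolding bm using n by (simp add: power2_eq_square)
    also have "real n * (real n * (?b ^ 3 * ?m) + 3 * (real n)\<^sup>2 * (?b * ?m)\<^sup>2)
        = b0 ^ 3 * m0 * (?i n)\<^sup>2 + 3 * (b0 * m0)\<^sup>2 * ?j n"
      unfolding bm using n q(1)[of n] by (simp add: field_simps power2_eq_square power3_eq_cube)
    finally have 1: "real n * (sqrt (real n * (?b * ?m)) * sqrt (real n * (?b ^ 3 * ?m) + 3 * (real n)\<^sup>2 * (?b * ?m)\<^sup>2))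
        = sqrt (b0 * m0) * sqrt (b0 ^ 3 * m0 * (?i n)\<^sup>2 + 3 * (b0 * m0)\<^sup>2 * ?j n)" .
    have "real n * sqrt (2 * real n * (?b * ?m)\<^sup>2 + 4 * (real n)\<^sup>2 * (?b * ?m ^ 3))
        = sqrt ((real n)\<^sup>2 * (2 * real n * (?b * ?m)\<^sup>2 + 4 * (real n)\<^sup>2 * (?b * ?m ^ 3)))"
      unfolding real_sqrt_mult by simp
    also have "(real n)\<^sup>2 * (2 * real n * (?b * ?m)\<^sup>2 + 4 * (real n)\<^sup>2 * (?b * ?m ^ 3))
        = 2 * (b0 * m0)\<^sup>2 * ?j n + 4 * (b0 * m0 ^ 3) * (q n)\<^sup>2"
      unfolding bm using n q(1)[of n] by (simp add: field_simps power2_eq_square power3_eq_cube)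
    finally have 2: "real n * sqrt (2 * real n * (?b * ?m)\<^sup>2 + 4 * (real n)\<^sup>2 * (?b * ?m ^ 3))
        = sqrt (2 * (b0 * m0)\<^sup>2 * ?j n + 4 * (b0 * m0 ^ 3) * (q n)\<^sup>2)" .
    have 3: "real n * (real n * (?b * ?m))\<^sup>2 = (b0 * m0)\<^sup>2 * ?j n"
      unfolding bm using n by (simp add: field_simps power2_eq_square)
    show "?F n = real n * clt_step_error ?b ?m t n"
      unfolding clt_step_error_def 1[symmetric] 2[symmetric] 3[symmetric] by (simp add: algebra_simps)
  qed
  with lim show ?thesis by (rule Lim_transform_eventually)
qed

section \<open>The edge kernel and its integral over the whole space\<close>

definition edge_kernel :: "real \<Rightarrow> real \<Rightarrow> 'a::euclidean_space \<Rightarrow> 'a \<Rightarrow> real" where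
  "edge_kernel \<gamma> \<rho> x y = of_bool (norm (x - y) \<le> \<rho>) * norm (x - y) powr \<gamma>"

text \<open>
  The integral of \<open>norm y powr \<gamma>\<close> over the ball of radius \<open>\<rho>\<close>; the first argument carries the
  dimension.
\<close>

definition ball_moment :: "'a::euclidean_space itself \<Rightarrow> real \<Rightarrow> real \<Rightarrow> real" where
  "ball_moment _ \<gamma> \<rho> = real DIM('a) * unit_ball_vol (real DIM('a)) / (\<gamma> + real DIM('a)) * \<rho> powr (\<gamma> + real DIM('a))"

lemma edge_kernel_nonneg: "0 \<le> edge_kernel \<gamma> \<rho> x y" by (simp add: edge_kernel_def)

lemma edge_kernel_commute: "edge_kernel \<gamma> \<rho> x y = edge_kernel \<gamma> \<rho> y x"
  by (simp add: edge_kernel_def norm_minus_commute)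

lemma edge_kernel_square: "(edge_kernel \<gamma> \<rho> x y)\<^sup>2 = edge_kernel (2 * \<gamma>) \<rho> x y"
  by (simp add: edge_kernel_def power_mult_distrib power2_eq_square powr_add[symmetric])

lemma edge_kernel_measurable [measurable]:
  "case_prod (edge_kernel \<gamma> \<rho>) \<in> borel_measurable (borel \<Otimes>\<^sub>M borel)"
  unfolding edge_kernel_def by measurable

lemma edge_kernel_section_measurable [measurable]: "edge_kernel \<gamma> \<rho> x \<in> borel_measurable borel"
  unfolding edge_kernel_def by measurable

text \<open>
  Both measures have the distribution function \<open>t \<mapsto> vol (cball x (min t \<rho>))\<close>.
\<close>

lemma distr_norm_cball:
  fixes x :: "'a::euclidean_space"
  assumes \<rho>: "0 < \<rho>"
  shows "distr (density lborel (indicator (cball x \<rho>))) borel (\<lambda>y. norm (x - y))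
    = density lborel (\<lambda>s. ennreal (real DIM('a) * unit_ball_vol (real DIM('a)) * s ^ (DIM('a) - 1)) * indicator {0..\<rho>} s)"
    (is "?L = ?R")
proof -
  let ?\<kappa> = "unit_ball_vol (real DIM('a))" and ?d = "DIM('a)"
  have em_L: "emeasure ?L {..t} = (if t < 0 then 0 else ennreal (?\<kappa> * min t \<rho> ^ ?d))" for t
  proof -
    have "emeasure ?L {..t} = emeasure lborel (cball x \<rho> \<inter> {y. norm (x - y) \<le> t})"
    proof -
      have "emeasure ?L {..t} = emeasure (density lborel (indicator (cball x \<rho>))) {y. norm (x - y) \<le> t}"
        by (subst emeasure_distr) (auto simp: vimage_def)
      also have "\<dots> = (\<integral>\<^sup>+y. indicator (cball x \<rho>) y * indicator {y. norm (x - y) \<le> t} y \<partial>lborel)"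
        by (rule emeasure_density) (auto intro!: borel_measurable_indicator)
      also have "\<dots> = (\<integral>\<^sup>+y. indicator (cball x \<rho> \<inter> {y. norm (x - y) \<le> t}) y \<partial>lborel)"
        by (simp only: indicator_inter_arith)
      also have "\<dots> = emeasure lborel (cball x \<rho> \<inter> {y. norm (x - y) \<le> t})"
        by (rule nn_integral_indicator) auto
      finally show ?thesis .
    qed
    also have "cball x \<rho> \<inter> {y. norm (x - y) \<le> t} = cball x (min t \<rho>)"
      by (auto simp: dist_norm)
    also have "emeasure lborel \<dots> = (if t < 0 then 0 else ennreal (?\<kappa> * min t \<rho> ^ ?d))"
      using \<rho> by (simp add: emeasure_cball)
    finally show ?thesis .
  qed
  have em_R: "emeasure ?R {..t} = (if t < 0 then 0 else ennreal (?\<kappa> * min t \<rho> ^ ?d))" for t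
  proof -
    have "emeasure ?R {..t} = (\<integral>\<^sup>+s. ennreal (real ?d * ?\<kappa> * s ^ (?d - 1)) * indicator {0..min t \<rho>} s \<partial>lborel)"
      by (subst emeasure_density) (auto intro!: nn_integral_cong simp: indicator_def)
    also have "\<dots> = (if t < 0 then 0 else ennreal (?\<kappa> * min t \<rho> ^ ?d))"
    proof (cases "t < 0")
      case False
      have "(\<integral>\<^sup>+s. ennreal (real ?d * ?\<kappa> * s ^ (?d - 1)) * indicator {0..min t \<rho>} s \<partial>lborel)
          = ennreal (?\<kappa> * min t \<rho> ^ ?d - ?\<kappa> * 0 ^ ?d)"
        using False \<rho> by (intro nn_integral_FTC_Icc) (auto intro!: derivative_eq_intros)
      with False show ?thesis by (simp add: zero_power)
    qed simp
    finally show ?thesis .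
  qed
  have fin: "emeasure ?L UNIV < \<infinity>" "emeasure ?R UNIV < \<infinity>"
  proof -
    have "emeasure ?L UNIV = emeasure (density lborel (indicator (cball x \<rho>))) UNIV"
      by (subst emeasure_distr) auto
    also have "\<dots> = (\<integral>\<^sup>+y. indicator (cball x \<rho>) y * indicator UNIV y \<partial>lborel)"
      by (rule emeasure_density) (auto intro!: borel_measurable_indicator)
    also have "\<dots> = emeasure lborel (cball x \<rho>)" by simp
    finally show "emeasure ?L UNIV < \<infinity>" using \<rho> by (simp add: emeasure_cball)
    have "emeasure ?R UNIV = emeasure ?R {..\<rho>}"
      by (subst (1 2) emeasure_density) (auto intro!: nn_integral_cong split: split_indicator)
    then show "emeasure ?R UNIV < \<infinity>" by (simp only: em_R) simp
  qed
  show ?thesis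
  proof (rule cdf_unique')
    show "finite_borel_measure ?L" "finite_borel_measure ?R"
      using fin by (auto intro!: finite_borel_measure.intro finite_borel_measure_axioms.intro finite_measureI)
    show "cdf ?L = cdf ?R" by (rule ext) (simp only: cdf_def measure_def em_L em_R)
  qed
qed

text \<open>
  The integrand depends only on the norm of \<open>x - y\<close>, whose image measure is known; this leaves a
  one-dimensional integral of a power.
\<close>

lemma nn_integral_edge_kernel:
  fixes x :: "'a::euclidean_space"
  assumes \<rho>: "0 < \<rho>" and \<gamma>: "- real DIM('a) < \<gamma>"
  shows "(\<integral>\<^sup>+y. ennreal (edge_kernel \<gamma> \<rho> x y) \<partial>lborel) = ennreal (ball_moment TYPE('a) \<gamma> \<rho>)"
proof -
  let ?\<kappa> = "unit_ball_vol (real DIM('a))" and ?d = "DIM('a)"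
  have pow: "s ^ (?d - 1) * s powr \<gamma> = s powr (\<gamma> + real ?d - 1)" if "0 \<le> s" for s :: real
  proof (cases "s = 0")
    case False
    then have "s ^ (?d - 1) = s powr (real ?d - 1)"
      using that DIM_positive[where 'a='a] by (simp add: powr_realpow[symmetric])
    then show ?thesis by (simp add: powr_add[symmetric] algebra_simps)
  qed simp
  have "(\<integral>\<^sup>+y. ennreal (edge_kernel \<gamma> \<rho> x y) \<partial>lborel)
      = (\<integral>\<^sup>+y. ennreal (norm (x - y) powr \<gamma>) \<partial>density lborel (indicator (cball x \<rho>)))"
    by (subst nn_integral_density)
       (auto simp: edge_kernel_def dist_norm intro!: nn_integral_cong borel_measurable_indicator split: split_indicator)
  also have "\<dots> = (\<integral>\<^sup>+s. ennreal (s powr \<gamma>) \<partial>distr (density lborel (indicator (cball x \<rho>))) borel (\<lambda>y. norm (x - y)))"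
    by (subst nn_integral_distr) auto
  also have "\<dots> = (\<integral>\<^sup>+s. ennreal (real ?d * ?\<kappa> * s ^ (?d - 1)) * indicator {0..\<rho>} s * ennreal (s powr \<gamma>) \<partial>lborel)"
    unfolding distr_norm_cball[OF \<rho>] by (subst nn_integral_density) auto
  also have "\<dots> = (\<integral>\<^sup>+s. ennreal (real ?d * ?\<kappa> * (if s \<in> {0..\<rho>} then s powr (\<gamma> + real ?d - 1) else 0)) \<partial>lborel)"
    by (intro nn_integral_cong)
       (auto simp: ennreal_mult[symmetric] pow[symmetric] mult.assoc split: split_indicator)
  also have "\<dots> = ennreal (real ?d * ?\<kappa> * (\<rho> powr (\<gamma> + real ?d) / (\<gamma> + real ?d)))"
  proof (rule nn_integral_has_integral_lborel)
    have "((\<lambda>s. s powr (\<gamma> + real ?d - 1)) has_integral (\<rho> powr (\<gamma> + real ?d) / (\<gamma> + real ?d))) {0..\<rho>}"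
      using has_integral_powr_from_0[of "\<gamma> + real ?d - 1" \<rho>] \<rho> \<gamma> by simp
    then have "((\<lambda>s. if s \<in> {0..\<rho>} then s powr (\<gamma> + real ?d - 1) else 0) has_integral
        (\<rho> powr (\<gamma> + real ?d) / (\<gamma> + real ?d))) UNIV"
      by (simp only: has_integral_restrict_UNIV)
    then show "((\<lambda>s. real ?d * ?\<kappa> * (if s \<in> {0..\<rho>} then s powr (\<gamma> + real ?d - 1) else 0)) has_integral
        (real ?d * ?\<kappa> * (\<rho> powr (\<gamma> + real ?d) / (\<gamma> + real ?d)))) UNIV"
      by (rule has_integral_mult_right)
  qed auto
  finally show ?thesis by (simp add: ball_moment_def)
qed

section \<open>The Hoeffding decomposition\<close>

locale symmetric_kernel = prob_space N for N :: "'b measure" +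
  fixes h :: "'b \<Rightarrow> 'b \<Rightarrow> real"
  assumes h_measurable [measurable]: "case_prod h \<in> borel_measurable (N \<Otimes>\<^sub>M N)"
    and h_commute: "\<And>x y. h x y = h y x"
    and h_section_square: "\<And>x. x \<in> space N \<Longrightarrow> integrable N (\<lambda>y. (h x y)\<^sup>2)"
    and h_square: "integrable (N \<Otimes>\<^sub>M N) (\<lambda>(x, y). (h x y)\<^sup>2)"
begin

sublocale square: pair_prob_space N N ..

definition section_mean :: "'b \<Rightarrow> real" where "section_mean x = (\<integral>y. h x y \<partial>N)"
definition total_mean :: real where "total_mean = (\<integral>x. section_mean x \<partial>N)"
definition mean_part :: "'b \<Rightarrow> 'b \<Rightarrow> real" where
  "mean_part x y = section_mean x + section_mean y - total_mean"
definition degenerate_part :: "'b \<Rightarrow> 'b \<Rightarrow> real" where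
  "degenerate_part x y = h x y - mean_part x y"

lemma h_section_measurable: "x \<in> space N \<Longrightarrow> h x \<in> borel_measurable N"
  using measurable_Pair2[OF h_measurable] by simp

lemma h_section_integrable: "x \<in> space N \<Longrightarrow> integrable N (h x)"
  by (rule integrable_of_square) (simp_all add: h_section_measurable h_section_square)

lemma section_mean_measurable [measurable]: "section_mean \<in> borel_measurable N"
  unfolding section_mean_def by measurable

lemma section_mean_square_integrable: "integrable N (\<lambda>x. (section_mean x)\<^sup>2)"
proof (rule Bochner_Integration.integrable_bound)
  show "integrable N (\<lambda>x. \<integral>y. (h x y)\<^sup>2 \<partial>N)"
    using square.integrable_fst[of "\<lambda>x y. (h x y)\<^sup>2"] h_square by simp
  have "(section_mean x)\<^sup>2 \<le> (\<integral>y. (h x y)\<^sup>2 \<partial>N)" if x: "x \<in> space N" for x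
  proof -
    have "\<bar>section_mean x\<bar> \<le> (\<integral>y. \<bar>h x y\<bar> \<partial>N)" unfolding section_mean_def by (rule integral_abs_bound)
    also have "\<dots> \<le> sqrt (\<integral>y. (h x y)\<^sup>2 \<partial>N)"
      by (rule expectation_abs_le_sqrt[OF h_section_measurable[OF x] h_section_square[OF x]])
    finally have "\<bar>section_mean x\<bar>\<^sup>2 \<le> (sqrt (\<integral>y. (h x y)\<^sup>2 \<partial>N))\<^sup>2" by (intro power_mono) auto
    then show ?thesis by simp
  qed
  then show "AE x in N. norm ((section_mean x)\<^sup>2) \<le> norm (\<integral>y. (h x y)\<^sup>2 \<partial>N)" by (auto intro!: AE_I2)
qed measurable

lemma section_mean_integrable: "integrable N section_mean"
  by (rule integrable_of_square) (use section_mean_square_integrable in auto)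

lemma integrable_fst_snd:
  fixes g :: "'b \<Rightarrow> real"
  assumes g: "integrable N g"
  shows "integrable (N \<Otimes>\<^sub>M N) (\<lambda>(x, y). g x)" "integrable (N \<Otimes>\<^sub>M N) (\<lambda>(x, y). g y)"
proof -
  have [measurable]: "g \<in> borel_measurable N" using g by simp
  show 1: "integrable (N \<Otimes>\<^sub>M N) (\<lambda>(x, y). g x)"
    by (rule square.Fubini_integrable) (use g in \<open>auto simp: prob_space\<close>)
  show "integrable (N \<Otimes>\<^sub>M N) (\<lambda>(x, y). g y)"
    using square.integrable_product_swap[OF 1] by (simp add: case_prod_beta')
qed

lemma mean_part_measurable [measurable]: "case_prod mean_part \<in> borel_measurable (N \<Otimes>\<^sub>M N)"
  unfolding mean_part_def by measurable

lemma degenerate_part_measurable [measurable]: "case_prod degenerate_part \<in> borel_measurable (N \<Otimes>\<^sub>M N)"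
  unfolding degenerate_part_def by measurable

lemma section_mean_fst_square: "integrable (N \<Otimes>\<^sub>M N) (\<lambda>p. (section_mean (fst p) - total_mean)\<^sup>2)"
  and section_mean_snd_square: "integrable (N \<Otimes>\<^sub>M N) (\<lambda>p. (section_mean (snd p))\<^sup>2)"
proof -
  have "integrable N (\<lambda>x. (section_mean x - total_mean)\<^sup>2)"
    unfolding power2_diff using section_mean_integrable section_mean_square_integrable by auto
  then show "integrable (N \<Otimes>\<^sub>M N) (\<lambda>p. (section_mean (fst p) - total_mean)\<^sup>2)"
    using integrable_fst_snd(1) by (auto simp: case_prod_beta')
  show "integrable (N \<Otimes>\<^sub>M N) (\<lambda>p. (section_mean (snd p))\<^sup>2)"
    using integrable_fst_snd(2)[OF section_mean_square_integrable] by (simp add: case_prod_beta')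
qed

lemma mean_part_square_integrable: "integrable (N \<Otimes>\<^sub>M N) (\<lambda>(x, y). (mean_part x y)\<^sup>2)"
proof -
  have "integrable (N \<Otimes>\<^sub>M N) (\<lambda>p. ((section_mean (fst p) - total_mean) + section_mean (snd p))\<^sup>2)"
    by (intro square_sum_integrable section_mean_fst_square section_mean_snd_square) measurable
  then show ?thesis by (simp add: mean_part_def case_prod_beta' algebra_simps)
qed

lemma degenerate_part_kernel: "degenerate_kernel N degenerate_part"
proof
  show "degenerate_part x y = degenerate_part y x" for x y
    by (simp add: degenerate_part_def mean_part_def h_commute)
  have "integrable (N \<Otimes>\<^sub>M N) (\<lambda>p. (h (fst p) (snd p) + - mean_part (fst p) (snd p))\<^sup>2)"
    by (rule square_sum_integrable)
       (use h_square mean_part_square_integrable in \<open>auto simp: case_prod_beta'\<close>)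
  then show "integrable (N \<Otimes>\<^sub>M N) (\<lambda>(x, y). (degenerate_part x y)\<^sup>2)"
    by (simp add: degenerate_part_def case_prod_beta')
  fix x assume x: "x \<in> space N"
  note [measurable] = h_section_measurable[OF x]
  have "integrable N (\<lambda>y. (section_mean y + (section_mean x - total_mean))\<^sup>2)"
    by (rule square_sum_integrable) (use section_mean_square_integrable in auto)
  then have "integrable N (\<lambda>y. (- (section_mean y + (section_mean x - total_mean)))\<^sup>2)"
    by (simp only: power2_minus)
  then have "integrable N (\<lambda>y. (h x y + - (section_mean y + (section_mean x - total_mean)))\<^sup>2)"
    by (rule square_sum_integrable[rotated -1]) (use h_section_square[OF x] in measurable)
  then show "integrable N (\<lambda>y. (degenerate_part x y)\<^sup>2)"
    by (simp add: degenerate_part_def mean_part_def algebra_simps)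
  show "(\<integral>y. degenerate_part x y \<partial>N) = 0"
    unfolding degenerate_part_def mean_part_def
    using h_section_integrable[OF x] section_mean_integrable
    by (simp add: prob_space section_mean_def[symmetric] total_mean_def[symmetric])
qed measurable

text \<open>
  The degenerate part is orthogonal to every function of one variable, hence to the rest.
\<close>

lemma second_moment_decomposition:
  "integral\<^sup>L (N \<Otimes>\<^sub>M N) (\<lambda>(x, y). (h x y)\<^sup>2)
   = integral\<^sup>L (N \<Otimes>\<^sub>M N) (\<lambda>(x, y). (degenerate_part x y)\<^sup>2)
     + integral\<^sup>L (N \<Otimes>\<^sub>M N) (\<lambda>(x, y). (mean_part x y)\<^sup>2)"
proof -
  interpret D: degenerate_kernel N degenerate_part by (rule degenerate_part_kernel)
  let ?D = "\<lambda>p. degenerate_part (fst p) (snd p)"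
  have sqD: "integrable (N \<Otimes>\<^sub>M N) (\<lambda>p. (?D p)\<^sup>2)"
    using D.kernel_square by (simp add: case_prod_beta')
  have sqG: "integrable (N \<Otimes>\<^sub>M N) (\<lambda>p. (mean_part (fst p) (snd p))\<^sup>2)"
    using mean_part_square_integrable by (simp add: case_prod_beta')
  have i1: "integrable (N \<Otimes>\<^sub>M N) (\<lambda>(x, y). degenerate_part x y * (section_mean x - total_mean))"
    and i2: "integrable (N \<Otimes>\<^sub>M N) (\<lambda>(x, y). degenerate_part x y * section_mean y)"
    unfolding case_prod_beta'
    by (rule integrable_mult_of_squares; use sqD section_mean_fst_square section_mean_snd_square in simp)+
  have "integral\<^sup>L (N \<Otimes>\<^sub>M N) (\<lambda>(x, y). degenerate_part x y * (section_mean x - total_mean))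
      = (\<integral>x. 0 \<partial>N)"
    unfolding square.integral_fst[OF i1, symmetric]
    by (rule Bochner_Integration.integral_cong) (simp_all add: D.kernel_degenerate)
  moreover have "integral\<^sup>L (N \<Otimes>\<^sub>M N) (\<lambda>(x, y). degenerate_part x y * section_mean y) = (\<integral>y. 0 \<partial>N)"
    unfolding square.integral_snd[OF i2, symmetric]
    by (rule Bochner_Integration.integral_cong)
       (simp_all add: D.kernel_commute[of _ "_::'b"] D.kernel_degenerate)
  moreover have "(\<lambda>(x, y). (h x y)\<^sup>2) = (\<lambda>p. ((?D p)\<^sup>2 + (mean_part (fst p) (snd p))\<^sup>2)
      + 2 * ((\<lambda>(x, y). degenerate_part x y * (section_mean x - total_mean)) p
        + (\<lambda>(x, y). degenerate_part x y * section_mean y) p))"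
    by (auto simp: fun_eq_iff degenerate_part_def mean_part_def power2_eq_square algebra_simps)
  ultimately show ?thesis using sqD sqG i1 i2 by (simp add: case_prod_beta')
qed

text \<open>
  Every point belongs to \<open>n - 1\<close> pairs.
\<close>

lemma U_sum_hoeffding:
  "U_sum h n u - real n * (real n - 1) / 2 * total_mean
   = U_sum degenerate_part n u + (real n - 1) * (\<Sum>i<n. (section_mean (u i) - total_mean))"
proof -
  have "U_sum h n u = U_sum degenerate_part n u + U_sum mean_part n u"
    by (simp add: U_sum_def degenerate_part_def sum_subtractf)
  moreover have "U_sum mean_part n u = real n * (real n - 1) / 2 * total_mean
      + (real n - 1) * (\<Sum>i<n. (section_mean (u i) - total_mean))"
    by (induction n)
       (simp_all add: U_sum_def mean_part_def sum.distrib sum_subtractf field_simps)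
  ultimately show ?thesis by simp
qed

lemma total_mean_bounds:
  assumes "\<And>x. x \<in> space N \<Longrightarrow> 0 \<le> section_mean x" "\<And>x. x \<in> space N \<Longrightarrow> section_mean x \<le> c"
  shows "0 \<le> total_mean" "total_mean \<le> c"
proof -
  show "0 \<le> total_mean" unfolding total_mean_def
    by (rule Bochner_Integration.integral_nonneg_AE) (use assms in \<open>auto intro!: AE_I2\<close>)
  have "total_mean \<le> (\<integral>x. c \<partial>N)" unfolding total_mean_def
    by (rule integral_mono[OF section_mean_integrable]) (use assms in auto)
  then show "total_mean \<le> c" by (simp add: prob_space)
qed

text \<open>
  The kernel, its two section means and its total mean are four nonnegative terms, each bounded by
  \<open>B\<close> in supremum and by \<open>c\<close> after integrating one variable.
\<close>

lemma degenerate_part_bounded: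
  assumes nonneg: "\<And>x y. x \<in> space N \<Longrightarrow> y \<in> space N \<Longrightarrow> 0 \<le> h x y"
    and le: "\<And>x y. x \<in> space N \<Longrightarrow> y \<in> space N \<Longrightarrow> h x y \<le> B"
    and mean: "\<And>x. x \<in> space N \<Longrightarrow> section_mean x \<le> c"
  shows "bounded_degenerate_kernel N degenerate_part (4 * B) (4 * c)"
proof -
  interpret D: degenerate_kernel N degenerate_part by (rule degenerate_part_kernel)
  have s0: "0 \<le> section_mean x" if "x \<in> space N" for x
    unfolding section_mean_def by (rule Bochner_Integration.integral_nonneg_AE) (use nonneg that in \<open>auto intro!: AE_I2\<close>)
  have sB: "section_mean x \<le> B" if x: "x \<in> space N" for x
  proof -
    have "section_mean x \<le> (\<integral>y. B \<partial>N)" unfolding section_mean_def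
      by (rule integral_mono[OF h_section_integrable[OF x]]) (use le x in auto)
    then show ?thesis by (simp add: prob_space)
  qed
  note tc = total_mean_bounds[OF s0 mean] and tB = total_mean_bounds[OF s0 sB]
  show ?thesis
  proof
    fix x assume x: "x \<in> space N"
    show "\<bar>degenerate_part x y\<bar> \<le> 4 * B" if y: "y \<in> space N" for y
      using nonneg[OF x y] le[OF x y] s0[OF x] s0[OF y] sB[OF x] sB[OF y] tB
      unfolding degenerate_part_def mean_part_def by linarith
    have "(\<integral>y. \<bar>degenerate_part x y\<bar> \<partial>N) \<le> (\<integral>y. h x y + section_mean x + section_mean y + total_mean \<partial>N)"
    proof (rule integral_mono)
      show "integrable N (\<lambda>y. \<bar>degenerate_part x y\<bar>)" using D.kernel_section_integrable[OF x] by simp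
      show "integrable N (\<lambda>y. h x y + section_mean x + section_mean y + total_mean)"
        using h_section_integrable[OF x] section_mean_integrable by simp
      show "\<bar>degenerate_part x y\<bar> \<le> h x y + section_mean x + section_mean y + total_mean" if y: "y \<in> space N" for y
        using nonneg[OF x y] s0[OF x] s0[OF y] tc unfolding degenerate_part_def mean_part_def by linarith
    qed
    also have "\<dots> = 2 * section_mean x + 2 * total_mean"
      using h_section_integrable[OF x] section_mean_integrable
      by (simp add: prob_space section_mean_def[symmetric] total_mean_def[symmetric])
    also have "\<dots> \<le> 4 * c" using mean[OF x] tc by simp
    finally show "(\<integral>y. \<bar>degenerate_part x y\<bar> \<partial>N) \<le> 4 * c" .
  qed
qed

lemma mean_part_second_moment_le:
  assumes s0: "\<And>x. x \<in> space N \<Longrightarrow> 0 \<le> section_mean x" and mean: "\<And>x. x \<in> space N \<Longrightarrow> section_mean x \<le> c"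
  shows "integral\<^sup>L (N \<Otimes>\<^sub>M N) (\<lambda>(x, y). (mean_part x y)\<^sup>2) \<le> 4 * c\<^sup>2"
proof -
  note t = total_mean_bounds[OF s0 mean]
  have "integral\<^sup>L (N \<Otimes>\<^sub>M N) (\<lambda>(x, y). (mean_part x y)\<^sup>2) \<le> (\<integral>p. 4 * c\<^sup>2 \<partial>(N \<Otimes>\<^sub>M N))"
  proof (rule integral_mono[OF mean_part_square_integrable])
    fix p assume "p \<in> space (N \<Otimes>\<^sub>M N)"
    then have p: "fst p \<in> space N" "snd p \<in> space N" by (auto simp: space_pair_measure)
    have "\<bar>mean_part (fst p) (snd p)\<bar> \<le> 2 * c"
      using s0[OF p(1)] s0[OF p(2)] mean[OF p(1)] mean[OF p(2)] t unfolding mean_part_def by linarith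
    then have "\<bar>mean_part (fst p) (snd p)\<bar>\<^sup>2 \<le> (2 * c)\<^sup>2" by (rule power_mono) simp
    then show "(case p of (x, y) \<Rightarrow> (mean_part x y)\<^sup>2) \<le> 4 * c\<^sup>2"
      by (simp add: case_prod_beta' power_mult_distrib)
  qed simp
  then show ?thesis by (simp add: square.prob_space)
qed

text \<open>
  The variance is at most the second moment about \<open>c\<close>, and \<open>(c - g)\<^sup>2 \<le> c * (c - g)\<close> for \<open>0 \<le> g \<le> c\<close>.
  A section mean that is seldom far from its maximum thus has a small variance.
\<close>

lemma section_mean_variance_le:
  assumes s0: "\<And>x. x \<in> space N \<Longrightarrow> 0 \<le> section_mean x" and mean: "\<And>x. x \<in> space N \<Longrightarrow> section_mean x \<le> c"
  shows "(\<integral>x. (section_mean x - total_mean)\<^sup>2 \<partial>N) \<le> c * (c - total_mean)"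
proof -
  note int = section_mean_integrable section_mean_square_integrable
  have "(\<integral>x. (section_mean x)\<^sup>2 \<partial>N) \<le> (\<integral>x. c * section_mean x \<partial>N)"
    by (rule integral_mono[OF int(2)]) (use int s0 mean in \<open>auto simp: power2_eq_square intro!: mult_right_mono\<close>)
  then have le: "(\<integral>x. (section_mean x)\<^sup>2 \<partial>N) \<le> c * total_mean" by (simp add: total_mean_def)
  have "(\<integral>x. (section_mean x - total_mean)\<^sup>2 \<partial>N) = (\<integral>x. (section_mean x)\<^sup>2 \<partial>N) - total_mean\<^sup>2"
    unfolding power2_diff using int
    by (simp add: prob_space total_mean_def[symmetric] power2_eq_square)
  also have "\<dots> \<le> c * total_mean - total_mean\<^sup>2" using le by simp
  also have "\<dots> \<le> c * (c - total_mean)"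
    using zero_le_power2[of "c - total_mean"] by (simp add: power2_eq_square algebra_simps)
  finally show ?thesis .
qed

end

section \<open>Edge moments under nearly uniform laws\<close>

lemma ball_moment_nonneg: "- real DIM('a::euclidean_space) < \<gamma> \<Longrightarrow> 0 \<le> ball_moment TYPE('a) \<gamma> \<rho>"
  by (auto simp: ball_moment_def intro!: mult_nonneg_nonneg divide_nonneg_pos)

lemma ball_moment_pos: "- real DIM('a::euclidean_space) < \<gamma> \<Longrightarrow> 0 < \<rho> \<Longrightarrow> 0 < ball_moment TYPE('a) \<gamma> \<rho>"
  by (auto simp: ball_moment_def intro!: mult_pos_pos divide_pos_pos)

lemma ball_moment_scale:
  "0 \<le> \<delta> \<Longrightarrow> 0 \<le> \<rho> \<Longrightarrow> ball_moment TYPE('a::euclidean_space) \<gamma> (\<delta> * \<rho>)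
    = \<delta> powr (\<gamma> + real DIM('a)) * ball_moment TYPE('a) \<gamma> \<rho>"
  by (simp add: ball_moment_def powr_mult)

text \<open>
  The edge kernel without its short edges; unlike the edge kernel it is bounded for negative
  exponents as well.
\<close>

definition annulus_kernel :: "real \<Rightarrow> real \<Rightarrow> real \<Rightarrow> 'a::euclidean_space \<Rightarrow> 'a \<Rightarrow> real" where
  "annulus_kernel \<gamma> \<rho>' \<rho> x y = edge_kernel \<gamma> \<rho> x y - edge_kernel \<gamma> \<rho>' x y"

lemma annulus_kernel_alt:
  "\<rho>' \<le> \<rho> \<Longrightarrow> annulus_kernel \<gamma> \<rho>' \<rho> x y = of_bool (\<rho>' < norm (x - y) \<and> norm (x - y) \<le> \<rho>) * norm (x - y) powr \<gamma>"
  by (auto simp: annulus_kernel_def edge_kernel_def)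

lemma annulus_kernel_nonneg: "\<rho>' \<le> \<rho> \<Longrightarrow> 0 \<le> annulus_kernel \<gamma> \<rho>' \<rho> x y"
  by (simp add: annulus_kernel_alt)

lemma annulus_kernel_square:
  "\<rho>' \<le> \<rho> \<Longrightarrow> (annulus_kernel \<gamma> \<rho>' \<rho> x y)\<^sup>2 = annulus_kernel (2 * \<gamma>) \<rho>' \<rho> x y"
  by (simp add: annulus_kernel_alt power_mult_distrib power2_eq_square powr_add[symmetric])

lemma annulus_kernel_le:
  assumes "0 < \<delta>" "\<delta> \<le> 1" "0 < \<rho>"
  shows "annulus_kernel \<gamma> (\<delta> * \<rho>) \<rho> x y \<le> \<rho> powr \<gamma> * max 1 (\<delta> powr \<gamma>)"
proof -
  have le: "\<delta> * \<rho> \<le> \<rho>" using assms by simp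
  have pos: "0 < \<delta> * \<rho>" using assms by simp
  have "s powr \<gamma> \<le> \<rho> powr \<gamma> * max 1 (\<delta> powr \<gamma>)" if s: "\<delta> * \<rho> < s" "s \<le> \<rho>" for s
  proof (cases "0 \<le> \<gamma>")
    case True
    have "s powr \<gamma> \<le> \<rho> powr \<gamma>" using True s pos by (intro powr_mono2) auto
    also have "\<dots> \<le> \<rho> powr \<gamma> * max 1 (\<delta> powr \<gamma>)" by (simp add: mult_le_cancel_left1)
    finally show ?thesis .
  next
    case False
    have "s powr \<gamma> \<le> (\<delta> * \<rho>) powr \<gamma>" using False s pos by (intro powr_mono2') auto
    also have "\<dots> = \<rho> powr \<gamma> * \<delta> powr \<gamma>" using assms by (simp add: powr_mult mult.commute)
    also have "\<dots> \<le> \<rho> powr \<gamma> * max 1 (\<delta> powr \<gamma>)" by (intro mult_left_mono) auto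
    finally show ?thesis .
  qed
  then show ?thesis unfolding annulus_kernel_alt[OF le] by auto
qed

text \<open>
  What the limit theorem has to know about the law of the points: it is dominated by Lebesgue
  measure, and on average a point sees a full ball of radius \<open>\<rho>\<close> up to a relative error \<open>C * \<rho>\<close>.
  The assumption \<open>deficit\<close> is where the regularity of the boundary enters.
\<close>

locale near_uniform = prob_space N for N :: "'a::euclidean_space measure" +
  fixes C r0 :: real
  assumes sets_N [measurable_cong]: "sets N = sets borel"
    and nn_integral_le: "\<And>g. g \<in> borel_measurable borel \<Longrightarrow> (\<integral>\<^sup>+x. g x \<partial>N) \<le> (\<integral>\<^sup>+x. g x \<partial>lborel)"
    and C_nonneg: "0 \<le> C" and r0_pos: "0 < r0"
    and deficit: "\<And>\<gamma> \<rho>. - real DIM('a) < \<gamma> \<Longrightarrow> 0 < \<rho> \<Longrightarrow> \<rho> < r0 \<Longrightarrow>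
       ball_moment TYPE('a) \<gamma> \<rho> * (1 - C * \<rho>) \<le> (\<integral>x. (\<integral>y. edge_kernel \<gamma> \<rho> x y \<partial>N) \<partial>N)"
begin

sublocale square: pair_prob_space N N ..

lemma space_N: "space N = UNIV" using sets_eq_imp_space_eq[OF sets_N] by simp

lemma
  assumes \<gamma>: "- real DIM('a) < \<gamma>" and \<rho>: "0 < \<rho>"
  shows edge_section_integrable: "integrable N (edge_kernel \<gamma> \<rho> x)"
    and edge_section_le: "(\<integral>y. edge_kernel \<gamma> \<rho> x y \<partial>N) \<le> ball_moment TYPE('a) \<gamma> \<rho>"
proof -
  have [measurable]: "edge_kernel \<gamma> \<rho> x \<in> borel_measurable N" by measurable
  have nn: "(\<integral>\<^sup>+y. ennreal (edge_kernel \<gamma> \<rho> x y) \<partial>N) \<le> ennreal (ball_moment TYPE('a) \<gamma> \<rho>)"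
    using nn_integral_le[of "\<lambda>y. ennreal (edge_kernel \<gamma> \<rho> x y)"] nn_integral_edge_kernel[OF \<rho> \<gamma>, of x]
    by (simp add: edge_kernel_section_measurable)
  show int: "integrable N (edge_kernel \<gamma> \<rho> x)"
  proof (rule integrableI_bounded)
    show "(\<integral>\<^sup>+y. ennreal (norm (edge_kernel \<gamma> \<rho> x y)) \<partial>N) < \<infinity>"
      using nn by (simp add: edge_kernel_nonneg) (meson ennreal_less_top le_less_trans)
  qed simp
  have "ennreal (\<integral>y. edge_kernel \<gamma> \<rho> x y \<partial>N) \<le> ennreal (ball_moment TYPE('a) \<gamma> \<rho>)"
    using nn by (simp add: nn_integral_eq_integral[OF int] edge_kernel_nonneg)
  then show "(\<integral>y. edge_kernel \<gamma> \<rho> x y \<partial>N) \<le> ball_moment TYPE('a) \<gamma> \<rho>"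
    using ball_moment_nonneg[OF \<gamma>] by simp
qed

definition energy :: "real \<Rightarrow> real \<Rightarrow> real" where
  "energy \<gamma> \<rho> = (\<integral>x. (\<integral>y. edge_kernel \<gamma> \<rho> x y \<partial>N) \<partial>N)"

lemma
  assumes \<gamma>: "- real DIM('a) < \<gamma>" and \<rho>: "0 < \<rho>"
  shows edge_integrable: "integrable (N \<Otimes>\<^sub>M N) (\<lambda>(x, y). edge_kernel \<gamma> \<rho> x y)"
    and energy_eq: "integral\<^sup>L (N \<Otimes>\<^sub>M N) (\<lambda>(x, y). edge_kernel \<gamma> \<rho> x y) = energy \<gamma> \<rho>"
    and energy_le: "energy \<gamma> \<rho> \<le> ball_moment TYPE('a) \<gamma> \<rho>"
proof -
  have bound: "\<bar>\<integral>y. edge_kernel \<gamma> \<rho> x y \<partial>N\<bar> \<le> ball_moment TYPE('a) \<gamma> \<rho>" for x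
    using edge_section_le[OF \<gamma> \<rho>, of x] by (simp add: edge_kernel_nonneg abs_of_nonneg)
  have int: "integrable N (\<lambda>x. \<integral>y. edge_kernel \<gamma> \<rho> x y \<partial>N)"
    by (rule integrable_const_bound[where B="ball_moment TYPE('a) \<gamma> \<rho>"]) (use bound in auto)
  show 1: "integrable (N \<Otimes>\<^sub>M N) (\<lambda>(x, y). edge_kernel \<gamma> \<rho> x y)"
  proof (rule square.Fubini_integrable)
    show "integrable N (\<lambda>x. \<integral>y. norm (case (x, y) of (x, y) \<Rightarrow> edge_kernel \<gamma> \<rho> x y) \<partial>N)"
      using int by (simp add: edge_kernel_nonneg)
  qed (use edge_section_integrable[OF \<gamma> \<rho>] in auto)
  show "integral\<^sup>L (N \<Otimes>\<^sub>M N) (\<lambda>(x, y). edge_kernel \<gamma> \<rho> x y) = energy \<gamma> \<rho>"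
    using square.integral_fst[OF 1] by (simp add: energy_def)
  have "energy \<gamma> \<rho> \<le> (\<integral>x. ball_moment TYPE('a) \<gamma> \<rho> \<partial>N)" unfolding energy_def
    by (rule integral_mono[OF int]) (use edge_section_le[OF \<gamma> \<rho>] in auto)
  then show "energy \<gamma> \<rho> \<le> ball_moment TYPE('a) \<gamma> \<rho>" by (simp add: prob_space)
qed

lemma edge_symmetric_kernel:
  assumes \<beta>: "- (real DIM('a) / 2) < \<beta>" and \<rho>: "0 < \<rho>"
  shows "symmetric_kernel N (edge_kernel \<beta> \<rho>)"
proof
  have \<gamma>: "- real DIM('a) < 2 * \<beta>" using \<beta> by simp
  show "case_prod (edge_kernel \<beta> \<rho>) \<in> borel_measurable (N \<Otimes>\<^sub>M N)" by measurable
  show "integrable N (\<lambda>y. (edge_kernel \<beta> \<rho> x y)\<^sup>2)" for x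
    unfolding edge_kernel_square by (rule edge_section_integrable[OF \<gamma> \<rho>])
  show "integrable (N \<Otimes>\<^sub>M N) (\<lambda>(x, y). (edge_kernel \<beta> \<rho> x y)\<^sup>2)"
    unfolding edge_kernel_square by (rule edge_integrable[OF \<gamma> \<rho>])
qed (rule edge_kernel_commute)

lemma annulus_symmetric_kernel:
  assumes \<beta>: "- (real DIM('a) / 2) < \<beta>" and \<rho>: "0 < \<rho>'" "\<rho>' \<le> \<rho>"
  shows "symmetric_kernel N (annulus_kernel \<beta> \<rho>' \<rho>)"
    and "integral\<^sup>L (N \<Otimes>\<^sub>M N) (\<lambda>(x, y). (annulus_kernel \<beta> \<rho>' \<rho> x y)\<^sup>2) = energy (2 * \<beta>) \<rho> - energy (2 * \<beta>) \<rho>'"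
proof -
  have \<gamma>: "- real DIM('a) < 2 * \<beta>" and \<rho>'': "0 < \<rho>" using \<beta> \<rho> by simp_all
  note i = edge_integrable[OF \<gamma> \<rho>''] edge_integrable[OF \<gamma> \<rho>(1)]
  show "symmetric_kernel N (annulus_kernel \<beta> \<rho>' \<rho>)"
  proof
    show "case_prod (annulus_kernel \<beta> \<rho>' \<rho>) \<in> borel_measurable (N \<Otimes>\<^sub>M N)"
      unfolding annulus_kernel_def by measurable
    show "integrable N (\<lambda>y. (annulus_kernel \<beta> \<rho>' \<rho> x y)\<^sup>2)" for x
      unfolding annulus_kernel_square[OF \<rho>(2)] unfolding annulus_kernel_def
      by (intro Bochner_Integration.integrable_diff edge_section_integrable[OF \<gamma>] \<rho>(1) \<rho>'')
    show "integrable (N \<Otimes>\<^sub>M N) (\<lambda>(x, y). (annulus_kernel \<beta> \<rho>' \<rho> x y)\<^sup>2)"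
      unfolding annulus_kernel_square[OF \<rho>(2)] unfolding annulus_kernel_def
      using i by (simp add: case_prod_beta')
  qed (simp add: annulus_kernel_def edge_kernel_commute)
  show "integral\<^sup>L (N \<Otimes>\<^sub>M N) (\<lambda>(x, y). (annulus_kernel \<beta> \<rho>' \<rho> x y)\<^sup>2) = energy (2 * \<beta>) \<rho> - energy (2 * \<beta>) \<rho>'"
    unfolding annulus_kernel_square[OF \<rho>(2)] unfolding annulus_kernel_def
      energy_eq[OF \<gamma> \<rho>'', symmetric] energy_eq[OF \<gamma> \<rho>(1), symmetric]
    using i by (simp add: case_prod_beta')
qed

text \<open>
  Both energies agree with the corresponding ball integrals up to the deficit, and the ball integral
  is homogeneous in the radius.
\<close>

lemma annulus_energy_bounds:
  assumes \<beta>: "- (real DIM('a) / 2) < \<beta>" and \<rho>: "0 < \<rho>" "\<rho> < r0" and \<delta>: "0 < \<delta>" "\<delta> < 1"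
  shows "\<bar>energy (2 * \<beta>) \<rho> - energy (2 * \<beta>) (\<delta> * \<rho>) - (1 - \<delta> powr (2 * \<beta> + real DIM('a))) * ball_moment TYPE('a) (2 * \<beta>) \<rho>\<bar>
    \<le> C * \<rho> * ball_moment TYPE('a) (2 * \<beta>) \<rho>"
proof -
  let ?s = "ball_moment TYPE('a) (2 * \<beta>) \<rho>" and ?\<eta> = "\<delta> powr (2 * \<beta> + real DIM('a))"
  have \<gamma>: "- real DIM('a) < 2 * \<beta>" using \<beta> by simp
  have s: "0 \<le> ?s" by (rule ball_moment_nonneg[OF \<gamma>])
  have \<delta>\<rho>: "0 < \<delta> * \<rho>" "\<delta> * \<rho> \<le> \<rho>" using \<rho> \<delta> by auto
  have scale: "ball_moment TYPE('a) (2 * \<beta>) (\<delta> * \<rho>) = ?\<eta> * ?s" using \<rho> \<delta> by (simp add: ball_moment_scale)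
  have \<eta>: "0 \<le> ?\<eta>" "?\<eta> \<le> 1" using \<delta> \<gamma> by (auto intro!: powr_le1)
  have 1: "?s * (1 - C * \<rho>) \<le> energy (2 * \<beta>) \<rho>" "energy (2 * \<beta>) \<rho> \<le> ?s"
    using deficit[OF \<gamma> \<rho>] energy_le[OF \<gamma> \<rho>(1)] by (simp_all add: energy_def)
  have 2: "?\<eta> * ?s * (1 - C * (\<delta> * \<rho>)) \<le> energy (2 * \<beta>) (\<delta> * \<rho>)" "energy (2 * \<beta>) (\<delta> * \<rho>) \<le> ?\<eta> * ?s"
    using deficit[OF \<gamma> \<delta>\<rho>(1)] energy_le[OF \<gamma> \<delta>\<rho>(1)] \<delta>\<rho> \<rho> by (simp_all add: energy_def scale)
  have "(?\<eta> * ?s) * (C * (\<delta> * \<rho>)) \<le> (1 * ?s) * (C * \<rho>)"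
    using \<eta> s C_nonneg \<delta>\<rho> by (intro mult_mono) auto
  then show ?thesis using 1 2 by (simp add: abs_le_iff algebra_simps)
qed

end

section \<open>Asymptotic normality of edge sums\<close>

locale near_uniform_sample = iid_sample M N X + N: near_uniform N C r0
  for M :: "'w measure" and N :: "'a::euclidean_space measure" and X :: "nat \<Rightarrow> 'w \<Rightarrow> 'a" and C r0 :: real
begin

text \<open>
  The normalized edge sum differs from the U-statistic of the degenerate annulus part by the
  degenerate part of the short edges, with standard deviation at most \<open>sqrt \<eta>\<close>, and by the linear
  part, whose variance is controlled by the deficit. The number \<open>v\<close> is the variance of the annulus
  part, so it is close to \<open>1 - \<eta>\<close>.
\<close>

lemma char_edge_sum_estimate:
  fixes \<beta> \<rho> \<delta> t :: real and n :: nat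
  assumes \<beta>: "- (real DIM('a) / 2) < \<beta>" and \<rho>: "0 < \<rho>" "\<rho> < r0" and \<delta>: "0 < \<delta>" "\<delta> < 1" and n: "0 < n"
  defines "A \<equiv> ball_moment TYPE('a) \<beta> \<rho>" and "s \<equiv> ball_moment TYPE('a) (2 * \<beta>) \<rho>"
    and "\<eta> \<equiv> \<delta> powr (2 * \<beta> + real DIM('a))"
  defines "\<tau> \<equiv> sqrt (s / 2) * real n"
  obtains v where
    "cmod (expectation (\<lambda>\<omega>. iexp (t * ((U_sum (edge_kernel \<beta> \<rho>) n (\<lambda>i. X i \<omega>)
        - real n * (real n - 1) / 2 * N.energy \<beta> \<rho>) / \<tau>))) - exp (- (t\<^sup>2 * v / 2)))
      \<le> real n * clt_step_error (4 * (\<rho> powr \<beta> * max 1 (\<delta> powr \<beta>)) / \<tau>) (4 * A / \<tau>) t n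
        + \<bar>t\<bar> * (sqrt \<eta> + sqrt (2 * real n * A\<^sup>2 * (C * \<rho>) / s))"
    and "\<bar>v - (1 - 1 / real n) * (1 - \<eta>)\<bar> \<le> C * \<rho> + 4 * A\<^sup>2 / s"
proof -
  let ?k = "annulus_kernel \<beta> (\<delta> * \<rho>) \<rho> :: 'a \<Rightarrow> 'a \<Rightarrow> real"
  have \<gamma>: "- real DIM('a) < 2 * \<beta>" "- real DIM('a) < \<beta>" using \<beta> by (simp_all add: field_simps)
  have \<delta>\<rho>: "0 < \<delta> * \<rho>" "\<delta> * \<rho> \<le> \<rho>" using \<rho> \<delta> by auto
  have s: "0 < s" unfolding s_def by (rule ball_moment_pos[OF \<gamma>(1) \<rho>(1)])
  have A: "0 < A" unfolding A_def by (rule ball_moment_pos[OF \<gamma>(2) \<rho>(1)])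
  have \<tau>: "0 < \<tau>" using s n by (simp add: \<tau>_def)
  have \<tau>2: "\<tau>\<^sup>2 = s / 2 * (real n)\<^sup>2" using s by (simp add: \<tau>_def power_mult_distrib)
  have sp: "space N = UNIV" by (rule N.space_N)
  interpret E: symmetric_kernel N "edge_kernel \<beta> \<rho>" by (rule N.edge_symmetric_kernel[OF \<beta> \<rho>(1)])
  interpret F: symmetric_kernel N "edge_kernel \<beta> (\<delta> * \<rho>)" by (rule N.edge_symmetric_kernel[OF \<beta> \<delta>\<rho>(1)])
  interpret K: symmetric_kernel N ?k by (rule N.annulus_symmetric_kernel(1)[OF \<beta> \<delta>\<rho>])
  interpret FD: degenerate_kernel N F.degenerate_part by (rule F.degenerate_part_kernel)

  have mean_add: "E.section_mean x = K.section_mean x + F.section_mean x" for x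
    unfolding E.section_mean_def K.section_mean_def F.section_mean_def
    using K.h_section_integrable[of x] F.h_section_integrable[of x] sp
    by (simp add: Bochner_Integration.integral_add[symmetric] annulus_kernel_def del: Bochner_Integration.integral_add)
  have "E.total_mean = K.total_mean + F.total_mean"
    unfolding E.total_mean_def K.total_mean_def F.total_mean_def mean_add
    using K.section_mean_integrable F.section_mean_integrable by simp
  then have part_add: "E.degenerate_part x y = K.degenerate_part x y + F.degenerate_part x y" for x y
    by (simp add: E.degenerate_part_def K.degenerate_part_def F.degenerate_part_def
        E.mean_part_def K.mean_part_def F.mean_part_def mean_add annulus_kernel_def)
  have total: "E.total_mean = N.energy \<beta> \<rho>"
    by (simp add: E.total_mean_def E.section_mean_def N.energy_def)
  have s0: "0 \<le> E.section_mean x" "0 \<le> F.section_mean x" "0 \<le> K.section_mean x" for x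
    using annulus_kernel_nonneg[OF \<delta>\<rho>(2)]
    by (auto simp: E.section_mean_def F.section_mean_def K.section_mean_def edge_kernel_nonneg
        intro!: Bochner_Integration.integral_nonneg)
  have sA: "E.section_mean x \<le> A" for x
    unfolding E.section_mean_def A_def by (rule N.edge_section_le[OF \<gamma>(2) \<rho>(1)])
  have kA: "K.section_mean x \<le> A" for x using sA[of x] s0(2)[of x] by (simp add: mean_add)

  let ?B = "\<rho> powr \<beta> * max 1 (\<delta> powr \<beta>)"
  have "bounded_degenerate_kernel N K.degenerate_part (4 * ?B) (4 * A)"
    by (rule K.degenerate_part_bounded)
       (use annulus_kernel_nonneg[OF \<delta>\<rho>(2)] annulus_kernel_le[of \<delta> \<rho>] \<delta> \<rho> kA in auto)
  from bounded_degenerate_kernel_scale[OF this, of "1 / \<tau>"] \<tau>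
  have bdk: "bounded_degenerate_kernel N (\<lambda>x y. 1 / \<tau> * K.degenerate_part x y) (4 * ?B / \<tau>) (4 * A / \<tau>)"
    by simp
  let ?H = "\<lambda>x y. 1 / \<tau> * K.degenerate_part x y"
  interpret H: bounded_degenerate_kernel N ?H "4 * ?B / \<tau>" "4 * A / \<tau>" by (rule bdk)
  interpret HU: degenerate_U_statistic M N X ?H "4 * ?B / \<tau>" "4 * A / \<tau>" ..

  define v where "v = real n * (real n - 1) / 2 * H.second_moment"
  let ?Z = "integral\<^sup>L (N \<Otimes>\<^sub>M N) (\<lambda>(x, y). (K.degenerate_part x y)\<^sup>2)"
  have "H.second_moment = ?Z / \<tau>\<^sup>2"
    unfolding H.second_moment_def by (simp add: power_mult_distrib power_divide case_prod_beta')
  then have "H.second_moment = ?Z / (s / 2 * (real n)\<^sup>2)" by (simp only: \<tau>2)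
  then have "v = real n * (real n - 1) / 2 * (?Z / (s / 2 * (real n)\<^sup>2))" by (simp only: v_def)
  also have "\<dots> = (1 - 1 / real n) * (?Z / s)"
    using n s by (simp add: divide_simps power2_eq_square)
  finally have v_eq: "v = (1 - 1 / real n) * (?Z / s)" .
  have Z: "\<bar>?Z - (1 - \<eta>) * s\<bar> \<le> C * \<rho> * s + 4 * A\<^sup>2"
  proof -
    have "0 \<le> integral\<^sup>L (N \<Otimes>\<^sub>M N) (\<lambda>(x, y). (K.mean_part x y)\<^sup>2)"
      by (auto intro!: Bochner_Integration.integral_nonneg)
    moreover note K.second_moment_decomposition[unfolded N.annulus_symmetric_kernel(2)[OF \<beta> \<delta>\<rho>]]
      K.mean_part_second_moment_le[of A, OF s0(3) kA]
      N.annulus_energy_bounds[OF \<beta> \<rho> \<delta>, folded s_def \<eta>_def]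
    ultimately show ?thesis by linarith
  qed
  have "?Z / s - (1 - \<eta>) = (?Z - (1 - \<eta>) * s) / s" using s by (simp add: diff_divide_distrib)
  then have "\<bar>?Z / s - (1 - \<eta>)\<bar> = \<bar>?Z - (1 - \<eta>) * s\<bar> / s" using s by (simp only: abs_divide abs_of_pos)
  also have "\<dots> \<le> (C * \<rho> * s + 4 * A\<^sup>2) / s" using Z s by (simp add: divide_right_mono)
  also have "\<dots> = C * \<rho> + 4 * A\<^sup>2 / s" using s by (simp add: add_divide_distrib)
  finally have Zs: "\<bar>?Z / s - (1 - \<eta>)\<bar> \<le> C * \<rho> + 4 * A\<^sup>2 / s" .
  have v_bound: "\<bar>v - (1 - 1 / real n) * (1 - \<eta>)\<bar> \<le> C * \<rho> + 4 * A\<^sup>2 / s"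
  proof -
    have "\<bar>v - (1 - 1 / real n) * (1 - \<eta>)\<bar> = \<bar>1 - 1 / real n\<bar> * \<bar>?Z / s - (1 - \<eta>)\<bar>"
      by (simp add: v_eq abs_mult[symmetric] right_diff_distrib)
    also have "\<dots> \<le> 1 * \<bar>?Z / s - (1 - \<eta>)\<bar>" using n by (intro mult_right_mono) auto
    finally show ?thesis using Zs by simp
  qed

  let ?T = "\<lambda>\<omega>. (U_sum (edge_kernel \<beta> \<rho>) n (\<lambda>i. X i \<omega>) - real n * (real n - 1) / 2 * N.energy \<beta> \<rho>) / \<tau>"
  let ?U = "\<lambda>\<omega>. U_sum ?H n (\<lambda>i. X i \<omega>)"
  let ?R = "\<lambda>\<omega>. U_sum F.degenerate_part n (\<lambda>i. X i \<omega>)"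
  let ?S = "\<lambda>\<omega>. \<Sum>i<n. (E.section_mean (X i \<omega>) - E.total_mean)"
  \<comment> \<open>The Hoeffding decomposition of the edge kernel, with its degenerate part split at length
    \<open>\<delta> * \<rho>\<close>.\<close>
  have split: "?T \<omega> - ?U \<omega> = ?R \<omega> / \<tau> + (real n - 1) / \<tau> * ?S \<omega>" for \<omega>
  proof -
    have "?T \<omega> = (U_sum E.degenerate_part n (\<lambda>i. X i \<omega>) + (real n - 1) * ?S \<omega>) / \<tau>"
      unfolding total[symmetric] E.U_sum_hoeffding ..
    also have "U_sum E.degenerate_part n (\<lambda>i. X i \<omega>) = U_sum K.degenerate_part n (\<lambda>i. X i \<omega>) + ?R \<omega>"
      by (simp add: U_sum_def part_add sum.distrib)
    also have "U_sum K.degenerate_part n (\<lambda>i. X i \<omega>) = \<tau> * ?U \<omega>"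
      using \<tau> by (simp add: U_sum_def sum_divide_distrib[symmetric] sum_distrib_left[symmetric])
    finally show ?thesis using \<tau> by (simp add: field_simps)
  qed
  have R2: "integrable M (\<lambda>\<omega>. (?R \<omega>)\<^sup>2)"
    by (rule integrable_U_sum_square[OF F.degenerate_part_kernel])
  have var_int: "integrable N (\<lambda>x. (E.section_mean x - E.total_mean)\<^sup>2)"
    unfolding power2_diff using E.section_mean_integrable E.section_mean_square_integrable by auto
  have var_mean: "(\<integral>x. E.section_mean x - E.total_mean \<partial>N) = 0"
    using E.section_mean_integrable by (simp add: N.prob_space E.total_mean_def)
  have S2: "integrable M (\<lambda>\<omega>. (?S \<omega>)\<^sup>2)"
    by (rule integrable_iid_sum_square[OF _ var_int var_mean]) measurable
  have [measurable]: "?R \<in> borel_measurable M" "?S \<in> borel_measurable M"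
    using U_sum_measurable[OF F.degenerate_part_measurable] by simp_all
  have U_meas [measurable]: "?U \<in> borel_measurable M" by (rule U_sum_measurable[OF H.kernel_measurable])
  have T_meas [measurable]: "?T \<in> borel_measurable M"
    using U_sum_measurable[OF E.h_measurable] by measurable
  have ER: "expectation (\<lambda>\<omega>. \<bar>?R \<omega>\<bar>) \<le> \<tau> * sqrt \<eta>"
  proof -
    have "integral\<^sup>L (N \<Otimes>\<^sub>M N) (\<lambda>(x, y). (F.degenerate_part x y)\<^sup>2)
        \<le> integral\<^sup>L (N \<Otimes>\<^sub>M N) (\<lambda>(x, y). (edge_kernel \<beta> (\<delta> * \<rho>) x y)\<^sup>2)"
      unfolding F.second_moment_decomposition by (auto intro!: Bochner_Integration.integral_nonneg)
    also have "\<dots> = N.energy (2 * \<beta>) (\<delta> * \<rho>)"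
      unfolding edge_kernel_square by (rule N.energy_eq[OF \<gamma>(1) \<delta>\<rho>(1)])
    also have "\<dots> \<le> \<eta> * s"
      using N.energy_le[OF \<gamma>(1) \<delta>\<rho>(1)] \<delta> \<rho> by (simp add: ball_moment_scale \<eta>_def s_def)
    finally have F2: "integral\<^sup>L (N \<Otimes>\<^sub>M N) (\<lambda>(x, y). (F.degenerate_part x y)\<^sup>2) \<le> \<eta> * s" .
    have "expectation (\<lambda>\<omega>. (?R \<omega>)\<^sup>2)
        = real n * (real n - 1) / 2 * integral\<^sup>L (N \<Otimes>\<^sub>M N) (\<lambda>(x, y). (F.degenerate_part x y)\<^sup>2)"
      by (rule expectation_U_sum_square[OF F.degenerate_part_kernel])
    also have "\<dots> \<le> real n * real n / 2 * (\<eta> * s)"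
      using F2 n by (intro mult_mono divide_right_mono) (auto intro!: Bochner_Integration.integral_nonneg)
    also have "\<dots> = \<tau>\<^sup>2 * \<eta>" unfolding \<tau>2 by (simp add: power2_eq_square)
    finally have "sqrt (expectation (\<lambda>\<omega>. (?R \<omega>)\<^sup>2)) \<le> sqrt (\<tau>\<^sup>2 * \<eta>)" by (rule real_sqrt_le_mono)
    with expectation_abs_le_sqrt[OF _ R2] show ?thesis using \<tau> by (simp add: real_sqrt_mult)
  qed
  have ES: "expectation (\<lambda>\<omega>. \<bar>?S \<omega>\<bar>) \<le> sqrt (real n * (A\<^sup>2 * (C * \<rho>)))"
  proof -
    have "(\<integral>x. (E.section_mean x - E.total_mean)\<^sup>2 \<partial>N) \<le> A * (A - E.total_mean)"
      by (rule E.section_mean_variance_le[OF s0(1) sA])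
    also have "A - E.total_mean \<le> A * (C * \<rho>)"
      using N.deficit[OF \<gamma>(2) \<rho>] by (simp add: total N.energy_def A_def[symmetric] algebra_simps)
    finally have "(\<integral>x. (E.section_mean x - E.total_mean)\<^sup>2 \<partial>N) \<le> A\<^sup>2 * (C * \<rho>)"
      using A by (simp add: power2_eq_square mult.assoc)
    then have "expectation (\<lambda>\<omega>. (?S \<omega>)\<^sup>2) \<le> real n * (A\<^sup>2 * (C * \<rho>))"
      using expectation_iid_sum_square[OF _ var_int var_mean, of n] by (simp add: mult_left_mono)
    from real_sqrt_le_mono[OF this] show ?thesis
      by (rule order_trans[OF expectation_abs_le_sqrt[OF _ S2], rotated]) measurable
  qed
  have diff2: "integrable M (\<lambda>\<omega>. (?T \<omega> - ?U \<omega>)\<^sup>2)"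
    unfolding split by (rule square_sum_integrable) (use R2 S2 in \<open>auto simp: power_mult_distrib power_divide\<close>)
  have "expectation (\<lambda>\<omega>. \<bar>?T \<omega> - ?U \<omega>\<bar>) \<le> expectation (\<lambda>\<omega>. \<bar>?R \<omega>\<bar> / \<tau> + (real n - 1) / \<tau> * \<bar>?S \<omega>\<bar>)"
  proof (rule integral_mono)
    show "integrable M (\<lambda>\<omega>. \<bar>?T \<omega> - ?U \<omega>\<bar>)"
      by (rule integrable_abs[OF integrable_of_square[OF _ diff2]]) measurable
    show "integrable M (\<lambda>\<omega>. \<bar>?R \<omega>\<bar> / \<tau> + (real n - 1) / \<tau> * \<bar>?S \<omega>\<bar>)"
      using integrable_of_square[OF _ R2] integrable_of_square[OF _ S2] by simp
    show "\<bar>?T \<omega> - ?U \<omega>\<bar> \<le> \<bar>?R \<omega>\<bar> / \<tau> + (real n - 1) / \<tau> * \<bar>?S \<omega>\<bar>" for \<omega>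
      unfolding split by (rule order_trans[OF abs_triangle_ineq]) (use \<tau> n in \<open>simp add: abs_mult\<close>)
  qed
  also have "\<dots> = expectation (\<lambda>\<omega>. \<bar>?R \<omega>\<bar>) / \<tau> + (real n - 1) / \<tau> * expectation (\<lambda>\<omega>. \<bar>?S \<omega>\<bar>)"
    using integrable_of_square[OF _ R2] integrable_of_square[OF _ S2] by simp
  also have "\<dots> \<le> (\<tau> * sqrt \<eta>) / \<tau> + real n / \<tau> * sqrt (real n * (A\<^sup>2 * (C * \<rho>)))"
    using \<tau> n by (intro add_mono divide_right_mono mult_mono ER ES) auto
  also have "real n / \<tau> = sqrt (2 / s)" using n s by (simp add: \<tau>_def real_sqrt_divide)
  also have "sqrt (2 / s) * sqrt (real n * (A\<^sup>2 * (C * \<rho>))) = sqrt (2 * real n * A\<^sup>2 * (C * \<rho>) / s)"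
    unfolding real_sqrt_mult[symmetric] by (simp add: mult.assoc)
  finally have "expectation (\<lambda>\<omega>. \<bar>?T \<omega> - ?U \<omega>\<bar>) \<le> sqrt \<eta> + sqrt (2 * real n * A\<^sup>2 * (C * \<rho>) / s)"
    using \<tau> by simp
  then have TU: "cmod (expectation (\<lambda>\<omega>. iexp (t * ?T \<omega>)) - expectation (\<lambda>\<omega>. iexp (t * ?U \<omega>)))
      \<le> \<bar>t\<bar> * (sqrt \<eta> + sqrt (2 * real n * A\<^sup>2 * (C * \<rho>) / s))"
    by (intro order_trans[OF char_diff_le[OF T_meas U_meas diff2]] mult_left_mono) auto
  have "cmod (expectation (\<lambda>\<omega>. iexp (t * ?U \<omega>)) - exp (- (t\<^sup>2 * v / 2)))
      \<le> real n * clt_step_error (4 * ?B / \<tau>) (4 * A / \<tau>) t n"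
    using HU.char_U_sum_approx[of t n] by (simp only: v_def)
  note norm_triangle_mono[OF TU this]
  then have "cmod (expectation (\<lambda>\<omega>. iexp (t * ?T \<omega>)) - exp (- (t\<^sup>2 * v / 2)))
      \<le> real n * clt_step_error (4 * ?B / \<tau>) (4 * A / \<tau>) t n
        + \<bar>t\<bar> * (sqrt \<eta> + sqrt (2 * real n * A\<^sup>2 * (C * \<rho>) / s))"
    by (simp only: diff_add_cancel diff_add_eq_diff_diff_swap add_diff_cancel diff_add_eq add_diff_eq)
  then show thesis using v_bound that by blast
qed

text \<open>
  Asymptotically the standard deviation of the degenerate part of the edge sum: there are about
  \<open>n\<^sup>2 / 2\<close> pairs, and \<open>ball_moment\<close> is close to the second moment of the kernel.
\<close>

definition normalizer :: "real \<Rightarrow> real \<Rightarrow> nat \<Rightarrow> real" where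
  "normalizer \<beta> \<rho> n = sqrt (ball_moment TYPE('a) (2 * \<beta>) \<rho> / 2) * real n"

definition unit_moment :: "real \<Rightarrow> real" where
  "unit_moment \<gamma> = ball_moment TYPE('a) \<gamma> 1"

text \<open>
  The powers of the radius are separated here so that \<open>\<rho> powr \<beta>\<close> cancels in all the quotients that
  occur below.
\<close>

lemma moment_factors:
  assumes \<rho>: "0 < \<rho>"
  defines "q \<equiv> sqrt (\<rho> ^ DIM('a))"
  shows "ball_moment TYPE('a) \<beta> \<rho> = unit_moment \<beta> * (\<rho> powr \<beta> * q\<^sup>2)"
    and "ball_moment TYPE('a) (2 * \<beta>) \<rho> = unit_moment (2 * \<beta>) * (\<rho> powr \<beta> * q)\<^sup>2"
    and "normalizer \<beta> \<rho> n = sqrt (unit_moment (2 * \<beta>) / 2) * (\<rho> powr \<beta> * q) * real n"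
proof -
  have q: "q\<^sup>2 = \<rho> powr real DIM('a)" "0 \<le> q" using \<rho> by (simp_all add: q_def powr_realpow)
  show 1: "ball_moment TYPE('a) \<beta> \<rho> = unit_moment \<beta> * (\<rho> powr \<beta> * q\<^sup>2)"
    using \<rho> by (simp add: ball_moment_def unit_moment_def q(1) powr_add)
  show 2: "ball_moment TYPE('a) (2 * \<beta>) \<rho> = unit_moment (2 * \<beta>) * (\<rho> powr \<beta> * q)\<^sup>2"
    using \<rho> by (simp add: ball_moment_def unit_moment_def power_mult_distrib q(1) powr_add powr_power mult.commute)
  have "sqrt (ball_moment TYPE('a) (2 * \<beta>) \<rho> / 2) = sqrt (unit_moment (2 * \<beta>) / 2 * (\<rho> powr \<beta> * q)\<^sup>2)"
    unfolding 2 by simp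
  also have "\<dots> = sqrt (unit_moment (2 * \<beta>) / 2) * (\<rho> powr \<beta> * q)"
    unfolding real_sqrt_mult using q(2) by simp
  finally show "normalizer \<beta> \<rho> n = sqrt (unit_moment (2 * \<beta>) / 2) * (\<rho> powr \<beta> * q) * real n"
    by (simp add: normalizer_def)
qed

text \<open>
  First \<open>n\<close> tends to infinity for a fixed cut-off \<open>\<delta>\<close>. What remains is the error of the cut-off, which
  is a continuous function of \<open>\<eta> = \<delta> powr (2 * \<beta> + d)\<close> that vanishes at zero.
\<close>

theorem char_edge_sum_tendsto:
  fixes \<beta> t :: real and r :: "nat \<Rightarrow> real"
  assumes \<beta>: "- (real DIM('a) / 2) < \<beta>" and r: "\<And>n. 0 < r n" "r \<longlonglongrightarrow> 0"
    and many_edges: "filterlim (\<lambda>n. real n ^ 2 * r n ^ DIM('a)) at_top sequentially"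
    and thin_boundary: "(\<lambda>n. real n * r n ^ (DIM('a) + 1)) \<longlonglongrightarrow> 0"
  shows "(\<lambda>n. expectation (\<lambda>\<omega>. iexp (t * ((U_sum (edge_kernel \<beta> (r n)) n (\<lambda>i. X i \<omega>)
        - real n * (real n - 1) / 2 * N.energy \<beta> (r n)) / normalizer \<beta> (r n) n))))
      \<longlonglongrightarrow> exp (- (t\<^sup>2) / 2)"
    (is "?\<phi> \<longlonglongrightarrow> _")
proof -
  define q where "q n = sqrt (r n ^ DIM('a))" for n
  define A1 where "A1 = unit_moment \<beta>"
  define A2 where "A2 = unit_moment (2 * \<beta>)"
  define c where "c = sqrt (A2 / 2)"
  have \<gamma>: "- real DIM('a) < \<beta>" "- real DIM('a) < 2 * \<beta>" using \<beta> by (simp_all add: field_simps)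
  have A: "0 < A1" "0 < A2"
    unfolding A1_def A2_def unit_moment_def using ball_moment_pos[OF \<gamma>(1)] ball_moment_pos[OF \<gamma>(2)] by simp_all
  then have c: "0 < c" by (simp add: c_def)
  have q_pos: "0 < q n" for n using r(1) by (simp add: q_def)
  have q2: "(q n)\<^sup>2 = r n ^ DIM('a)" for n using r(1)[of n] by (simp add: q_def less_imp_le)
  have "q \<longlonglongrightarrow> sqrt (0 ^ DIM('a))" unfolding q_def by (intro tendsto_intros r(2))
  then have q0: "q \<longlonglongrightarrow> 0" by (simp add: zero_power)
  have "filterlim (\<lambda>n. sqrt (real n ^ 2 * r n ^ DIM('a))) at_top sequentially"
    by (rule filterlim_compose[OF sqrt_at_top many_edges])
  then have nq: "filterlim (\<lambda>n. real n * q n) at_top sequentially"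
    by (simp add: real_sqrt_mult q_def)
  have cmp: "ball_moment TYPE('a) \<beta> (r n) = A1 * (r n powr \<beta> * (q n)\<^sup>2)"
    "ball_moment TYPE('a) (2 * \<beta>) (r n) = A2 * (r n powr \<beta> * q n)\<^sup>2"
    "normalizer \<beta> (r n) n = c * (r n powr \<beta> * q n) * real n" for n
    using moment_factors[OF r(1)[of n]] by (simp_all add: A1_def A2_def c_def q_def)
  have pw: "0 < r n powr \<beta>" for n using r(1)[of n] by simp
  have eventually_small: "\<forall>\<^sub>F n in sequentially. 0 < n \<and> r n < r0"
    using order_tendstoD(2)[OF r(2) N.r0_pos] eventually_gt_at_top[of 0] by eventually_elim simp

  have bound: "\<forall>\<^sub>F n in sequentially. cmod (?\<phi> n - exp (- (t\<^sup>2) / 2)) < \<epsilon>" if \<epsilon>: "0 < \<epsilon>" for \<epsilon>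
  proof -
    let ?L = "\<lambda>\<eta>. \<bar>exp (- (t\<^sup>2 * (1 - \<eta>) / 2)) - exp (- (t\<^sup>2) / 2)\<bar> + \<bar>t\<bar> * sqrt \<eta>"
    have "(?L \<longlongrightarrow> \<bar>exp (- (t\<^sup>2 * (1 - 0) / 2)) - exp (- (t\<^sup>2) / 2)\<bar> + \<bar>t\<bar> * sqrt 0) (at_right 0)"
      by (intro tendsto_intros) simp_all
    then have "(?L \<longlongrightarrow> 0) (at_right 0)" by simp
    from order_tendstoD(2)[OF this \<epsilon>] obtain y where y: "0 < y" "\<And>\<eta>. 0 < \<eta> \<Longrightarrow> \<eta> < y \<Longrightarrow> ?L \<eta> < \<epsilon>"
      unfolding eventually_at_right_field by auto
    define \<eta> where "\<eta> = min (y / 2) (1 / 2)"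
    have \<eta>: "0 < \<eta>" "\<eta> < 1" "?L \<eta> < \<epsilon>" using y by (auto simp: \<eta>_def)
    \<comment> \<open>This choice makes the short edges carry exactly the fraction \<open>\<eta>\<close> of the variance.\<close>
    define \<delta> where "\<delta> = \<eta> powr (1 / (2 * \<beta> + real DIM('a)))"
    have p: "0 < 2 * \<beta> + real DIM('a)" using \<beta> by simp
    have \<delta>\<eta>: "\<delta> powr (2 * \<beta> + real DIM('a)) = \<eta>" using p \<eta> by (simp add: \<delta>_def powr_powr)
    have \<delta>: "0 < \<delta>" "\<delta> < 1"
      using \<eta> p powr_less_mono2[of "1 / (2 * \<beta> + real DIM('a))" \<eta> 1] by (simp_all add: \<delta>_def)
    define b0 where "b0 = 4 * max 1 (\<delta> powr \<beta>) / c"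
    define m0 where "m0 = 4 * A1 / c"
    let ?G = "\<lambda>n. real n * clt_step_error (b0 / (real n * q n)) (m0 * q n / real n) t n
      + \<bar>t\<bar> * (sqrt \<eta> + sqrt (2 * A1\<^sup>2 / A2 * C * (real n * r n ^ (DIM('a) + 1))))"
    let ?D = "\<lambda>n. C * r n + 4 * A1\<^sup>2 / A2 * (q n)\<^sup>2"
    define good where "good n v \<longleftrightarrow> cmod (?\<phi> n - exp (- (t\<^sup>2 * v / 2))) \<le> ?G n
      \<and> \<bar>v - (1 - 1 / real n) * (1 - \<eta>)\<bar> \<le> ?D n" for n v
    have "\<exists>v. good n v" if n: "0 < n" "r n < r0" for n
    proof -
      have e1: "4 * (r n powr \<beta> * max 1 (\<delta> powr \<beta>)) / normalizer \<beta> (r n) n = b0 / (real n * q n)"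
        using pw[of n] c q_pos[of n] n unfolding cmp b0_def by (simp add: field_simps)
      have e2: "4 * ball_moment TYPE('a) \<beta> (r n) / normalizer \<beta> (r n) n = m0 * q n / real n"
        using pw[of n] c q_pos[of n] n unfolding cmp m0_def by (simp add: field_simps power2_eq_square)
      have e3: "(ball_moment TYPE('a) \<beta> (r n))\<^sup>2 / ball_moment TYPE('a) (2 * \<beta>) (r n) = A1\<^sup>2 / A2 * (q n)\<^sup>2"
        using pw[of n] A q_pos[of n] unfolding cmp by (simp add: field_simps power2_eq_square)
      have e4: "2 * real n * (ball_moment TYPE('a) \<beta> (r n))\<^sup>2 * (C * r n) / ball_moment TYPE('a) (2 * \<beta>) (r n)
          = 2 * A1\<^sup>2 / A2 * C * (real n * r n ^ (DIM('a) + 1))"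
      proof -
        have "2 * real n * (ball_moment TYPE('a) \<beta> (r n))\<^sup>2 * (C * r n) / ball_moment TYPE('a) (2 * \<beta>) (r n)
          = 2 * real n * (C * r n) * ((ball_moment TYPE('a) \<beta> (r n))\<^sup>2 / ball_moment TYPE('a) (2 * \<beta>) (r n))"
          by simp
        then show ?thesis unfolding e3 q2 by simp
      qed
      have e5: "4 * (ball_moment TYPE('a) \<beta> (r n))\<^sup>2 / ball_moment TYPE('a) (2 * \<beta>) (r n) = 4 * A1\<^sup>2 / A2 * (q n)\<^sup>2"
        using e3 by simp
      show ?thesis
        using char_edge_sum_estimate[OF \<beta> r(1) n(2) \<delta> n(1), where t=t]
        unfolding normalizer_def[symmetric] e1 e2 e4 e5 \<delta>\<eta> good_def by blast
    qed
    then have "\<forall>n. \<exists>v. 0 < n \<and> r n < r0 \<longrightarrow> good n v" by blast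
    from choice[OF this] obtain v where "\<forall>n. 0 < n \<and> r n < r0 \<longrightarrow> good n (v n)" by blast
    then have v: "\<And>n. 0 < n \<Longrightarrow> r n < r0 \<Longrightarrow> cmod (?\<phi> n - exp (- (t\<^sup>2 * v n / 2))) \<le> ?G n"
        "\<And>n. 0 < n \<Longrightarrow> r n < r0 \<Longrightarrow> \<bar>v n - (1 - 1 / real n) * (1 - \<eta>)\<bar> \<le> ?D n"
      unfolding good_def by blast+
    have "?D \<longlonglongrightarrow> C * 0 + 4 * A1\<^sup>2 / A2 * 0\<^sup>2" by (intro tendsto_intros r q0)
    then have D0: "?D \<longlonglongrightarrow> 0" by simp
    have "(\<lambda>n. v n - (1 - 1 / real n) * (1 - \<eta>)) \<longlonglongrightarrow> 0"
      by (rule Lim_null_comparison[OF _ D0]) (use eventually_small v(2) in \<open>auto elim: eventually_mono\<close>)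
    moreover have "(\<lambda>n. (1 - 1 / real n) * (1 - \<eta>)) \<longlonglongrightarrow> (1 - 0) * (1 - \<eta>)"
      by (intro tendsto_intros lim_1_over_n)
    ultimately have "(\<lambda>n. (v n - (1 - 1 / real n) * (1 - \<eta>)) + (1 - 1 / real n) * (1 - \<eta>)) \<longlonglongrightarrow> 0 + (1 - 0) * (1 - \<eta>)"
      by (rule tendsto_add)
    then have v_lim: "v \<longlonglongrightarrow> 1 - \<eta>" by simp
    have b0m0: "0 \<le> b0" "0 \<le> m0" using c A by (auto simp: b0_def m0_def)
    have "?G \<longlonglongrightarrow> 0 + \<bar>t\<bar> * (sqrt \<eta> + sqrt (2 * A1\<^sup>2 / A2 * C * 0))"
      by (intro tendsto_intros clt_step_error_vanishes b0m0 q_pos q0 nq thin_boundary)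
    then have G: "?G \<longlonglongrightarrow> \<bar>t\<bar> * sqrt \<eta>" by simp
    have "(\<lambda>n. ?G n + \<bar>exp (- (t\<^sup>2 * v n / 2)) - exp (- (t\<^sup>2) / 2)\<bar>)
        \<longlonglongrightarrow> \<bar>t\<bar> * sqrt \<eta> + \<bar>exp (- (t\<^sup>2 * (1 - \<eta>) / 2)) - exp (- (t\<^sup>2) / 2)\<bar>"
      by (intro tendsto_add G tendsto_intros v_lim) simp_all
    then have "\<forall>\<^sub>F n in sequentially. ?G n + \<bar>exp (- (t\<^sup>2 * v n / 2)) - exp (- (t\<^sup>2) / 2)\<bar> < \<epsilon>"
      by (rule order_tendstoD(2)) (use \<eta>(3) in linarith)
    with eventually_small show ?thesis
    proof eventually_elim
      fix n assume n: "0 < n \<and> r n < r0"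
        and lt: "?G n + \<bar>exp (- (t\<^sup>2 * v n / 2)) - exp (- (t\<^sup>2) / 2)\<bar> < \<epsilon>"
      have "?\<phi> n - exp (- (t\<^sup>2) / 2) = (?\<phi> n - exp (- (t\<^sup>2 * v n / 2)))
          + complex_of_real (exp (- (t\<^sup>2 * v n / 2)) - exp (- (t\<^sup>2) / 2))"
        by (simp add: of_real_diff)
      also have "cmod \<dots> \<le> ?G n + \<bar>exp (- (t\<^sup>2 * v n / 2)) - exp (- (t\<^sup>2) / 2)\<bar>"
        by (rule norm_triangle_mono) (use v(1)[of n] n in \<open>auto simp only: norm_of_real\<close>)
      finally show "cmod (?\<phi> n - exp (- (t\<^sup>2) / 2)) < \<epsilon>" using lt by linarith
    qed
  qed
  show ?thesis unfolding tendsto_iff dist_norm using bound by blast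
qed

text \<open>
  Changing the centring multiplies the characteristic function by \<open>iexp (t * s)\<close>, where the shift \<open>s\<close>
  is at most of order \<open>sqrt (n\<^sup>2 * r n ^ (d + 2))\<close> by the deficit. The hypothesis on the boundary layer
  in the preceding theorem holds because \<open>(n * r n ^ (d + 1))\<^sup>2 = n\<^sup>2 * r n ^ (d + 2) * r n ^ d\<close>.
\<close>

theorem char_edge_sum_tendsto_ball_centred:
  fixes \<beta> t :: real and r :: "nat \<Rightarrow> real"
  assumes \<beta>: "- (real DIM('a) / 2) < \<beta>" and r: "\<And>n. 0 < r n" "r \<longlonglongrightarrow> 0"
    and many_edges: "filterlim (\<lambda>n. real n ^ 2 * r n ^ DIM('a)) at_top sequentially"
    and thin_boundary: "(\<lambda>n. real n ^ 2 * r n ^ (DIM('a) + 2)) \<longlonglongrightarrow> 0"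
  shows "(\<lambda>n. expectation (\<lambda>\<omega>. iexp (t * ((U_sum (edge_kernel \<beta> (r n)) n (\<lambda>i. X i \<omega>)
        - real n * (real n - 1) / 2 * ball_moment TYPE('a) \<beta> (r n)) / normalizer \<beta> (r n) n))))
      \<longlonglongrightarrow> exp (- (t\<^sup>2) / 2)"
proof -
  let ?T = "\<lambda>n \<omega>. (U_sum (edge_kernel \<beta> (r n)) n (\<lambda>i. X i \<omega>)
        - real n * (real n - 1) / 2 * N.energy \<beta> (r n)) / normalizer \<beta> (r n) n"
  let ?s = "\<lambda>n. real n * (real n - 1) / 2 * (N.energy \<beta> (r n) - ball_moment TYPE('a) \<beta> (r n)) / normalizer \<beta> (r n) n"
  define A1 where "A1 = unit_moment \<beta>"
  define c where "c = sqrt (unit_moment (2 * \<beta>) / 2)"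
  have \<gamma>: "- real DIM('a) < \<beta>" "- real DIM('a) < 2 * \<beta>" using \<beta> by (simp_all add: field_simps)
  have A1: "0 < A1" and c: "0 < c"
    unfolding A1_def c_def unit_moment_def using ball_moment_pos[OF \<gamma>(1)] ball_moment_pos[OF \<gamma>(2)] by simp_all
  have "(\<lambda>n. sqrt (real n ^ 2 * r n ^ (DIM('a) + 2) * r n ^ DIM('a))) \<longlonglongrightarrow> sqrt (0 * 0 ^ DIM('a))"
    by (intro tendsto_intros thin_boundary r(2))
  moreover have "real n ^ 2 * r n ^ (DIM('a) + 2) * r n ^ DIM('a) = (real n * r n ^ (DIM('a) + 1))\<^sup>2" for n
    by (simp add: power_mult_distrib power_add power2_eq_square mult_ac)
  ultimately have thin: "(\<lambda>n. real n * r n ^ (DIM('a) + 1)) \<longlonglongrightarrow> 0"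
    using r(1) by (simp add: less_imp_le zero_power)
  have "(\<lambda>n. A1 * C / (2 * c) * sqrt (real n ^ 2 * r n ^ (DIM('a) + 2))) \<longlonglongrightarrow> A1 * C / (2 * c) * sqrt 0"
    by (intro tendsto_intros thin_boundary)
  then have lim: "(\<lambda>n. A1 * C / (2 * c) * sqrt (real n ^ 2 * r n ^ (DIM('a) + 2))) \<longlonglongrightarrow> 0" by simp
  have s0: "?s \<longlonglongrightarrow> 0"
  proof (rule Lim_null_comparison[OF _ lim])
    show "\<forall>\<^sub>F n in sequentially. norm (?s n) \<le> A1 * C / (2 * c) * sqrt (real n ^ 2 * r n ^ (DIM('a) + 2))"
      using order_tendstoD(2)[OF r(2) N.r0_pos] eventually_gt_at_top[of 0]
    proof eventually_elim
      fix n :: nat assume n: "0 < n" "r n < r0"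
      define q where "q = sqrt (r n ^ DIM('a))"
      let ?A = "ball_moment TYPE('a) \<beta> (r n)" and ?\<tau> = "normalizer \<beta> (r n) n"
      have q: "0 < q" "0 < r n powr \<beta>" using r(1)[of n] by (simp_all add: q_def)
      have cmp: "?A = A1 * (r n powr \<beta> * q\<^sup>2)" "?\<tau> = c * (r n powr \<beta> * q) * real n"
        using moment_factors[OF r(1)[of n]] by (simp_all add: A1_def c_def q_def)
      have \<tau>: "0 < ?\<tau>" unfolding cmp using c q n by simp
      have A: "0 < ?A" by (rule ball_moment_pos[OF \<gamma>(1) r(1)])
      have "\<bar>N.energy \<beta> (r n) - ?A\<bar> \<le> ?A * (C * r n)"
        using N.deficit[OF \<gamma>(1) r(1) n(2)] N.energy_le[OF \<gamma>(1) r(1)[of n]]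
        by (simp add: N.energy_def algebra_simps)
      then have "real n * (real n - 1) / 2 * \<bar>N.energy \<beta> (r n) - ?A\<bar> \<le> real n * real n / 2 * (?A * (C * r n))"
        using n by (intro mult_mono divide_right_mono) auto
      then have "norm (?s n) \<le> real n * real n / 2 * (?A * (C * r n)) / ?\<tau>"
        using \<tau> n by (simp add: abs_mult divide_right_mono)
      also have "\<dots> = A1 * C / (2 * c) * (real n * (r n * q))"
        unfolding cmp using c q n by (simp add: field_simps power2_eq_square)
      also have "real n * (r n * q) = sqrt (real n ^ 2 * r n ^ (DIM('a) + 2))"
        using r(1)[of n] by (simp add: q_def real_sqrt_mult power_add less_imp_le)
      finally show "norm (?s n) \<le> A1 * C / (2 * c) * sqrt (real n ^ 2 * r n ^ (DIM('a) + 2))" .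
    qed
  qed
  have split: "iexp (t * ((U_sum (edge_kernel \<beta> (r n)) n (\<lambda>i. X i \<omega>)
        - real n * (real n - 1) / 2 * ball_moment TYPE('a) \<beta> (r n)) / normalizer \<beta> (r n) n))
      = iexp (t * ?s n) * iexp (t * ?T n \<omega>)" for n \<omega>
  proof -
    have "t * ((U_sum (edge_kernel \<beta> (r n)) n (\<lambda>i. X i \<omega>)
        - real n * (real n - 1) / 2 * ball_moment TYPE('a) \<beta> (r n)) / normalizer \<beta> (r n) n) = t * ?s n + t * ?T n \<omega>"
      unfolding distrib_left[symmetric] add_divide_distrib[symmetric] by (simp add: right_diff_distrib)
    then show ?thesis by (simp only: of_real_add distrib_left exp_add)
  qed
  have "(\<lambda>n. iexp (t * ?s n) * expectation (\<lambda>\<omega>. iexp (t * ?T n \<omega>))) \<longlonglongrightarrow> iexp (t * 0) * exp (- (t\<^sup>2) / 2)"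
    by (intro tendsto_mult char_edge_sum_tendsto \<beta> r many_edges thin tendsto_intros s0)
  then show ?thesis unfolding split by simp
qed

end

section \<open>The edge length functional as a U-statistic\<close>

text \<open>
  Selects one index for every distinct point. The functional is a sum over a set of points, and it
  has to be a measurable function of the indexed sample also where some points coincide.
\<close>

definition first_occurrence :: "(nat \<Rightarrow> 'a) \<Rightarrow> nat \<Rightarrow> real" where
  "first_occurrence u i = of_bool (\<forall>l<i. u l \<noteq> u i)"

lemma sum_image_first_occurrence:
  fixes g :: "'a \<Rightarrow> real"
  shows "sum g (u ` {..<n}) = (\<Sum>i<n. first_occurrence u i * g (u i))"
proof (induction n)
  case (Suc n)
  show ?case
  proof (cases "u n \<in> u ` {..<n}")
    case True
    then have "first_occurrence u n = 0" by (auto simp: first_occurrence_def)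
    with True Suc show ?thesis by (simp add: lessThan_Suc insert_absorb)
  next
    case False
    then have "\<forall>l<n. u l \<noteq> u n" by (metis imageI lessThan_iff)
    then have "first_occurrence u n = 1" by (simp add: first_occurrence_def)
    with False Suc show ?thesis by (simp add: lessThan_Suc)
  qed
qed simp

lemma edge_length_functional_eq_sum:
  assumes "finite P"
  shows "edge_length_functional \<beta> \<rho> P = 1 / 2 * (\<Sum>x\<in>P. \<Sum>y\<in>P. edge_kernel \<beta> \<rho> x y)"
proof -
  have "(\<Sum>(x, y)\<in>{(x, y). x \<in> P \<and> y \<in> P \<and> x \<noteq> y}. of_bool (norm (x - y) \<le> \<rho>) * norm (x - y) powr \<beta>)
      = (\<Sum>(x, y)\<in>P \<times> P. edge_kernel \<beta> \<rho> x y)"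
    using assms by (intro sum.mono_neutral_cong_left) (auto simp: edge_kernel_def)
  then show ?thesis by (simp add: edge_length_functional_def sum.cartesian_product)
qed

lemma edge_length_functional_image:
  "edge_length_functional \<beta> \<rho> (u ` {..<n})
    = 1 / 2 * (\<Sum>i<n. first_occurrence u i * (\<Sum>j<n. first_occurrence u j * edge_kernel \<beta> \<rho> (u i) (u j)))"
  by (simp only: edge_length_functional_eq_sum[OF finite_imageI[OF finite_lessThan]] sum_image_first_occurrence)

lemma sum_symmetric_kernel_eq_U_sum:
  assumes "\<And>x y. h x y = h y x" "\<And>x. h x x = 0"
  shows "(\<Sum>i<n. \<Sum>j<n. h (u i) (u j)) = 2 * U_sum h n u"
  by (induction n) (simp_all add: U_sum_def sum.distrib assms(1)[of "u _" "u _"] assms(2))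

lemma edge_length_functional_inj:
  assumes "inj_on u {..<n}"
  shows "edge_length_functional \<beta> \<rho> (u ` {..<n}) = U_sum (edge_kernel \<beta> \<rho>) n u"
proof -
  have "first_occurrence u i = 1" if "i < n" for i
    using assms that by (auto simp: first_occurrence_def dest: inj_onD)
  then have "edge_length_functional \<beta> \<rho> (u ` {..<n}) = 1 / 2 * (\<Sum>i<n. \<Sum>j<n. edge_kernel \<beta> \<rho> (u i) (u j))"
    by (simp add: edge_length_functional_image)
  also have "\<dots> = U_sum (edge_kernel \<beta> \<rho>) n u"
    by (subst sum_symmetric_kernel_eq_U_sum[OF edge_kernel_commute]) (simp_all add: edge_kernel_def)
  finally show ?thesis .
qed

lemma edge_length_functional_measurable:
  fixes Y :: "nat \<Rightarrow> 'w \<Rightarrow> 'a::euclidean_space"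
  assumes [measurable]: "\<And>i. Y i \<in> borel_measurable M"
  shows "(\<lambda>\<omega>. edge_length_functional \<beta> \<rho> ((\<lambda>i. Y i \<omega>) ` {..<n})) \<in> borel_measurable M"
  unfolding edge_length_functional_image first_occurrence_def edge_kernel_def by measurable

section \<open>Uniform points in the window\<close>

text \<open>
  A ball is connected, so it cannot leave \<open>W\<close> without meeting the frontier.
\<close>

lemma cball_subset_if_far_from_frontier:
  fixes W :: "'a::euclidean_space set"
  assumes x: "x \<in> W" and far: "\<rho> < infdist x (frontier W)" and \<rho>: "0 \<le> \<rho>"
  shows "cball x \<rho> \<subseteq> W"
proof (rule ccontr)
  assume "\<not> cball x \<rho> \<subseteq> W"
  then have "cball x \<rho> \<inter> frontier W \<noteq> {}"
    using x \<rho> by (intro connected_Int_frontier) (auto intro!: exI[of _ x] simp: disjoint_iff)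
  then obtain z where "z \<in> frontier W" "dist x z \<le> \<rho>" by auto
  with infdist_le2[OF this] far show False by simp
qed

locale uniform_density =
  fixes W :: "'a::euclidean_space set" and f :: "'a \<Rightarrow> real"
  assumes W: "W \<in> sets lebesgue" "emeasure lebesgue W = 1"
    and f_nonneg: "\<And>x. 0 \<le> f x"
    and f_integral: "(\<integral>\<^sup>+x. ennreal (f x) \<partial>lborel) = 1"
    and f_support: "{x. f x \<noteq> 0} \<subseteq> W"
    and f_uniform: "AE x\<in>W in lebesgue. f x = indicator W x"
    and f_measurable [measurable]: "f \<in> borel_measurable borel"
begin

definition N :: "'a measure" where "N = density lborel (\<lambda>x. ennreal (f x))"

lemma sets_N [measurable_cong]: "sets N = sets borel" by (simp add: N_def)

lemma prob_space_N: "prob_space N"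
  by (rule prob_spaceI) (simp add: N_def emeasure_density f_integral)

lemma f_eq_indicator: "AE x in lborel. f x = indicator W x"
proof -
  have "AE x in lebesgue. f x = indicator W x"
    using f_uniform by eventually_elim (use f_support in \<open>auto simp: indicator_def\<close>)
  then show ?thesis by (simp add: AE_completion_iff)
qed

lemma nn_integral_N_le:
  assumes [measurable]: "g \<in> borel_measurable borel"
  shows "(\<integral>\<^sup>+x. g x \<partial>N) \<le> (\<integral>\<^sup>+x. g x \<partial>lborel)"
proof -
  have "(\<integral>\<^sup>+x. g x \<partial>N) = (\<integral>\<^sup>+x. ennreal (f x) * g x \<partial>lborel)"
    unfolding N_def by (rule nn_integral_density) simp_all
  also have "\<dots> \<le> (\<integral>\<^sup>+x. g x \<partial>lborel)"
    by (rule nn_integral_mono_AE) (use f_eq_indicator in eventually_elim, auto simp: indicator_def)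
  finally show ?thesis .
qed

lemma AE_N_in_W: "AE x in N. x \<in> W"
  unfolding N_def by (subst AE_density) (use f_support in \<open>auto intro!: AE_I2\<close>)

lemma interior_section:
  assumes \<rho>: "0 < \<rho>" and \<gamma>: "- real DIM('a) < \<gamma>" and x: "x \<in> W" "\<rho> < infdist x (frontier W)"
  shows "(\<integral>y. edge_kernel \<gamma> \<rho> x y \<partial>N) = ball_moment TYPE('a) \<gamma> \<rho>"
proof -
  have sub: "cball x \<rho> \<subseteq> W" using cball_subset_if_far_from_frontier[OF x] \<rho> by simp
  have "(\<integral>\<^sup>+y. ennreal (edge_kernel \<gamma> \<rho> x y) \<partial>N) = (\<integral>\<^sup>+y. ennreal (f y) * ennreal (edge_kernel \<gamma> \<rho> x y) \<partial>lborel)"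
    unfolding N_def by (rule nn_integral_density) simp_all
  also have "\<dots> = (\<integral>\<^sup>+y. ennreal (edge_kernel \<gamma> \<rho> x y) \<partial>lborel)"
  proof (rule nn_integral_cong_AE, use f_eq_indicator in eventually_elim)
    fix y assume "f y = indicator W y"
    moreover have "edge_kernel \<gamma> \<rho> x y = 0" if "y \<notin> W"
      using that sub by (auto simp: edge_kernel_def dist_norm)
    ultimately show "ennreal (f y) * ennreal (edge_kernel \<gamma> \<rho> x y) = ennreal (edge_kernel \<gamma> \<rho> x y)"
      by (cases "y \<in> W") auto
  qed
  also have "\<dots> = ennreal (ball_moment TYPE('a) \<gamma> \<rho>)" by (rule nn_integral_edge_kernel[OF \<rho> \<gamma>])
  finally show ?thesis
    using ball_moment_nonneg[OF \<gamma>] by (intro integral_eq_nn_integral[THEN trans]) (auto simp: edge_kernel_nonneg)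
qed

lemma measure_N_boundary_layer:
  "measure N {x. infdist x (frontier W) \<le> t} = measure lebesgue {x \<in> W. infdist x (frontier W) \<le> t}"
proof -
  let ?D = "{x. infdist x (frontier W) \<le> t}"
  have D [measurable]: "?D \<in> sets borel"
    by (intro borel_closed closed_Collect_le continuous_intros)
  have "emeasure N ?D = (\<integral>\<^sup>+x. ennreal (f x) * indicator ?D x \<partial>lborel)"
    unfolding N_def by (rule emeasure_density) simp_all
  also have "\<dots> = (\<integral>\<^sup>+x. indicator (W \<inter> ?D) x \<partial>lborel)"
    by (rule nn_integral_cong_AE) (use f_eq_indicator in eventually_elim, auto simp: indicator_def)
  also have "\<dots> = (\<integral>\<^sup>+x. indicator (W \<inter> ?D) x \<partial>lebesgue)"
    by (simp only: nn_integral_completion)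
  also have "\<dots> = emeasure lebesgue (W \<inter> ?D)"
    using W(1) D by (intro nn_integral_indicator) (auto intro: sets_completionI_sets)
  also have "W \<inter> ?D = {x \<in> W. infdist x (frontier W) \<le> t}" by auto
  finally show ?thesis by (simp add: measure_def)
qed

text \<open>
  Every section mean reaches the ball integral outside the boundary layer and is nonnegative inside,
  so the relative deficit is at most the measure of the layer.
\<close>

lemma near_uniform_N:
  assumes C: "0 \<le> C" and r0: "0 < r0"
    and layer: "\<And>t. 0 < t \<Longrightarrow> t < r0 \<Longrightarrow> measure lebesgue {x \<in> W. infdist x (frontier W) \<le> t} \<le> C * t"
  shows "near_uniform N C r0"
proof -
  interpret prob_space N by (rule prob_space_N)
  show ?thesis
  proof
    fix \<gamma> \<rho> :: real assume \<gamma>: "- real DIM('a) < \<gamma>" and \<rho>: "0 < \<rho>" "\<rho> < r0"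
    let ?A = "ball_moment TYPE('a) \<gamma> \<rho>" and ?D = "{x. infdist x (frontier W) \<le> \<rho>}"
    let ?g = "\<lambda>x. \<integral>y. edge_kernel \<gamma> \<rho> x y \<partial>N"
    have A: "0 \<le> ?A" by (rule ball_moment_nonneg[OF \<gamma>])
    have D [measurable]: "?D \<in> sets borel"
      by (intro borel_closed closed_Collect_le continuous_intros)
    have g0: "0 \<le> ?g x" for x by (auto intro!: Bochner_Integration.integral_nonneg simp: edge_kernel_nonneg)
    have gA: "?g x \<le> ?A" for x
    proof -
      have "(\<integral>\<^sup>+y. ennreal (edge_kernel \<gamma> \<rho> x y) \<partial>N) \<le> ennreal ?A"
        using nn_integral_N_le[of "\<lambda>y. ennreal (edge_kernel \<gamma> \<rho> x y)"] nn_integral_edge_kernel[OF \<rho>(1) \<gamma>, of x] by simp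
      then show ?thesis using A by (intro integral_real_bounded) (auto simp: edge_kernel_nonneg)
    qed
    have "(\<lambda>(x, y). edge_kernel \<gamma> \<rho> x y) \<in> borel_measurable (N \<Otimes>\<^sub>M N)" by measurable
    then have [measurable]: "?g \<in> borel_measurable N" by (rule borel_measurable_lebesgue_integral)
    have "integrable N ?g" by (rule integrable_const_bound[where B="?A"]) (use g0 gA in auto)
    have "AE x in N. ?A * (1 - indicator ?D x) \<le> ?g x"
      using AE_N_in_W
    proof eventually_elim
      fix x assume x: "x \<in> W"
      show "?A * (1 - indicator ?D x) \<le> ?g x"
        using interior_section[OF \<rho>(1) \<gamma> x] g0[of x] by (cases "x \<in> ?D") auto
    qed
    moreover have "integrable N (\<lambda>x. ?A * (1 - indicator ?D x))"
    proof (rule integrable_const_bound[where B="?A"])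
      show "AE x in N. norm (?A * (1 - indicator ?D x)) \<le> ?A" using A by (auto simp: indicator_def)
    qed measurable
    ultimately have "(\<integral>x. ?A * (1 - indicator ?D x) \<partial>N) \<le> (\<integral>x. ?g x \<partial>N)"
      by (intro integral_mono_AE \<open>integrable N ?g\<close>)
    moreover have "(\<integral>x. ?A * (1 - indicator ?D x) \<partial>N) = ?A * (1 - measure N ?D)"
      by (simp add: prob_space sets_N emeasure_eq_measure)
    moreover have "?A * (1 - C * \<rho>) \<le> ?A * (1 - measure N ?D)"
      using layer[OF \<rho>] A by (intro mult_left_mono) (simp_all add: measure_N_boundary_layer)
    ultimately show "?A * (1 - C * \<rho>) \<le> (\<integral>x. ?g x \<partial>N)" by linarith
  qed (use C r0 sets_N nn_integral_N_le in auto)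
qed

text \<open>
  The window is only Lebesgue measurable. The Borel function \<open>f\<close> stands in for its indicator up to a
  null set, which reduces the integral over \<open>W \<times> W\<close> to the product law of two points.
\<close>

lemma energy_eq_lebesgue:
  assumes "near_uniform N C r0" and \<gamma>: "- real DIM('a) < \<gamma>" and \<rho>: "0 < \<rho>"
  shows "near_uniform.energy N \<gamma> \<rho>
    = (LINT (x, y) : W \<times> W | lebesgue. of_bool (norm (x - y) \<le> \<rho>) * norm (x - y) powr \<gamma>)"
proof -
  interpret near_uniform N C r0 by fact
  let ?h = "\<lambda>p. edge_kernel \<gamma> \<rho> (fst p) (snd p)"
  have "N \<Otimes>\<^sub>M N = density (lborel \<Otimes>\<^sub>M lborel) (\<lambda>(x, y). ennreal (f x) * ennreal (f y))"
    unfolding N_def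
    by (rule pair_measure_density)
       (auto simp: N_def[symmetric] lborel.sigma_finite_measure_axioms sigma_finite_measure_axioms)
  also have "\<dots> = density lborel (\<lambda>p. ennreal (f (fst p) * f (snd p)))"
    unfolding lborel_prod by (simp add: case_prod_beta' ennreal_mult f_nonneg)
  finally have NN: "N \<Otimes>\<^sub>M N = density lborel (\<lambda>p. ennreal (f (fst p) * f (snd p)))" .
  have "?h \<in> borel_measurable (borel \<Otimes>\<^sub>M borel)" unfolding edge_kernel_def by measurable
  then have h [measurable]: "?h \<in> borel_measurable borel" by (simp only: borel_prod)
  have "(\<lambda>p. f (fst p) * f (snd p)) \<in> borel_measurable (borel \<Otimes>\<^sub>M borel)" by measurable
  then have ff [measurable]: "(\<lambda>p. f (fst p) * f (snd p)) \<in> borel_measurable borel" by (simp only: borel_prod)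
  have "energy \<gamma> \<rho> = integral\<^sup>L (N \<Otimes>\<^sub>M N) ?h"
    using energy_eq[OF \<gamma> \<rho>] by (simp add: case_prod_beta')
  also have "\<dots> = (\<integral>p. (f (fst p) * f (snd p)) *\<^sub>R ?h p \<partial>lborel)"
    unfolding NN by (rule integral_density) (use h ff in \<open>auto simp: f_nonneg\<close>)
  also have "\<dots> = (\<integral>p. (f (fst p) * f (snd p)) *\<^sub>R ?h p \<partial>lebesgue)"
    by (rule integral_completion[symmetric]) (use h ff in simp)
  also have "\<dots> = (\<integral>p. indicator (W \<times> W) p *\<^sub>R ?h p \<partial>lebesgue)"
  proof (rule integral_cong_AE)
    obtain Z where Z: "Z \<in> null_sets lborel" "{x. f x \<noteq> indicator W x} \<subseteq> Z"
      using f_eq_indicator unfolding eventually_ae_filter by auto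
    have "Z \<times> UNIV \<in> null_sets (lborel \<Otimes>\<^sub>M lborel :: ('a \<times> 'a) measure)"
      "UNIV \<times> Z \<in> null_sets (lborel \<Otimes>\<^sub>M lborel :: ('a \<times> 'a) measure)"
      using Z(1) by auto
    then have null: "Z \<times> UNIV \<union> UNIV \<times> Z \<in> null_sets (lborel :: ('a \<times> 'a) measure)"
      unfolding lborel_prod by blast
    have "AE p in lborel. f (fst p) * f (snd p) = indicator (W \<times> W) p"
    proof (rule AE_I'[OF null], rule subsetI)
      fix p :: "'a \<times> 'a"
      assume p: "p \<in> {p \<in> space lborel. f (fst p) * f (snd p) \<noteq> indicator (W \<times> W) p}"
      show "p \<in> Z \<times> UNIV \<union> UNIV \<times> Z"
      proof (rule ccontr)
        assume "p \<notin> Z \<times> UNIV \<union> UNIV \<times> Z"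
        then have "f (fst p) = indicator W (fst p)" "f (snd p) = indicator W (snd p)"
          using Z(2) by (auto simp: mem_Times_iff)
        with p show False by (simp add: indicator_times)
      qed
    qed
    then have ae: "AE p in lebesgue. f (fst p) * f (snd p) = indicator (W \<times> W) p" by (rule AE_completion)
    show "AE p in lebesgue. (f (fst p) * f (snd p)) *\<^sub>R ?h p = indicator (W \<times> W) p *\<^sub>R ?h p"
      using ae by eventually_elim simp
    have m: "(\<lambda>p. f (fst p) * f (snd p)) \<in> borel_measurable (lebesgue :: ('a \<times> 'a) measure)"
      by (rule measurable_completion) (use ff in simp)
    have hl: "?h \<in> borel_measurable (lebesgue :: ('a \<times> 'a) measure)"
      by (rule measurable_completion) (use h in simp)
    show "(\<lambda>p. (f (fst p) * f (snd p)) *\<^sub>R ?h p) \<in> borel_measurable lebesgue"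
      using m hl by (rule borel_measurable_scaleR)
    have "W \<times> W \<in> sets (lebesgue :: ('a \<times> 'a) measure)"
    proof -
      \<comment> \<open>Off a null set \<open>W \<times> W\<close> is the Borel set where \<open>f \<otimes> f = 1\<close>.\<close>
      let ?Z = "Z \<times> UNIV \<union> UNIV \<times> Z" and ?B = "{p. f (fst p) * f (snd p) = 1}"
      have nullc: "?Z \<in> null_sets (lebesgue :: ('a \<times> 'a) measure)" using null by (rule null_sets_completionI)
      then have WZ: "(W \<times> W) \<inter> ?Z \<in> sets lebesgue"
        using null_sets_completion_subset[of "(W \<times> W) \<inter> ?Z" ?Z] by blast
      have B: "?B \<in> sets lebesgue"
        by (rule sets_completionI_sets) (use borel_measurable_eq[OF ff, of "\<lambda>_. 1"] in simp)
      have split: "W \<times> W = (?B - ?Z) \<union> ((W \<times> W) \<inter> ?Z)"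
      proof -
        have eq: "(f a * f b = 1) = (a \<in> W \<and> b \<in> W)" if "a \<notin> Z" "b \<notin> Z" for a b
        proof -
          have "f a = indicator W a" "f b = indicator W b" using Z(2) that by auto
          then show ?thesis by (simp add: indicator_def)
        qed
        show ?thesis
        proof (rule set_eqI)
          fix p show "p \<in> W \<times> W \<longleftrightarrow> p \<in> (?B - ?Z) \<union> ((W \<times> W) \<inter> ?Z)"
          proof (cases "p \<in> ?Z")
            case False
            then have "fst p \<notin> Z" "snd p \<notin> Z" by (simp_all add: mem_Times_iff)
            from eq[OF this] False show ?thesis by (simp add: mem_Times_iff)
          qed blast
        qed
      qed
      show ?thesis
        using sets.Un[OF sets.Diff[OF B null_setsD2[OF nullc]] WZ] by (simp only: split[symmetric])
    qed
    then have "(indicator (W \<times> W) :: 'a \<times> 'a \<Rightarrow> real) \<in> borel_measurable lebesgue" by simp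
    then show "(\<lambda>p. indicator (W \<times> W) p *\<^sub>R ?h p) \<in> borel_measurable lebesgue"
      using hl by (rule borel_measurable_scaleR)
  qed
  also have "\<dots> = (LINT (x, y) : W \<times> W | lebesgue. of_bool (norm (x - y) \<le> \<rho>) * norm (x - y) powr \<gamma>)"
    by (simp add: set_lebesgue_integral_def edge_kernel_def case_prod_beta')
  finally show ?thesis .
qed

end

section \<open>Convergence in distribution\<close>

lemma boundary_layer_linear_bound:
  fixes m :: "real \<Rightarrow> real"
  assumes "Limsup (at_right 0) (\<lambda>t. ereal (m t / t)) < \<infinity>"
  obtains C r0 where "0 \<le> C" "0 < r0" "\<And>t. 0 < t \<Longrightarrow> t < r0 \<Longrightarrow> m t \<le> C * t"
proof -
  obtain c :: real where c: "Limsup (at_right 0) (\<lambda>t. ereal (m t / t)) < ereal c"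
    using less_PInf_Ex_of_nat[THEN iffD1, OF less_imp_neq[OF assms]] by blast
  define C where "C = max 0 c"
  from c have "Limsup (at_right 0) (\<lambda>t. ereal (m t / t)) < ereal C"
    by (rule less_le_trans) (simp add: C_def)
  from Limsup_lessD[OF this] obtain r0 where r0: "0 < r0" "\<And>t. 0 < t \<Longrightarrow> t < r0 \<Longrightarrow> m t / t < C"
    unfolding eventually_at_right_field by auto
  show thesis
  proof (rule that[of C r0])
    fix t :: real assume "0 < t" "t < r0"
    with r0(2)[OF this] show "m t \<le> C * t" by (simp add: field_simps)
  qed (use r0(1) in \<open>simp_all add: C_def\<close>)
qed

lemma (in prob_space) indep_vars_Suc:
  assumes "indep_vars (\<lambda>_. borel) X {1::nat..}" and N: "sets N = sets borel"
  shows "indep_vars (\<lambda>_. N) (\<lambda>i. X (Suc i)) UNIV"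
proof -
  have "indep_vars (\<lambda>j. PiM {Suc j} (\<lambda>_. borel)) (\<lambda>j \<omega>. restrict (\<lambda>i. X i \<omega>) {Suc j}) (UNIV :: nat set)"
    by (rule indep_vars_restrict[OF assms(1)]) (auto simp: disjoint_family_on_def)
  from indep_vars_compose2[OF this, of "\<lambda>j g. g (Suc j)" "\<lambda>_. N"]
  show ?thesis using N by (simp cong: measurable_cong_sets)
qed

text \<open>
  Two independent points with an atomless law coincide with probability zero, by Fubini.
\<close>

lemma (in near_uniform_sample) AE_sample_inj:
  assumes null: "\<And>x. emeasure N {x} = 0"
  shows "AE \<omega> in M. inj (\<lambda>i. X i \<omega>)"
proof -
  have ne: "AE \<omega> in M. X i \<omega> \<noteq> X j \<omega>" if ij: "i \<noteq> j" for i j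
  proof -
    have pred: "{p \<in> space (N \<Otimes>\<^sub>M N). fst p \<noteq> snd p} \<in> sets (N \<Otimes>\<^sub>M N)"
      by measurable
    have "AE p in N \<Otimes>\<^sub>M N. fst p \<noteq> snd p"
    proof (rule N.square.AE_pair_measure[OF pred], rule AE_I2)
      fix x
      show "AE y in N. fst (x, y) \<noteq> snd (x, y)"
        by (rule AE_I[where N="{x}"]) (auto simp: null N.sets_N)
    qed
    then have "AE p in distr M (N \<Otimes>\<^sub>M N) (\<lambda>\<omega>. (X i \<omega>, X j \<omega>)). fst p \<noteq> snd p"
      unfolding distr_pair[OF ij] .
    then show ?thesis by (subst (asm) AE_distr_iff) (use pred in auto)
  qed
  have "AE \<omega> in M. \<forall>i j. i \<noteq> j \<longrightarrow> X i \<omega> \<noteq> X j \<omega>"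
    unfolding AE_all_countable using ne by auto
  then show ?thesis by eventually_elim (auto simp: inj_def)
qed

lemma (in prob_space) weak_conv_std_normal:
  assumes F [measurable]: "\<And>n. F n \<in> borel_measurable M"
    and ae: "\<And>n. AE \<omega> in M. F n \<omega> = G n \<omega>" and G [measurable]: "\<And>n. G n \<in> borel_measurable M"
    and char: "\<And>t. (\<lambda>n. expectation (\<lambda>\<omega>. iexp (t * G n \<omega>))) \<longlonglongrightarrow> exp (- (t\<^sup>2) / 2)"
  shows "weak_conv_m (\<lambda>n. distr M borel (F n)) std_normal_distribution"
proof (rule levy_continuity)
  show "real_distribution (distr M borel (F n))" for n by (rule real_distribution_distr) simp
  show "real_distribution std_normal_distribution" by (rule real_dist_normal_dist)
  fix t
  have "char (distr M borel (F n)) t = expectation (\<lambda>\<omega>. iexp (t * G n \<omega>))" for n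
  proof -
    have "char (distr M borel (F n)) t = expectation (\<lambda>\<omega>. iexp (t * F n \<omega>))"
      unfolding char_def by (rule integral_distr) measurable
    also have "\<dots> = expectation (\<lambda>\<omega>. iexp (t * G n \<omega>))"
      by (rule integral_cong_AE) (use ae[of n] in \<open>measurable, eventually_elim, simp\<close>)
    finally show ?thesis .
  qed
  then show "(\<lambda>n. char (distr M borel (F n)) t) \<longlonglongrightarrow> char std_normal_distribution t"
    using char by (simp add: char_std_normal_distribution)
qed

theorem corollary2p5:
  fixes W :: "'a::euclidean_space set"
    and f :: "'a \<Rightarrow> real"
    and M :: "'w measure"
    and X :: "nat \<Rightarrow> 'w \<Rightarrow> 'a"
    and r :: "nat \<Rightarrow> real"
    and \<beta> :: real
  assumes "W \<in> sets lebesgue" and "emeasure lebesgue W = 1"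
    and "\<And>x. 0 \<le> f x" and "(\<integral>\<^sup>+x. ennreal (f x) \<partial>lborel) = 1" and "{x. f x \<noteq> 0} \<subseteq> W"
    and "prob_space M"
    and "prob_space.indep_vars M (\<lambda>_. borel) X {1..}"
    and "\<And>i. i \<ge> 1 \<Longrightarrow> distributed M lborel (X i) (\<lambda>x. ennreal (f x))"
    and "\<And>n. 0 < r n" and "r \<longlonglongrightarrow> 0"
    and "\<beta> > - (real DIM('a) / 2)"
    and "AE x\<in>W in lebesgue. f x = indicator W x"
    and "Limsup (at_right 0)
           (\<lambda>t. ereal (measure lebesgue {x \<in> W. infdist x (frontier W) \<le> t} / t)) < \<infinity>"
  shows
    "(filterlim (\<lambda>n. real n ^ 2 * r n ^ DIM('a)) at_top sequentially \<and>
      (\<lambda>n. real n * r n ^ (DIM('a) + 1)) \<longlonglongrightarrow> 0 \<longrightarrow>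
      weak_conv_m
        (\<lambda>n. distr M borel (\<lambda>\<omega>.
           (edge_length_functional \<beta> (r n) ((\<lambda>i. X i \<omega>) ` {1..n})
            - real n * (real n - 1) / 2 *
              (LINT (x, y) : W \<times> W | lebesgue.
                 of_bool (norm (x - y) \<le> r n) * norm (x - y) powr \<beta>))
           / (sqrt (real DIM('a) * unit_ball_vol (real DIM('a)) / (2 * (2 * \<beta> + real DIM('a))))
              * real n * r n powr (\<beta> + real DIM('a) / 2))))
        std_normal_distribution) \<and>
     (filterlim (\<lambda>n. real n ^ 2 * r n ^ DIM('a)) at_top sequentially \<and>
      (\<lambda>n. real n ^ 2 * r n ^ (DIM('a) + 2)) \<longlonglongrightarrow> 0 \<longrightarrow>
      weak_conv_m
        (\<lambda>n. distr M borel (\<lambda>\<omega>.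
           (edge_length_functional \<beta> (r n) ((\<lambda>i. X i \<omega>) ` {1..n})
            - real DIM('a) * unit_ball_vol (real DIM('a)) / (2 * (\<beta> + real DIM('a)))
              * (real n * (real n - 1)) * r n powr (\<beta> + real DIM('a)))
           / (sqrt (real DIM('a) * unit_ball_vol (real DIM('a)) / (2 * (2 * \<beta> + real DIM('a))))
              * real n * r n powr (\<beta> + real DIM('a) / 2))))
        std_normal_distribution)"
proof -
  have f_meas: "f \<in> borel_measurable borel"
  proof -
    have "(\<lambda>x. ennreal (f x)) \<in> borel_measurable lborel"
      using assms(8)[of 1] by (simp add: distributed_def)
    then have "(\<lambda>x. enn2real (ennreal (f x))) \<in> borel_measurable lborel" by measurable
    then show ?thesis using assms(3) by simp
  qed
  interpret D: uniform_density W f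
    by unfold_locales (use assms f_meas in auto)
  obtain C r0 where layer: "0 \<le> C" "0 < r0"
    "\<And>t. 0 < t \<Longrightarrow> t < r0 \<Longrightarrow> measure lebesgue {x \<in> W. infdist x (frontier W) \<le> t} \<le> C * t"
    using boundary_layer_linear_bound[OF assms(13)] by blast
  have NU: "near_uniform D.N C r0" by (rule D.near_uniform_N[OF layer])
  interpret M: prob_space M by fact
  let ?Y = "\<lambda>i. X (Suc i)"
  have dist_N: "distr M D.N (X i) = D.N" if "i \<ge> 1" for i
  proof -
    have "distr M D.N (X i) = distr M lborel (X i)" by (rule distr_cong) (simp_all add: D.sets_N)
    then show ?thesis using distributed_distr_eq_density[OF assms(8)[OF that]] by (simp add: D.N_def)
  qed
  interpret near_uniform_sample M D.N ?Y C r0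
    by (intro near_uniform_sample.intro iid_sample.intro iid_sample_axioms.intro NU
        D.prob_space_N M.prob_space_axioms M.indep_vars_Suc[OF assms(7)] D.sets_N dist_N) simp
  have Y_meas: "?Y i \<in> borel_measurable M" for i
    using X_measurable[of i] by (simp cong: measurable_cong_sets add: D.sets_N)
  have image: "(\<lambda>i. X i \<omega>) ` {1..n} = (\<lambda>i. ?Y i \<omega>) ` {..<n}" for \<omega> n
    unfolding image_Suc_lessThan[symmetric] image_image ..
  have "emeasure D.N {x} = 0" for x
    unfolding D.N_def by (subst emeasure_density) (auto simp: f_meas intro!: nn_integral_0_iff_AE[THEN iffD2] AE_I[where N="{x}"])
  then have inj: "AE \<omega> in M. inj (\<lambda>i. ?Y i \<omega>)" by (rule AE_sample_inj)
  have functional: "AE \<omega> in M. edge_length_functional \<beta> (r n) ((\<lambda>i. X i \<omega>) ` {1..n})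
      = U_sum (edge_kernel \<beta> (r n)) n (\<lambda>i. ?Y i \<omega>)" for n
    using inj unfolding image by eventually_elim (rule edge_length_functional_inj, auto intro: inj_on_subset)
  have functional_meas [measurable]:
    "(\<lambda>\<omega>. edge_length_functional \<beta> (r n) ((\<lambda>i. X i \<omega>) ` {1..n})) \<in> borel_measurable M" for n
    unfolding image by (rule edge_length_functional_measurable) (rule Y_meas)
  have kernel_meas: "case_prod (edge_kernel \<beta> (r n)) \<in> borel_measurable (D.N \<Otimes>\<^sub>M D.N)" for n
    by measurable
  have U_meas [measurable]: "(\<lambda>\<omega>. U_sum (edge_kernel \<beta> (r n)) n (\<lambda>i. ?Y i \<omega>)) \<in> borel_measurable M" for n
    by (rule U_sum_measurable[OF kernel_meas])
  have \<beta>: "- (real DIM('a) / 2) < \<beta>" using assms(11) by simp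
  have \<beta>': "- real DIM('a) < \<beta>" using \<beta> by (simp add: field_simps)
  have r_pos: "0 < r n" for n by (rule assms(9))
  have norm_eq: "sqrt (real DIM('a) * unit_ball_vol (real DIM('a)) / (2 * (2 * \<beta> + real DIM('a))))
              * real n * r n powr (\<beta> + real DIM('a) / 2) = normalizer \<beta> (r n) n" for n
  proof -
    have "r n powr (2 * \<beta> + real DIM('a)) = (r n powr (\<beta> + real DIM('a) / 2))\<^sup>2"
      using r_pos[of n] by (simp add: powr_power algebra_simps)
    then have "ball_moment TYPE('a) (2 * \<beta>) (r n) / 2
        = real DIM('a) * unit_ball_vol (real DIM('a)) / (2 * (2 * \<beta> + real DIM('a))) * (r n powr (\<beta> + real DIM('a) / 2))\<^sup>2"
      by (simp add: ball_moment_def)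
    then have "sqrt (ball_moment TYPE('a) (2 * \<beta>) (r n) / 2)
        = sqrt (real DIM('a) * unit_ball_vol (real DIM('a)) / (2 * (2 * \<beta> + real DIM('a)))) * r n powr (\<beta> + real DIM('a) / 2)"
      by (simp only: real_sqrt_mult) simp
    then show ?thesis by (simp add: normalizer_def)
  qed
  have energy: "(LINT (x, y) : W \<times> W | lebesgue. of_bool (norm (x - y) \<le> r n) * norm (x - y) powr \<beta>)
      = N.energy \<beta> (r n)" for n
    by (rule D.energy_eq_lebesgue[OF NU \<beta>' r_pos, symmetric])
  have ball: "real DIM('a) * unit_ball_vol (real DIM('a)) / (2 * (\<beta> + real DIM('a)))
              * (real n * (real n - 1)) * r n powr (\<beta> + real DIM('a))
      = real n * (real n - 1) / 2 * ball_moment TYPE('a) \<beta> (r n)" for n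
    by (simp add: ball_moment_def)
  have weak: "weak_conv_m (\<lambda>n. distr M borel (\<lambda>\<omega>.
        (edge_length_functional \<beta> (r n) ((\<lambda>i. X i \<omega>) ` {1..n}) - a n) / normalizer \<beta> (r n) n))
      std_normal_distribution"
    if "\<And>t. (\<lambda>n. M.expectation (\<lambda>\<omega>. iexp (t * ((U_sum (edge_kernel \<beta> (r n)) n (\<lambda>i. ?Y i \<omega>) - a n)
        / normalizer \<beta> (r n) n)))) \<longlonglongrightarrow> exp (- (t\<^sup>2) / 2)" for a :: "nat \<Rightarrow> real"
  proof (rule M.weak_conv_std_normal[OF _ _ _ that])
    show "AE \<omega> in M. (edge_length_functional \<beta> (r n) ((\<lambda>i. X i \<omega>) ` {1..n}) - a n) / normalizer \<beta> (r n) n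
        = (U_sum (edge_kernel \<beta> (r n)) n (\<lambda>i. ?Y i \<omega>) - a n) / normalizer \<beta> (r n) n" for n
      using functional[of n] by eventually_elim simp
  qed measurable
  show ?thesis
    unfolding norm_eq energy ball
    using weak[OF char_edge_sum_tendsto[OF \<beta> r_pos assms(10)]]
      weak[OF char_edge_sum_tendsto_ball_centred[OF \<beta> r_pos assms(10)]] by blast
qed

end
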